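(* Run the zeroth-order LQR tracking algorithm described in the context with minibatch size $m\ge1$, from an initial policy $(K_0,\tilde K_0)$ with $\sqrt\gamma\rho(A+BK_0)<1$. Let $\epsilon>0$ and suppose the step size $\eta>0$ and smoothing radius $r>0$ satisfy $$\eta\le\min\Big\{\frac{m\epsilon\mu}{240LZ_2},\ \frac{1}{4L},\ \frac{\rho}{Z_\infty}\Big\},\qquad r\le\min\Big\{\sqrt{\frac{\epsilon\mu}{240L^2}},\ \rho\Big\}.$$ Let $\Delta_0=J(K_0,\tilde K_0)-J^{\mathrm{opt}}$. If the error tolerance $\epsilon$ satisfies $\epsilon\log(120\Delta_0/\epsilon)\le5\Delta_0$, then after $T=\frac{4}{\mu\eta}\log(120\Delta_0/\epsilon)$ steps the iterate produced by the algorithm satisfies $$J(K_T,\tilde K_T)-J^{\mathrm{opt}}\le\epsilon$$ with probability at least $3/4$.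
   Context: Setting (discounted LQR tracking). Fix integers $n,k\ge1$, $A\in\mathbb{R}^{n\times n}$, $B\in\mathbb{R}^{n\times k}$ with $(A,B)$ controllable, symmetric positive definite $Q\in\mathbb{R}^{n\times n}$, $R\in\mathbb{R}^{k\times k}$, $\Sigma\in\mathbb{R}^{n\times n}$, $0<\gamma<1$, $x^*\in\mathbb{R}^n$. The initial state $x_0$ has distribution $\mathcal{D}$ with $\mathbb{E}[x_0]=0$, $\mathbb{E}[x_0x_0^\top]=\Sigma$, and $\|x_0\|\le C_n$ for all $x_0$ in its support, for some $C_n>0$. A policy $\hat K=(K,\tilde K)$, $K,\tilde K\in\mathbb{R}^{k\times n}$, generates $x_{t+1}=Ax_t+Bu_t$, $u_t=Kx_t+\tilde Kx^*$. Let $J(\hat K;x_0)=\sum_{t\ge0}\gamma^t((x_t-x^* )^\top Q(x_t-x^* )+u_t^\top Ru_t)$ for given $x_0$, $J(\hat K)=\mathbb{E}_{x_0\sim\mathcal D}[J(\hat K;x_0)]\in[0,\infty]$, and $J^{\mathrm{opt}}=\min_{\hat K}J(\hat K)$. $\|\cdot\|$ is the Euclidean (Frobenius) norm; in $\rho(\cdot)$ with a matrix argument $\rho$ is the spectral radius. Gradient estimator: let $d=2nk$ and identify $\hat K$ with a vector in $\mathbb{R}^d$. For $r>0$ and a unit vector $\delta\in\mathbb{R}^d$, $$z_r(\hat K;x_0,\delta)=d\,\frac{J(\hat K+r\delta;x_0)-J(\hat K-r\delta;x_0)}{2r}\,\delta .$$ Algorithm: for $t=0,1,\dots,T-1$,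 sample independently $(x_0)_t^i\sim\mathcal{D}$ and $\delta_t^i$ uniform on the unit sphere $\mathbb{S}^{d-1}$, $i=1,\dots,m$; set $z_t=\frac1m\sum_{i=1}^m z_r(\hat K_t;(x_0)_t^i,\delta_t^i)$ and $\hat K_{t+1}=\hat K_t-\eta z_t$, where $\hat K_t=(K_t,\tilde K_t)$. $T$ is treated as an integer. Constants: $\mu>0$ is a constant with $J(\hat K)-J^{\mathrm{opt}}\le\frac1\mu\|\nabla J(\hat K)\|^2$ for all $\hat K=(K,\tilde K)$ with $\sqrt\gamma\rho(A+BK)<1$. Let $J_0=J(K_0,\tilde K_0)$ and $\mathcal{G}_{10J_0}=\{\hat K:J(\hat K)\le10J_0\}$. The constants $\rho,\lambda,L>0$ are such that whenever $\hat K\in\mathcal{G}_{10J_0}$ and $\|\hat K'-\hat K\|\le\rho$: $|J(\hat K')-J(\hat K)|\le\lambda\|\hat K'-\hat K\|$, $|J(\hat K';x_0)-J(\hat K;x_0)|\le\lambda\|\hat K'-\hat K\|$ for all $x_0$ in the support of $\mathcal D$, and $\|\nabla J(\hat K')-\nabla J(\hat K)\|\le L\|\hat K'-\hat K\|$. Finally $$Z_\infty=\sup_{\hat K\in\mathcal{G}_{10J_0},\,x_0,\,\delta}\|z_r(\hat K;x_0,\delta)\|,\qquad Z_2=\sup_{\hat K\in\mathcal{G}_{10J_0}}\mathbb{E}\big[\|z_r(\hat K;x_0,\delta)-\mathbb{E}[z_r(\hat K;x_0,\delta)\mid\hat K]\|^2\big],$$ where $x_0$ ranges over the support of $\mathcal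 D$ and $\delta$ over $\mathbb{S}^{d-1}$ in the first, and $x_0\sim\mathcal D$, $\delta\sim\mathrm{Unif}(\mathbb{S}^{d-1})$ in the second. *)

theory Defs
  imports "HOL-Probability.Probability"
begin

section \<open>Linear algebra\<close>

definition pos_def :: "real^'n^'n \<Rightarrow> bool" where
  "pos_def M \<longleftrightarrow> transpose M = M \<and> (\<forall>x. x \<noteq> 0 \<longrightarrow> 0 < x \<bullet> (M *v x))"

text \<open>The Kalman rank condition: the columns of \<open>B, A B, \<dots>, A\<^sup>n\<^sup>-\<^sup>1 B\<close> span a space of
  dimension \<open>n\<close>. The power is written as an iterate of \<open>(**) A\<close>, since \<open>*\<close> and \<open>^\<close> on
  \<open>real^'n^'n\<close> act componentwise.\<close>

definition controllable :: "real^'n^'n \<Rightarrow> real^'k^'n \<Rightarrow> bool" where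
  "controllable A B \<longleftrightarrow> dim (\<Union>i<CARD('n). columns ((((**) A) ^^ i) B)) = CARD('n)"

definition spectral_radius :: "real^'n^'n \<Rightarrow> real" where
  "spectral_radius M =
     Max (cmod ` {z. \<exists>v::complex^'n. v \<noteq> 0 \<and> (\<chi> i j. complex_of_real (M $ i $ j)) *v v = z *s v})"

section \<open>Gradients and probability\<close>

definition grad :: "('a::real_inner \<Rightarrow> real) \<Rightarrow> 'a \<Rightarrow> 'a" where
  "grad f x = (THE g. GDERIV f x :> g)"

definition msupport :: "'a::topological_space measure \<Rightarrow> 'a set" where
  "msupport D = {x. \<forall>U. open U \<and> x \<in> U \<longrightarrow> 0 < emeasure D U}"

text \<open>The uniform distribution on the unit sphere (normalized surface measure), obtained by
  projecting the uniform distribution on the unit ball radially; \<open>sgn v = v /\<^sub>R norm v\<close>.\<close>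

definition unif_sphere :: "'a::euclidean_space measure" where
  "unif_sphere = distr (uniform_measure lborel (ball 0 1)) borel sgn"

text \<open>The distance \<open>\<bar>a - b\<bar>\<close> on \<open>[0,\<infinity>]\<close>. It is infinite as soon as one of \<open>a\<close>, \<open>b\<close> is
  (as \<open>\<infinity> - \<infinity> = \<infinity>\<close> in \<^typ>\<open>ereal\<close>), so a finite bound on it entails that both are finite.\<close>

definition edist :: "ennreal \<Rightarrow> ennreal \<Rightarrow> ereal" where
  "edist a b = \<bar>enn2ereal a - enn2ereal b\<bar>"

section \<open>Discounted LQR tracking\<close>

text \<open>A policy is a pair \<open>(K, K')\<close> of gain matrices. The Euclidean structure of this type is that of
  \<open>\<real>\<^sup>d\<close> with \<open>d = 2 n k\<close>; its norm is the Frobenius norm.\<close>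

type_synonym ('n, 'k) policy = "(real^'n^'k) \<times> (real^'n^'k)"

definition control :: "real^'n \<Rightarrow> ('n::finite, 'k::finite) policy \<Rightarrow> real^'n \<Rightarrow> real^'k" where
  "control xs K x = fst K *v x + snd K *v xs"

primrec state :: "real^'n^'n \<Rightarrow> real^'k^'n \<Rightarrow> real^'n \<Rightarrow> ('n::finite, 'k::finite) policy
    \<Rightarrow> real^'n \<Rightarrow> nat \<Rightarrow> real^'n" where
  "state A B xs K x0 0 = x0"
| "state A B xs K x0 (Suc t) =
     A *v state A B xs K x0 t + B *v control xs K (state A B xs K x0 t)"

definition cost_from :: "real^'n^'n \<Rightarrow> real^'k^'n \<Rightarrow> real^'n^'n \<Rightarrow> real^'k^'k \<Rightarrow> real \<Rightarrow> real^'n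
    \<Rightarrow> ('n::finite, 'k::finite) policy \<Rightarrow> real^'n \<Rightarrow> ennreal" where
  "cost_from A B Q R \<gamma> xs K x0 =
     (\<Sum>t. ennreal (\<gamma> ^ t *
        (let x = state A B xs K x0 t; u = control xs K x
         in (x - xs) \<bullet> (Q *v (x - xs)) + u \<bullet> (R *v u))))"

definition cost :: "real^'n^'n \<Rightarrow> real^'k^'n \<Rightarrow> real^'n^'n \<Rightarrow> real^'k^'k \<Rightarrow> real \<Rightarrow> real^'n
    \<Rightarrow> (real^'n) measure \<Rightarrow> ('n::finite, 'k::finite) policy \<Rightarrow> ennreal" where
  "cost A B Q R \<gamma> xs D K = (\<integral>\<^sup>+x0. cost_from A B Q R \<gamma> xs K x0 \<partial>D)"

section \<open>The zeroth-order method\<close>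

text \<open>The two-point estimator for a family \<open>F\<close> of costs; it is meaningful where
  \<open>F (K + r \<delta>) x0\<close> and \<open>F (K - r \<delta>) x0\<close> are finite.\<close>

definition two_point :: "(('n::finite, 'k::finite) policy \<Rightarrow> real^'n \<Rightarrow> ennreal) \<Rightarrow> real
    \<Rightarrow> ('n, 'k) policy \<Rightarrow> real^'n \<Rightarrow> ('n, 'k) policy \<Rightarrow> ('n, 'k) policy" where
  "two_point F r K x0 \<delta> =
     (real (2 * CARD('n) * CARD('k)) *
       ((enn2real (F (K + r *\<^sub>R \<delta>) x0) - enn2real (F (K - r *\<^sub>R \<delta>) x0)) / (2 * r))) *\<^sub>R \<delta>"

definition estimator_bound :: "('n::finite, 'k::finite) policy set \<Rightarrow> (real^'n) measure
    \<Rightarrow> (('n, 'k) policy \<Rightarrow> real^'n \<Rightarrow> ('n, 'k) policy \<Rightarrow> ('n, 'k) policy) \<Rightarrow> ennreal" where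
  "estimator_bound G D z =
     (SUP K\<in>G. SUP x0\<in>msupport D. SUP \<delta>\<in>sphere 0 1. ennreal (norm (z K x0 \<delta>)))"

definition estimator_variance :: "('n::finite, 'k::finite) policy set \<Rightarrow> (real^'n) measure
    \<Rightarrow> (('n, 'k) policy \<Rightarrow> real^'n \<Rightarrow> ('n, 'k) policy \<Rightarrow> ('n, 'k) policy) \<Rightarrow> ennreal" where
  "estimator_variance G D z =
     (SUP K\<in>G. \<integral>\<^sup>+(x0, \<delta>).
        ennreal ((norm (z K x0 \<delta> - (\<integral>(x0', \<delta>'). z K x0' \<delta>' \<partial>(D \<Otimes>\<^sub>M unif_sphere))))\<^sup>2)
      \<partial>(D \<Otimes>\<^sub>M unif_sphere))"

primrec iterate :: "(('n::finite, 'k::finite) policy \<Rightarrow> real^'n \<Rightarrow> ('n, 'k) policy \<Rightarrow> ('n, 'k) policy)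
    \<Rightarrow> real \<Rightarrow> nat \<Rightarrow> ('n, 'k) policy \<Rightarrow> (nat \<Rightarrow> nat \<Rightarrow> real^'n) \<Rightarrow> (nat \<Rightarrow> nat \<Rightarrow> ('n, 'k) policy)
    \<Rightarrow> nat \<Rightarrow> ('n, 'k) policy" where
  "iterate z \<eta> m K0 x \<delta> 0 = K0"
| "iterate z \<eta> m K0 x \<delta> (Suc t) =
     iterate z \<eta> m K0 x \<delta> t
       - \<eta> *\<^sub>R ((1 / real m) *\<^sub>R (\<Sum>i=1..m. z (iterate z \<eta> m K0 x \<delta> t) (x t i) (\<delta> t i)))"

end

theory Submission
  imports Defs "HOL-Computational_Algebra.Fundamental_Theorem_Algebra"
begin

text \<open>
  The method is stochastic gradient descent on a function \<open>J\<close> that is smooth on a sublevel set only.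
  The proof combines an expected descent inequality on that set with a stopping argument. Four points
  carry it.

  \<^item> \<^emph>\<open>Where \<open>J\<close> is finite it is a rational function.\<close> In the coordinates \<open>y = (x, 1)\<close> the closed loop
    is linear, \<open>y\<^sub>t\<^sub>+\<^sub>1 = M y\<^sub>t\<close>, and the stage cost is a linear function of \<open>y\<^sub>t \<otimes> y\<^sub>t = (M \<otimes> M)\<^sup>t (y\<^sub>0 \<otimes> y\<^sub>0)\<close>.
    The second moment of \<open>y\<^sub>0\<close> is positive definite, so a finite cost forces \<open>\<Sum>\<^sub>t \<gamma>\<^sup>t \<parallel>M\<^sup>t\<parallel>\<^sup>2 < \<infinity>\<close>
    (\<open>finite_cost_imp_summable\<close>). This gives \<open>\<surd>\<gamma> \<rho>(A + B K) < 1\<close>, under which the gradient domination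
    inequality is assumed, and it makes the Neumann series of \<open>I - \<gamma> M \<otimes> M\<close> converge. Cramer's rule then expresses
    \<open>J\<close> through determinants of matrices that are polynomial in the policy (\<open>finite_cost_rational\<close>), and
    \<open>J\<close> is differentiable. Finiteness itself comes from the Lipschitz hypothesis: the distance of \<open>\<infinity>\<close> to
    itself is \<open>\<infinity>\<close>, so no policy in the sublevel set \<open>G\<close>, nor within \<open>\<rho>\<close> of it, has infinite cost.

  \<^item> \<^emph>\<open>The bias of the estimator is at most \<open>L r\<close>, without a dimension factor.\<close> By the divergence theorem
    \<open>d E[f(\<delta>) \<delta>]\<close> over the unit sphere is the average of the gradient of \<open>f\<close> over the unit ball; it is therefore as close
    to the gradient at the centre as the gradients in the ball are (\<open>sphere_gradient_bound\<close>).

  \<^item> \<^emph>\<open>One step.\<close> Write \<open>\<Delta> = J - J\<^sup>o\<^sup>p\<^sup>t\<close> and \<open>c = \<eta> \<mu> / 2\<close>. Smoothness, the bias bound, the variance of a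
    minibatch and gradient domination give \<open>E \<Delta>(K\<^sub>t\<^sub>+\<^sub>1) \<le> (1 - c) \<Delta>(K\<^sub>t) + c \<epsilon> / 120\<close> for \<open>K\<^sub>t \<in> G\<close>
    (\<open>expected_descent\<close>). Here \<open>c \<le> 1\<close>, because the constant of gradient domination cannot exceed
    twice the smoothness constant (\<open>PL_constant_le_smoothness\<close>).

  \<^item> \<^emph>\<open>Stopping.\<close> The one-step bound says nothing outside \<open>G\<close>, so the iteration is frozen when it leaves
    \<open>G\<close>. Outside \<open>G\<close> the gap is at least \<open>10 \<Delta>\<^sub>0\<close>. The potential that equals \<open>\<Delta>\<close> on \<open>G\<close> and \<open>10 \<Delta>\<^sub>0\<close> elsewhere grows
    by at most \<open>c \<epsilon> / 120\<close> per step in expectation, and it stays below \<open>(13/12) \<Delta>\<^sub>0\<close> up to time \<open>T\<close> by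
    the assumption on \<open>\<epsilon>\<close>; hence the iterates leave \<open>G\<close> with probability at most \<open>13/120\<close>. The gap of the
    surviving iterates contracts to an expectation of at most \<open>\<epsilon> / 60\<close>, so it exceeds \<open>\<epsilon>\<close> with probability at most
    \<open>1/60\<close>. In total the failure probability is at most \<open>1/8\<close> (\<open>descent_success_probability\<close>).
\<close>

section \<open>Eigenvalues of a complex matrix\<close>

lemma eigenvalue_iff_det:
  fixes M :: "complex^'n^'n"
  shows "(\<exists>v. v \<noteq> 0 \<and> M *v v = z *s v) \<longleftrightarrow> det (mat z - M) = 0"
proof -
  have "M *v v = z *s v \<longleftrightarrow> (mat z - M) *v v = 0" for v
  proof -
    have "mat z *v v = z *s v"
      by (simp add: vec_eq_iff matrix_vector_mult_def mat_def if_distrib[of "\<lambda>x. x * _"] cong: if_cong)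
    then have "(mat z - M) *v v = z *s v - M *v v"
      by (metis matrix_vector_mult_diff_rdistrib)
    then show ?thesis by auto
  qed
  then show ?thesis
    using invertible_det_nz[of "mat z - M"] invertible_left_inverse[of "mat z - M"]
      matrix_left_invertible_ker[of "mat z - M"] by auto
qed

lemma tendsto_det:
  fixes f :: "'a \<Rightarrow> complex^'n^'n"
  assumes "\<And>i j. ((\<lambda>x. f x $ i $ j) \<longlongrightarrow> N $ i $ j) F"
  shows "((\<lambda>x. det (f x)) \<longlongrightarrow> det N) F"
  unfolding det_def by (intro tendsto_intros assms)

text \<open>The spectral radius is a maximum over the set of eigenvalues, which is a meaningful number only if
  that set is finite and nonempty. Both follow once the characteristic polynomial is known to be
  nonconstant. It is: \<open>det (I - M / z)\<close> tends to \<open>1\<close> as \<open>z\<close>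
  grows, whereas it would tend to \<open>0\<close> if \<open>det (z I - M) = z\<^sup>n det (I - M /
  z)\<close> were constant.\<close>

lemma eigenvalues_finite_nonempty:
  fixes M :: "complex^'n^'n"
  shows "finite {z. \<exists>v. v \<noteq> 0 \<and> M *v v = z *s v}"
    and "{z. \<exists>v. v \<noteq> 0 \<and> M *v v = z *s v} \<noteq> {}"
proof -
  define p where "p = det ((\<chi> i j. (if i = j then [:0,1:] else 0) - [:M $ i $ j:]) :: complex poly^'n^'n)"
  have p: "poly p z = det (mat z - M)" for z
    unfolding p_def det_def
    by (simp add: poly_sum poly_prod mat_def of_int_poly) (intro sum.cong prod.cong arg_cong2[where f="(*)"] refl; simp)
  have const: "degree p \<noteq> 0"
  proof
    assume "degree p = 0"
    then obtain c where c: "p = [:c:]" by (metis degree_eq_zeroE)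
    have nz: "inverse z ^ CARD('n) * c = det (mat 1 - (\<chi> i j. inverse z * M $ i $ j))" if z: "z \<noteq> 0" for z
    proof -
      have "det (mat 1 - (\<chi> i j. inverse z * M $ i $ j)) = det (\<chi> i. inverse z *s ((mat z - M) $ i))"
        using z by (intro arg_cong[where f=det]) (auto simp: vec_eq_iff mat_def algebra_simps)
      also have "\<dots> = inverse z ^ CARD('n) * det (mat z - M)"
        by (subst det_rows_mul) simp
      finally show ?thesis using p[of z] c by simp
    qed
    have pos: "of_nat (Suc k) \<noteq> (0::complex)" for k by (simp only: of_nat_eq_0_iff)
    have inv: "(\<lambda>k. inverse (of_nat (Suc k)) :: complex) \<longlonglongrightarrow> 0"
      by (rule tendsto_norm_zero_cancel)
        (use LIMSEQ_inverse_real_of_nat in \<open>simp add: norm_inverse del: of_nat_Suc\<close>)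
    have "(\<lambda>k. det (mat 1 - (\<chi> i j. inverse (of_nat (Suc k)) * M $ i $ j))) \<longlonglongrightarrow> det (mat 1 :: complex^'n^'n)"
    proof (rule tendsto_det)
      fix i j
      have "(\<lambda>k. mat 1 $ i $ j - inverse (of_nat (Suc k)) * M $ i $ j) \<longlonglongrightarrow> (mat 1 $ i $ j :: complex) - 0 * M $ i $ j"
        by (intro tendsto_intros inv)
      then show "(\<lambda>k. (mat 1 - (\<chi> i j. inverse (of_nat (Suc k)) * M $ i $ j)) $ i $ j) \<longlonglongrightarrow> (mat 1 :: complex^'n^'n) $ i $ j"
        by simp
    qed
    moreover have "(\<lambda>k. inverse (of_nat (Suc k)) ^ CARD('n) * c) \<longlonglongrightarrow> 0 ^ CARD('n) * c"
      by (intro tendsto_intros inv)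
    ultimately have "0 ^ CARD('n) * c = det (mat 1 :: complex^'n^'n)"
      unfolding nz[OF pos] using LIMSEQ_unique by blast
    then show False by (simp add: zero_power)
  qed
  then have "p \<noteq> 0" by auto
  then show "finite {z. \<exists>v. v \<noteq> 0 \<and> M *v v = z *s v}"
    unfolding eigenvalue_iff_det p[symmetric] by (rule poly_roots_finite)
  have "\<not> constant (poly p)" using const by (simp add: constant_degree)
  then show "{z. \<exists>v. v \<noteq> 0 \<and> M *v v = z *s v} \<noteq> {}"
    unfolding eigenvalue_iff_det p[symmetric] using fundamental_theorem_of_algebra[of p] by auto
qed

section \<open>Geometric series of matrix powers\<close>

abbreviation mpow :: "real^'m^'m \<Rightarrow> nat \<Rightarrow> real^'m^'m" where
  "mpow W t \<equiv> ((**) W ^^ t) (mat 1)"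

lemma matrix_mult_scaleR_right: "M ** (c *\<^sub>R N) = c *\<^sub>R (M ** N)" for M :: "real^'m^'n" and N :: "real^'k^'m"
  by (simp add: matrix_matrix_mult_def vec_eq_iff sum_distrib_left mult_ac)

lemma matrix_mult_scaleR_left: "(c *\<^sub>R M) ** N = c *\<^sub>R (M ** N)" for M :: "real^'m^'n" and N :: "real^'k^'m"
  by (simp add: matrix_matrix_mult_def vec_eq_iff sum_distrib_left mult_ac)

lemma matrix_diff_rdistrib: "(M - M') ** N = M ** N - M' ** N" for M M' :: "real^'m^'n" and N :: "real^'k^'m"
  by (simp add: matrix_matrix_mult_def vec_eq_iff sum_subtractf algebra_simps)

lemma neumann_inverse:
  fixes W :: "real^'m^'m"
  assumes sm: "summable (\<lambda>t. c ^ t *\<^sub>R mpow W t)"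
  shows "(mat 1 - c *\<^sub>R W) ** (\<Sum>t. c ^ t *\<^sub>R mpow W t) = mat 1"
proof -
  let ?Z = "\<Sum>t. c ^ t *\<^sub>R mpow W t"
  have bl: "bounded_linear (\<lambda>Y. c *\<^sub>R (W ** Y))"
    by (intro bounded_linear_compose[OF bounded_linear_scaleR_right])
       (auto intro!: linear_conv_bounded_linear[THEN iffD1] linearI simp: matrix_add_ldistrib matrix_mult_scaleR_right)
  have "?Z = mat 1 + (\<Sum>t. c ^ Suc t *\<^sub>R mpow W (Suc t))"
    using suminf_split_head[OF sm] by simp
  also have "(\<Sum>t. c ^ Suc t *\<^sub>R mpow W (Suc t)) = (\<Sum>t. c *\<^sub>R (W ** (c ^ t *\<^sub>R mpow W t)))"
    by (simp add: matrix_mult_scaleR_right)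
  also have "\<dots> = c *\<^sub>R (W ** ?Z)"
    by (rule bounded_linear.suminf[OF bl sm, symmetric])
  finally have Z: "?Z = mat 1 + c *\<^sub>R (W ** ?Z)" .
  have "(mat 1 - c *\<^sub>R W) ** ?Z = ?Z - c *\<^sub>R (W ** ?Z)"
    by (simp only: matrix_diff_rdistrib matrix_mult_scaleR_left matrix_mul_lid)
  also have "\<dots> = mat 1"
    using Z by (rule diff_eq_eq[THEN iffD2])
  finally show ?thesis .
qed

text \<open>The Kronecker square \<open>M \<otimes> M\<close> and, below, \<open>y \<otimes> y\<close>. They
  turn a quadratic form along the orbit of a matrix into a linear form along the orbit of another
  matrix.\<close>

definition kron :: "real^'m^'m \<Rightarrow> real^('m \<times> 'm)^('m \<times> 'm)" where
  "kron M = (\<chi> p q. M $ fst p $ fst q * M $ snd p $ snd q)"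

definition vkron :: "real^'m \<Rightarrow> real^('m \<times> 'm)" where
  "vkron y = (\<chi> p. y $ fst p * y $ snd p)"

lemma sum_UNIV_prod: "(\<Sum>p\<in>UNIV. f (p :: 'a::finite \<times> 'b::finite)) = (\<Sum>i\<in>UNIV. \<Sum>j\<in>UNIV. f (i, j))"
  by (simp add: sum.cartesian_product)

lemma kron_mult: "kron (M ** N) = kron M ** kron N"
  by (simp add: kron_def matrix_matrix_mult_def vec_eq_iff sum_UNIV_prod sum_product mult_ac)

lemma kron_mat_1: "kron (mat 1) = mat 1"
  by (auto simp: kron_def mat_def vec_eq_iff)

lemma kron_mpow: "mpow (kron M) t = kron (mpow M t)"
  by (induction t) (simp_all add: kron_mat_1 kron_mult)

lemma vkron_mult: "vkron (M *v y) = kron M *v vkron y"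
  by (simp add: kron_def vkron_def matrix_vector_mult_def vec_eq_iff sum_UNIV_prod sum_product mult_ac)

lemma quadratic_form_vkron: "y \<bullet> (N *v y) = (\<chi> p. N $ fst p $ snd p) \<bullet> vkron y"
  by (simp add: vkron_def inner_vec_def matrix_vector_mult_def sum_UNIV_prod sum_distrib_left mult_ac)

lemma abs_component_le_norm: "\<bar>U $ i $ j\<bar> \<le> norm (U :: real^'m^'n)"
  using component_le_norm_cart[of "U $ i" j] Finite_Cartesian_Product.norm_nth_le[of U i] by simp

lemma norm_matrix_le:
  fixes U :: "real^'m^'n"
  assumes "\<And>i j. \<bar>U $ i $ j\<bar> \<le> b"
  shows "norm U \<le> real CARD('n) * (real CARD('m) * b)"
proof -
  have "norm U \<le> (\<Sum>i\<in>UNIV. norm (U $ i))"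
    unfolding norm_vec_def by (rule L2_set_le_sum) simp
  also have "\<dots> \<le> (\<Sum>i\<in>(UNIV::'n set). \<Sum>j\<in>(UNIV::'m set). \<bar>U $ i $ j\<bar>)"
    by (intro sum_mono norm_le_l1_cart)
  also have "\<dots> \<le> (\<Sum>i\<in>(UNIV::'n set). \<Sum>j\<in>(UNIV::'m set). b)"
    by (intro sum_mono assms)
  finally show ?thesis by simp
qed

lemma norm_kron_le:
  fixes U :: "real^'m^'m"
  shows "norm (kron U) \<le> real CARD('m \<times> 'm) * (real CARD('m \<times> 'm) * (norm U)\<^sup>2)"
proof (rule norm_matrix_le)
  fix i j
  have "\<bar>kron U $ i $ j\<bar> = \<bar>U $ fst i $ fst j\<bar> * \<bar>U $ snd i $ snd j\<bar>"
    by (simp add: kron_def abs_mult)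
  also have "\<dots> \<le> norm U * norm U"
    by (intro mult_mono abs_component_le_norm) auto
  finally show "\<bar>kron U $ i $ j\<bar> \<le> (norm U)\<^sup>2" by (simp add: power2_eq_square)
qed

lemma summable_kron:
  fixes M :: "real^'m^'m"
  assumes "0 \<le> c" and "summable (\<lambda>t. c ^ t * (norm (mpow M t))\<^sup>2)"
  shows "summable (\<lambda>t. c ^ t *\<^sub>R mpow (kron M) t)"
proof (rule summable_comparison_test')
  let ?N = "real CARD('m \<times> 'm)"
  show "summable (\<lambda>t. ?N * ?N * (c ^ t * (norm (mpow M t))\<^sup>2))"
    by (intro summable_mult assms)
  fix t
  have "norm (c ^ t *\<^sub>R mpow (kron M) t) = c ^ t * norm (kron (mpow M t))"
    using assms(1) by (simp add: kron_mpow)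
  also have "\<dots> \<le> c ^ t * (?N * (?N * (norm (mpow M t))\<^sup>2))"
    using assms(1) by (intro mult_left_mono norm_kron_le) auto
  finally show "norm (c ^ t *\<^sub>R mpow (kron M) t) \<le> ?N * ?N * (c ^ t * (norm (mpow M t))\<^sup>2)"
    by (simp add: mult_ac)
qed

text \<open>The weighted sum solves a linear system whose matrix is invertible by the Neumann series. Cramer's
  rule is preferred to the series as a description of the solution, because it is visibly
  differentiable in the entries of \<open>W\<close>.\<close>

lemma geometric_solution:
  fixes W :: "real^'m^'m"
  assumes sm: "summable (\<lambda>t. c ^ t *\<^sub>R mpow W t)"
  shows "det (mat 1 - c *\<^sub>R W) \<noteq> 0"
    and "(\<lambda>t. c ^ t * (w \<bullet> (mpow W t *v s))) sums
     (\<Sum>k\<in>UNIV. w $ k * (det (\<chi> i j. if j = k then s $ i else (mat 1 - c *\<^sub>R W) $ i $ j) / det (mat 1 - c *\<^sub>R W)))"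
proof -
  let ?Z = "\<Sum>t. c ^ t *\<^sub>R mpow W t"
  have inv: "(mat 1 - c *\<^sub>R W) ** ?Z = mat 1" by (rule neumann_inverse[OF sm])
  then show det: "det (mat 1 - c *\<^sub>R W) \<noteq> 0"
    using invertible_det_nz invertible_right_inverse by blast
  have "(mat 1 - c *\<^sub>R W) *v (?Z *v s) = s"
    by (simp add: matrix_vector_mul_assoc inv)
  then have Z: "?Z *v s = (\<chi> k. det (\<chi> i j. if j = k then s $ i else (mat 1 - c *\<^sub>R W) $ i $ j) / det (mat 1 - c *\<^sub>R W))"
    using cramer[OF det] by blast
  have w: "w \<bullet> (\<chi> k. g k) = (\<Sum>k\<in>UNIV. w $ k * g k)" for g
    by (simp add: inner_vec_def)
  have bl: "bounded_linear (\<lambda>Y::real^'m^'m. w \<bullet> (Y *v s))"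
    by (auto intro!: linear_conv_bounded_linear[THEN iffD1] linearI
        simp: matrix_vector_mult_add_rdistrib scaleR_matrix_vector_assoc[symmetric] inner_add_right)
  have "(\<lambda>t. w \<bullet> ((c ^ t *\<^sub>R mpow W t) *v s)) sums (w \<bullet> (?Z *v s))"
    by (rule bounded_linear.sums[OF bl summable_sums[OF sm]])
  then show "(\<lambda>t. c ^ t * (w \<bullet> (mpow W t *v s))) sums
     (\<Sum>k\<in>UNIV. w $ k * (det (\<chi> i j. if j = k then s $ i else (mat 1 - c *\<^sub>R W) $ i $ j) / det (mat 1 - c *\<^sub>R W)))"
    unfolding Z w by (simp only: scaleR_matrix_vector_assoc[symmetric] inner_scaleR_right)
qed

lemma differentiable_prod:
  fixes f :: "'i \<Rightarrow> 'a::real_normed_vector \<Rightarrow> real"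
  assumes "\<And>i. i \<in> I \<Longrightarrow> f i differentiable (at x)"
  shows "(\<lambda>x. \<Prod>i\<in>I. f i x) differentiable (at x)"
proof -
  have "(f i has_derivative frechet_derivative (f i) (at x)) (at x)" if "i \<in> I" for i
    by (rule frechet_derivative_works[THEN iffD1, OF assms[OF that]])
  then show ?thesis by (rule differentiableI[OF has_derivative_prod])
qed

lemma differentiable_det:
  fixes F :: "'a::real_normed_vector \<Rightarrow> real^'m^'m"
  assumes "\<And>i j. (\<lambda>x. F x $ i $ j) differentiable (at x)"
  shows "(\<lambda>x. det (F x)) differentiable (at x)"
  unfolding det_def
  by (intro differentiable_sum differentiable_mult differentiable_const differentiable_prod assms ballI) auto

section \<open>The closed loop in augmented coordinates\<close>

text \<open>The input \<open>K x + K' x\<^sup>*\<close> is affine in \<open>x\<close>. A further coordinate,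
  indexed by \<^term>\<open>None\<close> and constantly \<open>1\<close>, makes the closed loop
  linear.\<close>

definition aug_mat :: "real^'n^'n \<Rightarrow> real^'k^'n \<Rightarrow> real^'n \<Rightarrow> ('n::finite, 'k::finite) policy \<Rightarrow> real^('n option)^('n option)" where
  "aug_mat A B xs K = (\<chi> i j. case i of None \<Rightarrow> (if j = None then 1 else 0)
     | Some i' \<Rightarrow> (case j of None \<Rightarrow> (B *v (snd K *v xs)) $ i' | Some j' \<Rightarrow> (A + B ** fst K) $ i' $ j'))"

definition aug_vec :: "real^'n \<Rightarrow> real^('n::finite option)" where
  "aug_vec x = (\<chi> i. case i of None \<Rightarrow> 1 | Some i' \<Rightarrow> x $ i')"

lemma sum_UNIV_option: "(\<Sum>i\<in>UNIV. f (i :: 'a::finite option)) = f None + (\<Sum>i\<in>UNIV. f (Some i))"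
  by (simp add: UNIV_option_conv sum.reindex)

lemma aug_mat_step: "aug_mat A B xs K *v aug_vec x = aug_vec (A *v x + B *v control xs K x)"
proof -
  have "(M *v aug_vec x) $ a = M $ a $ None + (\<Sum>j\<in>UNIV. M $ a $ Some j * x $ j)" for M :: "real^('a option)^('a option)" and a and x
    by (simp add: matrix_vector_mult_def sum_UNIV_option aug_vec_def)
  note entry = this
  have "(aug_mat A B xs K *v aug_vec x) $ i = aug_vec (A *v x + B *v control xs K x) $ i" for i
  proof (cases i)
    case None
    then show ?thesis unfolding entry by (simp add: aug_mat_def aug_vec_def)
  next
    case (Some a)
    have "(aug_mat A B xs K *v aug_vec x) $ i = (B *v (snd K *v xs)) $ a + ((A + B ** fst K) *v x) $ a"
      unfolding entry Some by (simp add: aug_mat_def matrix_vector_mult_def[of "A + B ** fst K"])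
    then show ?thesis
      using Some by (simp add: aug_vec_def control_def matrix_vector_right_distrib matrix_vector_mult_add_rdistrib matrix_vector_mul_assoc)
  qed
  then show ?thesis by (simp add: vec_eq_iff)
qed

lemma aug_vec_state: "aug_vec (state A B xs K x0 t) = mpow (aug_mat A B xs K) t *v aug_vec x0"
  by (induction t) (simp_all add: aug_mat_step[symmetric] matrix_vector_mul_assoc)

definition error_mat :: "real^'n \<Rightarrow> real^('n::finite option)^'n" where
  "error_mat xs = (\<chi> a i. case i of None \<Rightarrow> - xs $ a | Some j \<Rightarrow> if a = j then 1 else 0)"

definition gain_mat :: "real^'n \<Rightarrow> ('n::finite, 'k::finite) policy \<Rightarrow> real^('n option)^'k" where
  "gain_mat xs K = (\<chi> a i. case i of None \<Rightarrow> (snd K *v xs) $ a | Some j \<Rightarrow> fst K $ a $ j)"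

lemma error_mat_mult: "error_mat xs *v aug_vec x = x - xs"
  by (simp add: vec_eq_iff error_mat_def aug_vec_def matrix_vector_mult_def sum_UNIV_option
      if_distrib[of "\<lambda>y. y * _"] cong: if_cong)

lemma gain_mat_mult: "gain_mat xs K *v aug_vec x = control xs K x"
  by (simp add: vec_eq_iff gain_mat_def aug_vec_def control_def matrix_vector_mult_def sum_UNIV_option)

definition stage_mat :: "real^'n^'n \<Rightarrow> real^'k^'k \<Rightarrow> real^'n \<Rightarrow> ('n::finite, 'k::finite) policy \<Rightarrow> real^('n option)^('n option)" where
  "stage_mat Q R xs K = transpose (error_mat xs) ** (Q ** error_mat xs) + transpose (gain_mat xs K) ** (R ** gain_mat xs K)"

definition stage_cost :: "real^'n^'n \<Rightarrow> real^'k^'k \<Rightarrow> real^'n \<Rightarrow> ('n::finite, 'k::finite) policy \<Rightarrow> real^'n \<Rightarrow> real" where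
  "stage_cost Q R xs K x = (x - xs) \<bullet> (Q *v (x - xs)) + control xs K x \<bullet> (R *v control xs K x)"

lemma quadratic_form_congruence:
  fixes E :: "real^'b^'c"
  shows "y \<bullet> ((transpose E ** (N ** E)) *v y) = (E *v y) \<bullet> (N *v (E *v y))"
  by (metis dot_lmul_matrix inner_commute transpose_matrix_vector matrix_vector_mul_assoc)

lemma stage_cost_eq: "stage_cost Q R xs K x = (\<chi> p. stage_mat Q R xs K $ fst p $ snd p) \<bullet> vkron (aug_vec x)"
proof -
  show ?thesis
    unfolding quadratic_form_vkron[symmetric]
    by (simp add: stage_cost_def stage_mat_def matrix_vector_mult_add_rdistrib inner_add_right
        quadratic_form_congruence error_mat_mult gain_mat_mult)
qed

text \<open>All dependence on time sits in a matrix power and all dependence on the initial state in one vector,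
  so that taking expectations only replaces this vector by its mean.\<close>

lemma stage_cost_state:
  "stage_cost Q R xs K (state A B xs K x0 t)
    = (\<chi> p. stage_mat Q R xs K $ fst p $ snd p) \<bullet> (mpow (kron (aug_mat A B xs K)) t *v vkron (aug_vec x0))"
  by (simp add: stage_cost_eq aug_vec_state vkron_mult kron_mpow)

lemma cost_from_eq: "cost_from A B Q R \<gamma> xs K x0 = (\<Sum>t. ennreal (\<gamma> ^ t * stage_cost Q R xs K (state A B xs K x0 t)))"
  by (simp add: cost_from_def stage_cost_def Let_def)

text \<open>The candidate for the expected cost, where \<open>s\<close> stands for the second moment of the
  augmented initial state. It is defined for every policy, also where the series for the cost
  diverges.\<close>

definition rational_cost :: "real^'n^'n \<Rightarrow> real^'k^'n \<Rightarrow> real^'n^'n \<Rightarrow> real^'k^'k \<Rightarrow> real \<Rightarrow> real^'n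
    \<Rightarrow> real^('n option \<times> 'n option) \<Rightarrow> ('n::finite, 'k::finite) policy \<Rightarrow> real" where
  "rational_cost A B Q R \<gamma> xs s K = (let H = mat 1 - \<gamma> *\<^sub>R kron (aug_mat A B xs K) in
     \<Sum>p\<in>UNIV. stage_mat Q R xs K $ fst p $ snd p * (det (\<chi> i j. if j = p then s $ i else H $ i $ j) / det H))"

lemma bounded_linear_differentiable: "bounded_linear f \<Longrightarrow> f differentiable (at x)"
  by (meson bounded_linear_imp_has_derivative differentiableI)

lemma differentiable_fst_entry: "(\<lambda>K. fst K $ a $ (b::'n::finite)) differentiable (at (K :: ('n, 'k::finite) policy))"
  by (intro bounded_linear_differentiable bounded_linear_vec_nth[THEN bounded_linear_compose] bounded_linear_fst)

lemma differentiable_snd_entry: "(\<lambda>K. snd K $ a $ (b::'n::finite)) differentiable (at (K :: ('n, 'k::finite) policy))"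
  by (intro bounded_linear_differentiable bounded_linear_vec_nth[THEN bounded_linear_compose] bounded_linear_snd)

lemma differentiable_rational_cost:
  fixes A :: "real^'n^'n" and K :: "('n::finite, 'k::finite) policy"
  assumes "det (mat 1 - \<gamma> *\<^sub>R kron (aug_mat A B xs K)) \<noteq> 0"
  shows "rational_cost A B Q R \<gamma> xs s differentiable (at K)"
proof -
  have aug: "(\<lambda>K. aug_mat A B xs K $ i $ j) differentiable (at K)" for i j
    by (cases i; cases j)
      (auto simp: aug_mat_def matrix_vector_mult_def matrix_matrix_mult_def 
       intro!: differentiable_sum differentiable_mult differentiable_add differentiable_const differentiable_fst_entry differentiable_snd_entry)
  have gain: "(\<lambda>K. gain_mat xs K $ i $ j) differentiable (at K)" for i :: 'k and j
    by (cases j)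
      (auto simp: gain_mat_def matrix_vector_mult_def
       intro!: differentiable_sum differentiable_mult differentiable_const differentiable_fst_entry differentiable_snd_entry)
  have stage: "(\<lambda>K. stage_mat Q R xs K $ i $ j) differentiable (at K)" for i j
    unfolding stage_mat_def
    by (auto simp: matrix_matrix_mult_def transpose_def
       intro!: differentiable_sum differentiable_mult differentiable_add differentiable_const gain)
  have H: "(\<lambda>K. (mat 1 - \<gamma> *\<^sub>R kron (aug_mat A B xs K)) $ i $ j) differentiable (at K)" for i j
    by (auto simp: kron_def intro!: differentiable_diff differentiable_mult differentiable_const aug)
  have H': "(\<lambda>K. (\<chi> i j. if j = p then s $ i else (mat 1 - \<gamma> *\<^sub>R kron (aug_mat A B xs K)) $ i $ j) $ i $ j) differentiable (at K)" for i j p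
    using H[of i j] by (cases "j = p") auto
  show ?thesis
    unfolding rational_cost_def[abs_def] Let_def
    by (intro differentiable_sum differentiable_mult differentiable_divide differentiable_det stage H H' assms ballI) auto
qed

section \<open>Costs under a random initial state\<close>

lemma pos_def_lower_bound:
  fixes M :: "real^'n^'n"
  assumes "pos_def M"
  shows "\<exists>q>0. \<forall>x. q * (norm x)\<^sup>2 \<le> x \<bullet> (M *v x)"
proof -
  have cont: "continuous_on (sphere 0 1) (\<lambda>x::real^'n. x \<bullet> (M *v x))"
    by (intro continuous_intros linear_continuous_on matrix_vector_mul_bounded_linear)
  have ne: "sphere (0::real^'n) 1 \<noteq> {}" by simp
  obtain u where u: "u \<in> sphere 0 1" and min: "\<And>y. y \<in> sphere 0 1 \<Longrightarrow> u \<bullet> (M *v u) \<le> y \<bullet> (M *v y)"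
    using continuous_attains_inf[OF compact_sphere ne cont] by blast
  have "u \<bullet> (M *v u) * (norm x)\<^sup>2 \<le> x \<bullet> (M *v x)" for x
  proof (cases "x = 0")
    case False
    have "u \<bullet> (M *v u) \<le> sgn x \<bullet> (M *v sgn x)"
      using False by (intro min) (simp add: norm_sgn)
    then have "u \<bullet> (M *v u) * (norm x)\<^sup>2 \<le> (sgn x \<bullet> (M *v sgn x)) * (norm x)\<^sup>2"
      by (intro mult_right_mono) auto
    also have "\<dots> = (norm x *\<^sub>R sgn x) \<bullet> (M *v (norm x *\<^sub>R sgn x))"
      by (simp add: matrix_vector_mult_scaleR power2_eq_square)
    also have "norm x *\<^sub>R sgn x = x" using False by (simp add: sgn_div_norm)
    finally show ?thesis .
  qed simp
  moreover have "0 < u \<bullet> (M *v u)"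
    using assms u unfolding pos_def_def by (metis mem_sphere_0 norm_zero zero_neq_one)
  ultimately show ?thesis by blast
qed

lemma norm_aug_vec: "(norm (aug_vec x))\<^sup>2 = 1 + (norm x)\<^sup>2"
  by (simp add: power2_norm_eq_inner inner_vec_def sum_UNIV_option aug_vec_def)

lemma inner_vkron: "(r \<bullet> y)\<^sup>2 = vkron r \<bullet> vkron y"
  by (simp add: vkron_def inner_vec_def sum_UNIV_prod power2_eq_square sum_product mult_ac)

lemma norm_vkron_le: "norm (vkron y) \<le> (norm y)\<^sup>2"
proof -
  have "(norm (vkron y))\<^sup>2 = ((norm y)\<^sup>2)\<^sup>2"
    using inner_vkron[of y y] by (simp add: power2_norm_eq_inner)
  then show ?thesis by (metis abs_norm_cancel abs_power2 order_refl power2_eq_iff_nonneg norm_ge_zero zero_le_power2)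
qed

lemma frobenius_norm: "(norm (U :: real^'m^'n))\<^sup>2 = (\<Sum>i\<in>UNIV. (norm (U $ i))\<^sup>2)"
  by (simp add: power2_norm_eq_inner inner_vec_def)

lemma norm_mult_vec: "(norm (U *v y))\<^sup>2 = (\<Sum>i\<in>UNIV. ((U :: real^'m^'n) $ i \<bullet> y)\<^sup>2)"
  unfolding power2_norm_eq_inner inner_vec_def[of "U *v y"]
  by (simp add: matrix_vector_mul_component power2_eq_square)

lemma continuous_aug_vec: "continuous_on S (aug_vec :: real^'n \<Rightarrow> _)"
  unfolding aug_vec_def[abs_def]
proof (intro continuous_on_vec_lambda)
  fix i :: "'n option"
  show "continuous_on S (\<lambda>x::real^'n. case i of None \<Rightarrow> 1 | Some i' \<Rightarrow> x $ i')"
    by (cases i) (auto intro!: continuous_intros)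
qed

lemma continuous_vkron: "continuous_on S vkron"
  unfolding vkron_def[abs_def] by (intro continuous_on_vec_lambda continuous_intros)

locale initial_law =
  fixes D :: "(real^'n) measure" and \<Sigma> :: "real^'n^'n"
  assumes prob: "prob_space D" and setsD: "sets D = sets borel"
    and mean: "(\<integral>x. x \<partial>D) = 0"
    and second: "(\<integral>x. (\<chi> i j. x $ i * x $ j) \<partial>D) = \<Sigma>"
    and posS: "pos_def \<Sigma>"
begin

interpretation prob_space D by (rule prob)

lemma borelD: "continuous_on UNIV f \<Longrightarrow> f \<in> borel_measurable D"
  unfolding measurable_cong_sets[OF setsD refl] by (rule borel_measurable_continuous_onI)

text \<open>Otherwise the Bochner integral \<open>\<Sigma>\<close> would be \<open>0\<close> by convention,
  which is not positive definite.\<close>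

lemma integrable_outer: "integrable D (\<lambda>x. \<chi> i j. x $ i * x $ j)"
proof (rule ccontr)
  assume "\<not> ?thesis"
  then have "(\<integral>x. (\<chi> i j. x $ i * x $ j) \<partial>D) = 0" by (rule not_integrable_integral_eq)
  then have 0: "\<Sigma> = 0" by (simp only: second)
  have "(axis undefined 1 :: real^'n) \<noteq> 0" by (simp add: axis_eq_0_iff)
  then have "0 < (axis undefined 1 :: real^'n) \<bullet> (\<Sigma> *v axis undefined 1)"
    using posS unfolding pos_def_def by blast
  then show False unfolding 0 by simp
qed

lemma integrable_sq: "integrable D (\<lambda>x. (norm x)\<^sup>2)"
proof -
  have "integrable D (\<lambda>x. \<Sum>i\<in>UNIV. (\<chi> i j. x $ i * x $ j) $ i $ i)"
    by (intro Bochner_Integration.integrable_sum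
       integrable_bounded_linear[OF bounded_linear_vec_nth] integrable_outer)
  then show ?thesis by (simp add: power2_norm_eq_inner inner_vec_def)
qed

lemma integrable_id: "integrable D (\<lambda>x. x)"
proof (rule Bochner_Integration.integrable_bound)
  show "integrable D (\<lambda>x. 1 + (norm x)\<^sup>2)" by (intro Bochner_Integration.integrable_add integrable_sq integrable_const)
  have "a \<le> 1 + a\<^sup>2" if "0 \<le> a" for a :: real
    using that sum_squares_bound[of a 1] by simp
  then show "AE x in D. norm x \<le> norm (1 + (norm x)\<^sup>2)"
    by (intro AE_I2) (simp add: abs_of_nonneg)
qed (rule borelD[OF continuous_on_id])

definition moment :: "real^('n option \<times> 'n option)" where
  "moment = (\<integral>x. vkron (aug_vec x) \<partial>D)"

lemma integrable_vkron: "integrable D (\<lambda>x. vkron (aug_vec x))"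
proof (rule Bochner_Integration.integrable_bound)
  show "integrable D (\<lambda>x. 1 + (norm x)\<^sup>2)" by (intro Bochner_Integration.integrable_add integrable_sq integrable_const)
  show "AE x in D. norm (vkron (aug_vec x)) \<le> norm (1 + (norm x)\<^sup>2)"
    using norm_vkron_le[of "aug_vec _"] by (intro AE_I2) (simp add: norm_aug_vec abs_of_nonneg)
qed (rule borelD, rule continuous_on_compose2[OF continuous_vkron[of UNIV] continuous_aug_vec], rule subset_UNIV)

lemma integrable_square_inner: "integrable D (\<lambda>x. (r \<bullet> aug_vec x)\<^sup>2)"
  unfolding inner_vkron by (intro integrable_inner_right integrable_vkron)

text \<open>The mean being zero, the second moment matrix of \<open>(x, 1)\<close> is block diagonal with blocks
  \<open>\<Sigma>\<close> and \<open>1\<close>.\<close>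

lemma second_moment_lower_bound:
  "\<exists>s>0. \<forall>r. s * (norm r)\<^sup>2 \<le> (\<integral>x. (r \<bullet> aug_vec x)\<^sup>2 \<partial>D)"
proof -
  obtain q where q: "0 < q" "\<And>x. q * (norm x)\<^sup>2 \<le> x \<bullet> (\<Sigma> *v x)"
    using pos_def_lower_bound[OF posS] by blast
  have "min q 1 * (norm r)\<^sup>2 \<le> (\<integral>x. (r \<bullet> aug_vec x)\<^sup>2 \<partial>D)" for r
  proof -
    define c where "c = r $ None"
    define r' where "r' = (\<chi> i. r $ Some i)"
    have inner: "r \<bullet> aug_vec x = c + r' \<bullet> x" for x
      by (simp add: inner_vec_def sum_UNIV_option c_def r'_def aug_vec_def)
    have norm_r: "(norm r)\<^sup>2 = c\<^sup>2 + (norm r')\<^sup>2"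
      by (simp add: power2_norm_eq_inner inner_vec_def sum_UNIV_option c_def r'_def power2_eq_square[of "r $ None"])
    have bl: "bounded_linear (\<lambda>N::real^'n^'n. r' \<bullet> (N *v r'))"
      by (auto intro!: linear_conv_bounded_linear[THEN iffD1] linearI
        simp: matrix_vector_mult_add_rdistrib scaleR_matrix_vector_assoc[symmetric] inner_add_right)
    have out: "r' \<bullet> ((\<chi> i j. x $ i * x $ j) *v r') = (r' \<bullet> x)\<^sup>2" for x
      by (simp add: inner_vec_def matrix_vector_mult_def power2_eq_square sum_product sum_distrib_left mult_ac)
    have i2: "integrable D (\<lambda>x. (r' \<bullet> x)\<^sup>2)"
      using integrable_bounded_linear[OF bl integrable_outer] by (simp add: out)
    have e2: "(\<integral>x. (r' \<bullet> x)\<^sup>2 \<partial>D) = r' \<bullet> (\<Sigma> *v r')"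
      using integral_bounded_linear[OF bl integrable_outer] by (simp add: out second)
    have i1: "integrable D (\<lambda>x. r' \<bullet> x)" by (intro integrable_inner_right integrable_id)
    have e1: "(\<integral>x. r' \<bullet> x \<partial>D) = 0"
      using integral_inner_right[OF integrable_id, of r'] mean by simp
    have "(\<integral>x. (r \<bullet> aug_vec x)\<^sup>2 \<partial>D) = (\<integral>x. c\<^sup>2 + 2 * c * (r' \<bullet> x) + (r' \<bullet> x)\<^sup>2 \<partial>D)"
      by (simp add: inner power2_sum algebra_simps)
    also have "\<dots> = c\<^sup>2 + r' \<bullet> (\<Sigma> *v r')"
      using i1 i2 e1 e2 prob_space by simp
    also have "\<dots> \<ge> c\<^sup>2 + q * (norm r')\<^sup>2" using q(2) by simp
    also have "c\<^sup>2 + q * (norm r')\<^sup>2 \<ge> min q 1 * c\<^sup>2 + min q 1 * (norm r')\<^sup>2"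
      by (intro add_mono mult_right_mono) (auto simp: mult_left_le_one_le q less_imp_le)
    also have "min q 1 * c\<^sup>2 + min q 1 * (norm r')\<^sup>2 = min q 1 * (norm r)\<^sup>2"
      by (simp add: norm_r distrib_left)
    finally show ?thesis by simp
  qed
  then show ?thesis using q(1) by (intro exI[of _ "min q 1"]) auto
qed

lemma expected_stage_cost:
  "integrable D (\<lambda>x. stage_cost Q R xs K (state A B xs K x t))"
  "(\<integral>x. stage_cost Q R xs K (state A B xs K x t) \<partial>D)
    = (\<chi> p. stage_mat Q R xs K $ fst p $ snd p) \<bullet> (mpow (kron (aug_mat A B xs K)) t *v moment)"
proof -
  let ?w = "\<chi> p. stage_mat Q R xs K $ fst p $ snd p" and ?U = "mpow (kron (aug_mat A B xs K)) t"
  have bl: "bounded_linear (\<lambda>s. ?w \<bullet> (?U *v s))"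
    by (intro bounded_linear_inner_right_comp matrix_vector_mul_bounded_linear)
  show "integrable D (\<lambda>x. stage_cost Q R xs K (state A B xs K x t))"
    unfolding stage_cost_state by (rule integrable_bounded_linear[OF bl integrable_vkron])
  show "(\<integral>x. stage_cost Q R xs K (state A B xs K x t) \<partial>D) = ?w \<bullet> (?U *v moment)"
    unfolding stage_cost_state moment_def by (rule integral_bounded_linear[OF bl integrable_vkron])
qed

lemma stage_cost_lower_bound:
  assumes "pos_def Q" "pos_def R"
  shows "\<exists>q>0. \<forall>K x. q * (norm (x - xs))\<^sup>2 \<le> stage_cost Q R xs K x"
proof -
  obtain q where q: "0 < q" "\<And>x. q * (norm x)\<^sup>2 \<le> x \<bullet> (Q *v x)"
    using pos_def_lower_bound[OF assms(1)] by blast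
  have "0 \<le> u \<bullet> (R *v u)" for u
    using assms(2) unfolding pos_def_def by (cases "u = 0") (auto intro: less_imp_le)
  then show ?thesis
    using q unfolding stage_cost_def by (intro exI[of _ q]) (auto intro: add_increasing2)
qed

lemma cost_eq_suminf:
  assumes "pos_def Q" "pos_def R" "0 < \<gamma>"
  shows "cost A B Q R \<gamma> xs D K = (\<Sum>t. ennreal (\<gamma> ^ t * (\<integral>x. stage_cost Q R xs K (state A B xs K x t) \<partial>D)))"
    and "0 \<le> (\<integral>x. stage_cost Q R xs K (state A B xs K x t) \<partial>D)"
proof -
  obtain q where q: "0 < q" "\<And>K x. q * (norm (x - xs))\<^sup>2 \<le> stage_cost Q R xs K x"
    using stage_cost_lower_bound[OF assms(1,2)] by blast
  have nn: "0 \<le> stage_cost Q R xs K x" for x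
    using q(2)[of x K] q(1) by (meson order_trans less_imp_le mult_nonneg_nonneg zero_le_power2)
  have int: "integrable D (\<lambda>x. stage_cost Q R xs K (state A B xs K x t))" for t
    by (rule expected_stage_cost)
  have "cost A B Q R \<gamma> xs D K = (\<Sum>t. \<integral>\<^sup>+x. ennreal (\<gamma> ^ t * stage_cost Q R xs K (state A B xs K x t)) \<partial>D)"
    unfolding cost_def cost_from_eq using int
    by (intro nn_integral_suminf) auto
  also have "\<dots> = (\<Sum>t. ennreal (\<gamma> ^ t * (\<integral>x. stage_cost Q R xs K (state A B xs K x t) \<partial>D)))"
    using int nn assms(3) by (intro suminf_cong) (subst nn_integral_eq_integral, auto)
  finally show "cost A B Q R \<gamma> xs D K = (\<Sum>t. ennreal (\<gamma> ^ t * (\<integral>x. stage_cost Q R xs K (state A B xs K x t) \<partial>D)))" .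
  show "0 \<le> (\<integral>x. stage_cost Q R xs K (state A B xs K x t) \<partial>D)"
    using nn by (intro integral_nonneg_AE) auto
qed

text \<open>This is where excitation of all directions by the initial state enters: the \<open>i\<close>-th row
  \<open>u\<close> of \<open>M\<^sup>t\<close> contributes \<open>E (u \<bullet> y\<^sub>0)\<^sup>2
  \<ge> s \<parallel>u\<parallel>\<^sup>2\<close> to \<open>E
  \<parallel>y\<^sub>t\<parallel>\<^sup>2\<close>, and the latter is controlled by the expected stage
  cost.\<close>

lemma finite_cost_imp_summable:
  assumes Q: "pos_def Q" and R: "pos_def R" and \<gamma>: "0 < \<gamma>" "\<gamma> < 1" and fin: "cost A B Q R \<gamma> xs D K < \<top>"
  shows "summable (\<lambda>t. \<gamma> ^ t * (norm (mpow (aug_mat A B xs K) t))\<^sup>2)"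
proof -
  define a where "a t = (\<integral>x. stage_cost Q R xs K (state A B xs K x t) \<partial>D)" for t
  obtain q where q: "0 < q" "\<And>K x. q * (norm (x - xs))\<^sup>2 \<le> stage_cost Q R xs K x"
    using stage_cost_lower_bound[OF Q R] by blast
  obtain s where s: "0 < s" "\<And>r. s * (norm r)\<^sup>2 \<le> (\<integral>x. (r \<bullet> aug_vec x)\<^sup>2 \<partial>D)"
    using second_moment_lower_bound by blast
  have sa: "summable (\<lambda>t. \<gamma> ^ t * a t)"
    using fin cost_eq_suminf(2)[OF Q R \<gamma>(1)] \<gamma> unfolding cost_eq_suminf(1)[OF Q R \<gamma>(1)] a_def
    by (intro summable_suminf_not_top) auto
  have bound: "s * (norm (mpow (aug_mat A B xs K) t))\<^sup>2 \<le> 1 + 2 * (norm xs)\<^sup>2 + 2 / q * a t" for t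
  proof -
    let ?U = "mpow (aug_mat A B xs K) t"
    have "s * (norm ?U)\<^sup>2 = (\<Sum>i\<in>UNIV. s * (norm (?U $ i))\<^sup>2)"
      by (simp add: frobenius_norm sum_distrib_left)
    also have "\<dots> \<le> (\<Sum>i\<in>UNIV. \<integral>x. (?U $ i \<bullet> aug_vec x)\<^sup>2 \<partial>D)"
      by (intro sum_mono s)
    also have "\<dots> = (\<integral>x. (norm (?U *v aug_vec x))\<^sup>2 \<partial>D)"
      unfolding norm_mult_vec by (intro Bochner_Integration.integral_sum[symmetric] integrable_square_inner)
    also have "\<dots> \<le> (\<integral>x. 1 + 2 * (norm xs)\<^sup>2 + 2 / q * stage_cost Q R xs K (state A B xs K x t) \<partial>D)"
    proof (rule integral_mono)
      show "integrable D (\<lambda>x. (norm (?U *v aug_vec x))\<^sup>2)"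
        unfolding norm_mult_vec by (intro Bochner_Integration.integrable_sum integrable_square_inner)
      show "integrable D (\<lambda>x. 1 + 2 * (norm xs)\<^sup>2 + 2 / q * stage_cost Q R xs K (state A B xs K x t))"
        by (intro Bochner_Integration.integrable_add integrable_mult_right expected_stage_cost) simp_all
      fix x
      let ?x = "state A B xs K x t"
      have "norm ?x \<le> norm (?x - xs) + norm xs" using norm_triangle_ineq[of "?x - xs" xs] by simp
      then have "(norm ?x)\<^sup>2 \<le> (norm (?x - xs) + norm xs)\<^sup>2" by (intro power_mono) auto
      also have "\<dots> \<le> 2 * (norm (?x - xs))\<^sup>2 + 2 * (norm xs)\<^sup>2"
        using sum_squares_bound[of "norm (?x - xs)" "norm xs"] unfolding power2_sum by linarith
      also have "(norm (?x - xs))\<^sup>2 \<le> stage_cost Q R xs K ?x / q"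
        using q(2)[of ?x K] q(1) by (simp add: field_simps)
      finally show "(norm (?U *v aug_vec x))\<^sup>2 \<le> 1 + 2 * (norm xs)\<^sup>2 + 2 / q * stage_cost Q R xs K ?x"
        by (simp add: aug_vec_state[symmetric] norm_aug_vec)
    qed
    also have "\<dots> = 1 + 2 * (norm xs)\<^sup>2 + 2 / q * a t"
      by (simp add: expected_stage_cost(1) a_def prob_space)
    finally show ?thesis .
  qed
  show ?thesis
  proof (rule summable_comparison_test')
    show "summable (\<lambda>t. ((1 + 2 * (norm xs)\<^sup>2) * \<gamma> ^ t + 2 / q * (\<gamma> ^ t * a t)) / s)"
      using \<gamma> by (intro summable_divide summable_add summable_mult sa summable_geometric) auto
    fix t
    have "(norm (mpow (aug_mat A B xs K) t))\<^sup>2 \<le> (1 + 2 * (norm xs)\<^sup>2 + 2 / q * a t) / s"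
      using bound[of t] s(1) by (simp add: pos_le_divide_eq mult.commute)
    then have "\<gamma> ^ t * (norm (mpow (aug_mat A B xs K) t))\<^sup>2 \<le> \<gamma> ^ t * ((1 + 2 * (norm xs)\<^sup>2 + 2 / q * a t) / s)"
      using \<gamma> by (intro mult_left_mono) auto
    then show "norm (\<gamma> ^ t * (norm (mpow (aug_mat A B xs K) t))\<^sup>2) \<le> ((1 + 2 * (norm xs)\<^sup>2) * \<gamma> ^ t + 2 / q * (\<gamma> ^ t * a t)) / s"
      using \<gamma> by (simp add: algebra_simps)
  qed
qed

lemma finite_cost_rational:
  assumes Q: "pos_def Q" and R: "pos_def R" and \<gamma>: "0 < \<gamma>" "\<gamma> < 1" and fin: "cost A B Q R \<gamma> xs D K < \<top>"
  shows "det (mat 1 - \<gamma> *\<^sub>R kron (aug_mat A B xs K)) \<noteq> 0"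
    and "enn2real (cost A B Q R \<gamma> xs D K) = rational_cost A B Q R \<gamma> xs moment K"
proof -
  have sm: "summable (\<lambda>t. \<gamma> ^ t *\<^sub>R mpow (kron (aug_mat A B xs K)) t)"
    by (rule summable_kron) (use finite_cost_imp_summable[OF assms] \<gamma> in auto)
  show "det (mat 1 - \<gamma> *\<^sub>R kron (aug_mat A B xs K)) \<noteq> 0" by (rule geometric_solution(1)[OF sm])
  let ?w = "\<chi> p. stage_mat Q R xs K $ fst p $ snd p"
  have sums: "(\<lambda>t. \<gamma> ^ t * (\<integral>x. stage_cost Q R xs K (state A B xs K x t) \<partial>D)) sums rational_cost A B Q R \<gamma> xs moment K"
    using geometric_solution(2)[OF sm, of ?w moment]
    by (simp add: expected_stage_cost rational_cost_def Let_def)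
  have nn: "0 \<le> \<gamma> ^ t * (\<integral>x. stage_cost Q R xs K (state A B xs K x t) \<partial>D)" for t
    using cost_eq_suminf(2)[OF Q R \<gamma>(1)] \<gamma> by (intro mult_nonneg_nonneg) auto
  have "cost A B Q R \<gamma> xs D K = ennreal (rational_cost A B Q R \<gamma> xs moment K)"
    unfolding cost_eq_suminf(1)[OF Q R \<gamma>(1)] by (rule suminf_ennreal_eq[OF nn sums])
  moreover have "0 \<le> rational_cost A B Q R \<gamma> xs moment K"
    using suminf_nonneg[OF sums_summable[OF sums] nn] sums_unique[OF sums] by simp
  ultimately show "enn2real (cost A B Q R \<gamma> xs D K) = rational_cost A B Q R \<gamma> xs moment K" by simp
qed

end

text \<open>An eigenvector \<open>v\<close> of \<open>A + B K\<close> extends to the eigenvector \<open>(v,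
  0)\<close> of the augmented matrix, so its eigenvalue \<open>z\<close> satisfies \<open>(\<gamma>
  \<bar>z\<bar>\<^sup>2)\<^sup>t \<rightarrow> 0\<close>.\<close>

lemma summable_imp_stable:
  fixes A :: "real^'n^'n" and K :: "('n::finite, 'k::finite) policy"
  assumes \<gamma>: "0 < \<gamma>" and sm: "summable (\<lambda>t. \<gamma> ^ t * (norm (mpow (aug_mat A B xs K) t))\<^sup>2)"
  shows "sqrt \<gamma> * spectral_radius (A + B ** fst K) < 1"
proof -
  let ?M = "aug_mat A B xs K"
  let ?C = "\<chi> i j. complex_of_real ((A + B ** fst K) $ i $ j)"
  have ev: "sqrt \<gamma> * cmod z < 1" if v: "v \<noteq> 0" "?C *v v = z *s v" for z and v :: "complex^'n"
  proof -
    define v' where "v' i = (case i of None \<Rightarrow> 0 | Some j \<Rightarrow> v $ j)" for i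
    have step: "(\<Sum>j\<in>UNIV. complex_of_real (?M $ i $ j) * v' j) = z * v' i" for i
    proof (cases i)
      case (Some a)
      have "(?C *v v) $ a = z * v $ a" using v(2) by simp
      then show ?thesis using Some by (simp add: sum_UNIV_option aug_mat_def v'_def matrix_vector_mult_def)
    qed (simp add: sum_UNIV_option aug_mat_def v'_def)
    have pow: "(\<Sum>j\<in>UNIV. complex_of_real (mpow ?M t $ i $ j) * v' j) = z ^ t * v' i" for t i
    proof (induction t arbitrary: i)
      case 0
      then show ?case by (simp add: mat_def if_distrib[of "\<lambda>y. y * _"] if_distrib[of complex_of_real] cong: if_cong)
    next
      case (Suc t)
      have "(\<Sum>j\<in>UNIV. complex_of_real (mpow ?M (Suc t) $ i $ j) * v' j)
        = (\<Sum>j\<in>UNIV. \<Sum>k\<in>UNIV. complex_of_real (?M $ i $ k) * (complex_of_real (mpow ?M t $ k $ j) * v' j))"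
        by (simp add: matrix_matrix_mult_def sum_distrib_left sum_distrib_right mult_ac)
      also have "\<dots> = (\<Sum>k\<in>UNIV. complex_of_real (?M $ i $ k) * (\<Sum>j\<in>UNIV. complex_of_real (mpow ?M t $ k $ j) * v' j))"
        by (subst sum.swap) (simp add: sum_distrib_left)
      also have "\<dots> = z ^ t * (\<Sum>k\<in>UNIV. complex_of_real (?M $ i $ k) * v' k)"
        by (simp only: Suc.IH) (simp add: sum_distrib_left mult_ac)
      finally show ?case by (simp add: step)
    qed
    obtain a where a: "v $ a \<noteq> 0" using v(1) by (auto simp: vec_eq_iff)
    define S where "S = (\<Sum>j\<in>UNIV. cmod (v' j))"
    have le: "(\<gamma> * (cmod z)\<^sup>2) ^ t * (cmod (v $ a))\<^sup>2 \<le> \<gamma> ^ t * (norm (mpow ?M t))\<^sup>2 * S\<^sup>2" for t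
    proof -
      have "cmod z ^ t * cmod (v $ a) = cmod (\<Sum>j\<in>UNIV. complex_of_real (mpow ?M t $ Some a $ j) * v' j)"
        unfolding pow by (simp add: norm_mult norm_power v'_def)
      also have "\<dots> \<le> (\<Sum>j\<in>UNIV. cmod (complex_of_real (mpow ?M t $ Some a $ j) * v' j))" by (rule norm_sum)
      also have "\<dots> = (\<Sum>j\<in>UNIV. \<bar>mpow ?M t $ Some a $ j\<bar> * cmod (v' j))" by (simp add: norm_mult)
      also have "\<dots> \<le> (\<Sum>j\<in>UNIV. norm (mpow ?M t) * cmod (v' j))"
        by (intro sum_mono mult_right_mono abs_component_le_norm) auto
      also have "\<dots> = norm (mpow ?M t) * S" by (simp add: S_def sum_distrib_left)
      finally have "(cmod z ^ t * cmod (v $ a))\<^sup>2 \<le> (norm (mpow ?M t) * S)\<^sup>2" by (intro power_mono) auto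
      then have "\<gamma> ^ t * (cmod z ^ t * cmod (v $ a))\<^sup>2 \<le> \<gamma> ^ t * (norm (mpow ?M t) * S)\<^sup>2"
        using \<gamma> by (intro mult_left_mono) auto
      then show ?thesis
        by (simp add: power_mult_distrib power2_eq_square mult_ac)
    qed
    have "(\<lambda>t. \<gamma> ^ t * (norm (mpow ?M t))\<^sup>2 * S\<^sup>2) \<longlonglongrightarrow> 0"
      using tendsto_mult_right[OF summable_LIMSEQ_zero[OF sm], of "S\<^sup>2"] by simp
    then have "eventually (\<lambda>t. \<gamma> ^ t * (norm (mpow ?M t))\<^sup>2 * S\<^sup>2 < (cmod (v $ a))\<^sup>2) sequentially"
      using a by (intro order_tendstoD(2)) auto
    from eventually_happens'[OF sequentially_bot this]
    obtain t where "\<gamma> ^ t * (norm (mpow ?M t))\<^sup>2 * S\<^sup>2 < (cmod (v $ a))\<^sup>2" ..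
    with le[of t] have "(\<gamma> * (cmod z)\<^sup>2) ^ t * (cmod (v $ a))\<^sup>2 < 1 * (cmod (v $ a))\<^sup>2" by simp
    moreover have "0 < (cmod (v $ a))\<^sup>2" using a by simp
    ultimately have "(\<gamma> * (cmod z)\<^sup>2) ^ t < 1" by (simp only: mult_less_cancel_right_pos)
    then have "\<gamma> * (cmod z)\<^sup>2 < 1" by (meson one_le_power not_less)
    then have "(sqrt \<gamma> * cmod z)\<^sup>2 < 1" using \<gamma> by (simp add: power_mult_distrib)
    then show ?thesis using \<gamma> by (simp add: abs_square_less_1)
  qed
  let ?E = "{z. \<exists>v::complex^'n. v \<noteq> 0 \<and> ?C *v v = z *s v}"
  have "Max (cmod ` ?E) \<in> cmod ` ?E"
    using eigenvalues_finite_nonempty[of ?C] by (intro Max_in) auto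
  then show ?thesis unfolding spectral_radius_def using ev by auto
qed

section \<open>Descent along gradients\<close>

text \<open>The gradient is defined by a definite description; it denotes something as soon as a derivative
  exists.\<close>

lemma differentiable_imp_GDERIV_grad:
  fixes f :: "'a::euclidean_space \<Rightarrow> real"
  assumes "f differentiable (at x)"
  shows "GDERIV f x :> grad f x"
proof -
  obtain f' where f': "(f has_derivative f') (at x)"
    using assms unfolding differentiable_def by blast
  interpret f': bounded_linear f' by (rule has_derivative_bounded_linear[OF f'])
  define g where "g = (\<Sum>b\<in>Basis. f' b *\<^sub>R b)"
  have "f' = (\<lambda>h. h \<bullet> g)"
  proof
    fix h
    have "f' h = f' (\<Sum>b\<in>Basis. (h \<bullet> b) *\<^sub>R b)" by (simp add: euclidean_representation)
    also have "\<dots> = h \<bullet> g" by (simp add: f'.sum f'.scaleR g_def inner_sum_right mult.commute)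
    finally show "f' h = h \<bullet> g" .
  qed
  with f' have g: "GDERIV f x :> g" by (simp only: gderiv_def)
  have "g' = g" if "GDERIV f x :> g'" for g'
  proof -
    have "(\<lambda>h. h \<bullet> g') = (\<lambda>h. h \<bullet> g)"
      using has_derivative_unique that g unfolding gderiv_def by blast
    then have "(g' - g) \<bullet> g' = (g' - g) \<bullet> g" by (rule fun_cong)
    then have "(g' - g) \<bullet> (g' - g) = 0" by (simp only: inner_diff_right)
    then show ?thesis by simp
  qed
  with g show ?thesis unfolding grad_def by (rule theI)
qed

lemma GDERIV_along_line:
  fixes f :: "'a::euclidean_space \<Rightarrow> real"
  assumes "GDERIV f (x + s *\<^sub>R h) :> d"
  shows "((\<lambda>s. f (x + s *\<^sub>R h)) has_real_derivative h \<bullet> d) (at s)"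
proof -
  have "((\<lambda>s. x + s *\<^sub>R h) has_derivative (\<lambda>t. t *\<^sub>R h)) (at s)"
    by (auto intro!: derivative_eq_intros)
  from has_derivative_compose[OF this assms[unfolded gderiv_def]]
  show ?thesis by (simp add: has_field_derivative_def mult.commute[of _ "h \<bullet> d"])
qed

text \<open>Gradients are compared with the one at the centre only, and differentiability is required in the
  open ball only. This is what the hypotheses on the cost provide: they are centred at points of the
  sublevel set and say nothing about the cost beyond distance \<open>\<rho>\<close>.\<close>

lemma descent_inequality:
  fixes f :: "'a::euclidean_space \<Rightarrow> real"
  assumes cont: "continuous_on (cball x \<rho>) f"
    and deriv: "\<And>y. y \<in> ball x \<rho> \<Longrightarrow> GDERIV f y :> d y"
    and lip: "\<And>y. y \<in> ball x \<rho> \<Longrightarrow> norm (d y - d x) \<le> L * norm (y - x)"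
    and y: "norm (y - x) \<le> \<rho>"
  shows "f y \<le> f x + d x \<bullet> (y - x) + L / 2 * (norm (y - x))\<^sup>2"
proof (cases "y = x")
  case False
  define h where "h = y - x"
  have h: "0 < norm h" "norm h \<le> \<rho>" using False y by (auto simp: h_def)
  let ?\<phi> = "\<lambda>s. f (x + s *\<^sub>R h) - s * (h \<bullet> d x) - L / 2 * s\<^sup>2 * (norm h)\<^sup>2"
  have "?\<phi> 1 \<le> ?\<phi> 0"
  proof (rule DERIV_nonpos_imp_decreasing_open[where f="?\<phi>"])
    fix s :: real assume s: "0 < s" "s < 1"
    have b: "x + s *\<^sub>R h \<in> ball x \<rho>"
    proof -
      have "s * norm h < \<rho>" using mult_strict_right_mono[OF s(2) h(1)] h(2) by linarith
      then show ?thesis using s by (simp add: dist_norm)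
    qed
    have D: "(?\<phi> has_real_derivative (h \<bullet> d (x + s *\<^sub>R h) - h \<bullet> d x - L * s * (norm h)\<^sup>2)) (at s)"
      by (rule derivative_eq_intros GDERIV_along_line[OF deriv[OF b]] refl | simp)+
    have "h \<bullet> (d (x + s *\<^sub>R h) - d x) \<le> norm h * norm (d (x + s *\<^sub>R h) - d x)"
      by (rule norm_cauchy_schwarz)
    also have "\<dots> \<le> norm h * (L * norm (x + s *\<^sub>R h - x))"
      using lip[OF b] by (rule mult_left_mono) simp
    also have "\<dots> = L * s * (norm h)\<^sup>2" using s by (simp add: power2_eq_square)
    finally have "h \<bullet> d (x + s *\<^sub>R h) - h \<bullet> d x - L * s * (norm h)\<^sup>2 \<le> 0" by (simp add: inner_diff_right)
    with D show "\<exists>y. (?\<phi> has_real_derivative y) (at s) \<and> y \<le> 0" by blast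
  next
    have "x + s *\<^sub>R h \<in> cball x \<rho>" if "s \<in> {0..1}" for s
    proof -
      have "s * norm h \<le> norm h" using that by (intro mult_left_le_one_le) auto
      then have "s * norm h \<le> \<rho>" using h(2) by linarith
      then show ?thesis using that by (simp add: dist_norm)
    qed
    then show "continuous_on {0..1} ?\<phi>"
      by (intro continuous_intros continuous_on_compose2[OF cont]) auto
  qed simp
  then show ?thesis by (simp add: h_def inner_commute)
qed simp

text \<open>On a small ball \<open>f\<close> differs from a linear function by a map with Lipschitz constant
  \<open>L r\<close>. This is the form in which smoothness enters the analysis of the estimator.\<close>

lemma gradient_nearly_constant:
  fixes f :: "'a::euclidean_space \<Rightarrow> real"
  assumes cont: "continuous_on (cball c \<rho>) f"
    and deriv: "\<And>y. y \<in> ball c \<rho> \<Longrightarrow> GDERIV f y :> d y"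
    and lip: "\<And>y. y \<in> ball c \<rho> \<Longrightarrow> norm (d y - d c) \<le> L * norm (y - c)"
    and r: "r \<le> \<rho>" and L: "0 \<le> L" and xy: "norm (x - c) \<le> r" "norm (y - c) \<le> r"
  shows "\<bar>f y - f x - d c \<bullet> (y - x)\<bar> \<le> L * r * norm (y - x)"
proof (cases "x = y")
  case False
  define h where "h = y - x"
  have seg: "x + s *\<^sub>R h \<in> cball c r" if "0 \<le> s" "s \<le> 1" for s
  proof -
    have "x + s *\<^sub>R h = (1 - s) *\<^sub>R x + s *\<^sub>R y" by (simp add: h_def algebra_simps)
    then show ?thesis using that xy by (simp only:, intro convexD[OF convex_cball]) (auto simp: dist_norm norm_minus_commute)
  qed
  have oseg: "x + s *\<^sub>R h \<in> ball c r" if "0 < s" "s < 1" for s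
  proof -
    have "x + s *\<^sub>R h = (1 - s) *\<^sub>R x + s *\<^sub>R y" by (simp add: h_def algebra_simps)
    then have "x + s *\<^sub>R h \<in> open_segment x y" using that False unfolding in_segment by blast
    then have "dist c (x + s *\<^sub>R h) < dist c x \<or> dist c (x + s *\<^sub>R h) < dist c y"
      by (rule dist_decreases_open_segment[rule_format])
    then show ?thesis using xy by (auto simp: dist_norm norm_minus_commute)
  qed
  have "continuous_on {0..1} (\<lambda>s. f (x + s *\<^sub>R h))"
    by (intro continuous_on_compose2[OF cont] continuous_intros) (use seg r in force)
  moreover have "((\<lambda>s. f (x + s *\<^sub>R h)) has_derivative (\<lambda>t. (h \<bullet> d (x + s *\<^sub>R h)) * t)) (at s)" if "0 < s" "s < 1" for s
    using GDERIV_along_line[OF deriv] oseg[OF that] r unfolding has_field_derivative_def by auto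
  ultimately obtain s where s: "0 < s" "s < 1" "f (x + 1 *\<^sub>R h) - f (x + 0 *\<^sub>R h) = (h \<bullet> d (x + s *\<^sub>R h)) * (1 - 0)"
    using mvt[of 0 1 "\<lambda>s. f (x + s *\<^sub>R h)" "\<lambda>s t. (h \<bullet> d (x + s *\<^sub>R h)) * t"] by auto
  have "f y - f x - d c \<bullet> (y - x) = (y - x) \<bullet> (d (x + s *\<^sub>R h) - d c)"
    using s(3) by (simp add: h_def inner_diff_right inner_diff_left inner_commute[of "d c"])
  also have "\<bar>\<dots>\<bar> \<le> norm (y - x) * norm (d (x + s *\<^sub>R h) - d c)" by (rule Cauchy_Schwarz_ineq2)
  also have "\<dots> \<le> norm (y - x) * (L * r)"
  proof (intro mult_left_mono)
    have b: "x + s *\<^sub>R h \<in> ball c r" by (rule oseg[OF s(1,2)])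
    then have "norm (d (x + s *\<^sub>R h) - d c) \<le> L * norm (x + s *\<^sub>R h - c)"
      using r by (intro lip) auto
    also have "\<dots> \<le> L * r" using b L by (intro mult_left_mono) (auto simp: dist_norm norm_minus_commute)
    finally show "norm (d (x + s *\<^sub>R h) - d c) \<le> L * r" .
  qed simp
  finally show ?thesis by (simp add: mult.commute)
qed simp

text \<open>Suppose \<open>\<mu> > 2 L\<close>. At a point with positive value, a full gradient step \<open>1 /
  L\<close> would make the value negative, so that step must be longer than \<open>\<rho>\<close>; the
  truncated step, of length \<open>\<rho>\<close>, then decreases the value by at least
  \<open>\<rho>\<^sup>2 L / 2\<close>. Started from a value close to the infimum of all positive
  values on \<open>G\<close>, the function falls continuously below this infimum along the step, and
  so takes a positive value below it at a point of \<open>G\<close>.\<close>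

lemma PL_constant_le_smoothness:
  fixes f :: "'a::euclidean_space \<Rightarrow> real"
  assumes x0: "x0 \<in> G" "0 < f x0" and \<rho>: "0 < \<rho>" and L: "0 < L" and \<mu>: "0 < \<mu>"
    and cont: "\<And>x. x \<in> G \<Longrightarrow> continuous_on (cball x \<rho>) f"
    and nonneg: "\<And>x y. x \<in> G \<Longrightarrow> norm (y - x) \<le> \<rho> \<Longrightarrow> 0 \<le> f y"
    and descent: "\<And>x y. x \<in> G \<Longrightarrow> norm (y - x) \<le> \<rho> \<Longrightarrow> f y \<le> f x + d x \<bullet> (y - x) + L / 2 * (norm (y - x))\<^sup>2"
    and sublevel: "\<And>x y. x \<in> G \<Longrightarrow> norm (y - x) \<le> \<rho> \<Longrightarrow> f y \<le> f x \<Longrightarrow> y \<in> G"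
    and PL: "\<And>x. x \<in> G \<Longrightarrow> f x \<le> 1 / \<mu> * (norm (d x))\<^sup>2"
  shows "\<mu> \<le> 2 * L"
proof (rule ccontr)
  assume "\<not> \<mu> \<le> 2 * L"
  then have \<mu>L: "2 * L < \<mu>" by simp
  have drop: "\<exists>y. norm (y - x) \<le> \<rho> \<and> f y \<le> f x - \<rho>\<^sup>2 * L / 2" if x: "x \<in> G" "0 < f x" for x
  proof -
    have step: "f (x - s *\<^sub>R d x) \<le> f x - s * (norm (d x))\<^sup>2 + L / 2 * s\<^sup>2 * (norm (d x))\<^sup>2"
      if "0 \<le> s" "s * norm (d x) \<le> \<rho>" for s
      using descent[OF x(1), of "x - s *\<^sub>R d x"] that
      by (simp add: power2_norm_eq_inner[symmetric] power_mult_distrib)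
    have "\<rho> * L < norm (d x)"
    proof (rule ccontr)
      assume "\<not> \<rho> * L < norm (d x)"
      then have s: "1 / L * norm (d x) \<le> \<rho>" using L by (simp add: field_simps)
      have "0 \<le> f (x - (1 / L) *\<^sub>R d x)" using nonneg[OF x(1)] s L by simp
      also have "\<dots> \<le> f x - 1 / L * (norm (d x))\<^sup>2 + L / 2 * (1 / L)\<^sup>2 * (norm (d x))\<^sup>2"
        by (rule step) (use s L in auto)
      also have "\<dots> = f x - (norm (d x))\<^sup>2 / (2 * L)" using L by (simp add: field_simps power2_eq_square)
      finally have "(norm (d x))\<^sup>2 / (2 * L) \<le> f x" by simp
      moreover have "\<mu> * f x \<le> (norm (d x))\<^sup>2" using PL[OF x(1)] \<mu> by (simp add: field_simps)
      ultimately have "\<mu> * f x \<le> 2 * L * f x" using L by (simp add: field_simps)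
      then show False using x(2) \<mu>L by simp
    qed
    then have d: "0 < norm (d x)" "\<rho> * L < norm (d x)" using mult_pos_pos[OF \<rho> L] by linarith+
    have "f (x - (\<rho> / norm (d x)) *\<^sub>R d x) \<le> f x - \<rho> / norm (d x) * (norm (d x))\<^sup>2 + L / 2 * (\<rho> / norm (d x))\<^sup>2 * (norm (d x))\<^sup>2"
      by (rule step) (use d \<rho> in auto)
    also have "\<dots> = f x - \<rho> * norm (d x) + L / 2 * \<rho>\<^sup>2" using d by (simp add: power2_eq_square)
    also have "\<dots> \<le> f x - \<rho> * (\<rho> * L) + L / 2 * \<rho>\<^sup>2" using d \<rho> by simp
    also have "\<dots> = f x - \<rho>\<^sup>2 * L / 2" by (simp add: power2_eq_square)
    finally show ?thesis using d \<rho> by (intro exI[of _ "x - (\<rho> / norm (d x)) *\<^sub>R d x"]) auto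
  qed
  define S where "S = f ` {x \<in> G. 0 < f x}"
  have S: "S \<noteq> {}" "bdd_below S" using x0 by (auto simp: S_def intro!: bdd_belowI[of _ 0])
  have "Inf S < Inf S + \<rho>\<^sup>2 * L / 2" using \<rho> L by simp
  then obtain x where x: "x \<in> G" "0 < f x" "f x < Inf S + \<rho>\<^sup>2 * L / 2"
    using cInf_lessD[OF S(1)] unfolding S_def by blast
  obtain y where y: "norm (y - x) \<le> \<rho>" "f y \<le> f x - \<rho>\<^sup>2 * L / 2" using drop[OF x(1,2)] by blast
  have fy: "f y < Inf S" "0 \<le> f y" using x(3) y nonneg[OF x(1) y(1)] by auto
  have fx: "Inf S \<le> f x" using x by (intro cInf_lower S) (auto simp: S_def)
  \<comment> \<open>A value between \<open>f y \<ge> 0\<close> and the infimum; it is positive, and by continuity it is attained on the segment.\<close>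
  define v where "v = (f y + Inf S) / 2"
  have v: "0 < v" "v < Inf S" "f y \<le> v" "v \<le> f x" using fy fx by (auto simp: v_def)
  have seg: "norm (x + s *\<^sub>R (y - x) - x) \<le> \<rho>" if "s \<in> {0..1}" for s
    using that y(1) mult_left_le_one_le[of "norm (y - x)" s] by simp
  have "continuous_on {0..1} (\<lambda>s. f (x + s *\<^sub>R (y - x)))"
    by (intro continuous_on_compose2[OF cont[OF x(1)]] continuous_intros)
      (use seg in \<open>auto simp: dist_norm norm_minus_commute\<close>)
  then have "\<exists>s\<ge>0. s \<le> 1 \<and> f (x + s *\<^sub>R (y - x)) = v"
    using v by (intro IVT2') auto
  then obtain s where s: "s \<in> {0..1}" "f (x + s *\<^sub>R (y - x)) = v" by auto
  have "x + s *\<^sub>R (y - x) \<in> G"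
    by (rule sublevel[OF x(1) seg[OF s(1)]]) (use s v in simp)
  then have "v \<in> S" using s v by (auto simp: S_def)
  then have "Inf S \<le> v" by (intro cInf_lower S)
  then show False using v by simp
qed

section \<open>Where the cost is finite it is differentiable\<close>

text \<open>The cost agrees with the rational function on the closed ball. This gives derivatives in its
  interior, and continuity up to the boundary.\<close>

lemma (in initial_law) finite_cost_calculus:
  fixes A :: "real^'n^'n" and B :: "real^'k^'n" and K :: "('n, 'k::finite) policy"
  assumes Q: "pos_def Q" and R: "pos_def R" and \<gamma>: "0 < \<gamma>" "\<gamma> < 1"
    and fin: "\<And>K'. norm (K' - K) \<le> \<rho> \<Longrightarrow> cost A B Q R \<gamma> xs D K' < \<top>"
  shows "continuous_on (cball K \<rho>) (\<lambda>K. enn2real (cost A B Q R \<gamma> xs D K))"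
    and "y \<in> ball K \<rho> \<Longrightarrow> GDERIV (\<lambda>K. enn2real (cost A B Q R \<gamma> xs D K)) y :> grad (\<lambda>K. enn2real (cost A B Q R \<gamma> xs D K)) y"
proof -
  let ?f = "\<lambda>K. enn2real (cost A B Q R \<gamma> xs D K)" and ?\<Phi> = "rational_cost A B Q R \<gamma> xs moment"
  have eq: "?f y = ?\<Phi> y" and diff: "?\<Phi> differentiable (at y)" if "y \<in> cball K \<rho>" for y
  proof -
    have "cost A B Q R \<gamma> xs D y < \<top>" using that fin[of y] by (simp add: dist_norm norm_minus_commute)
    from finite_cost_rational[OF Q R \<gamma> this]
    show "?f y = ?\<Phi> y" "?\<Phi> differentiable (at y)" by (auto intro: differentiable_rational_cost)
  qed
  have "continuous_on (cball K \<rho>) ?\<Phi>"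
    by (intro continuous_at_imp_continuous_on ballI differentiable_imp_continuous_within diff)
  then show "continuous_on (cball K \<rho>) ?f" by (subst continuous_on_cong[OF refl eq])
  show "GDERIV ?f y :> grad ?f y" if y: "y \<in> ball K \<rho>"
  proof (rule differentiable_imp_GDERIV_grad)
    obtain D' where D': "(?\<Phi> has_derivative D') (at y)"
      using diff[of y] y unfolding differentiable_def by auto
    have "(?f has_derivative D') (at y)"
      by (rule has_derivative_transform_within_open[OF D' open_ball y]) (use eq in auto)
    then show "?f differentiable (at y)" by (rule differentiableI)
  qed
qed

section \<open>Averages over the sphere and gradients over the ball\<close>

lemma integral_lborel_scale:
  fixes f :: "'a::euclidean_space \<Rightarrow> real"
  assumes [measurable]: "f \<in> borel_measurable borel" and c: "0 < c"
  shows "(\<integral>x. f x \<partial>lborel) = c ^ DIM('a) * (\<integral>x. f (c *\<^sub>R x) \<partial>lborel)"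
proof -
  have "(\<integral>x. f x \<partial>lborel) = (\<integral>x. f x \<partial>density (distr lborel borel (\<lambda>x. 0 + c *\<^sub>R x)) (\<lambda>_. ennreal (\<bar>c\<bar>^DIM('a))))"
    using c by (subst lborel_affine[of c 0]) auto
  also have "\<dots> = (\<integral>x. c ^ DIM('a) * f x \<partial>distr lborel borel (\<lambda>x. 0 + c *\<^sub>R x))"
    using c by (subst integral_density) auto
  also have "\<dots> = (\<integral>x. c ^ DIM('a) * f (c *\<^sub>R x) \<partial>lborel)"
    by (subst integral_distr) auto
  finally show ?thesis by simp
qed

lemma integral_lborel_translate:
  fixes f :: "'a::euclidean_space \<Rightarrow> real"
  assumes [measurable]: "f \<in> borel_measurable borel"
  shows "(\<integral>x. f (x + v) \<partial>lborel) = (\<integral>x. f x \<partial>lborel)"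
proof -
  have "(\<integral>x. f x \<partial>lborel) = (\<integral>x. f x \<partial>distr lborel borel ((+) v))"
    by (simp add: lborel_distr_plus)
  also have "\<dots> = (\<integral>x. f (v + x) \<partial>lborel)"
    by (subst integral_distr) auto
  finally show ?thesis by (simp add: add.commute)
qed

lemma sets_borel_ball [measurable]: "ball c r \<in> sets borel"
  by (rule borel_open) simp

lemma borel_measurable_sgn_vec [measurable]:
  "(sgn :: 'a::euclidean_space \<Rightarrow> 'a) \<in> borel_measurable borel"
  unfolding sgn_div_norm[abs_def] by measurable

lemma integral_ball_radial:
  fixes h :: "'a::euclidean_space \<Rightarrow> real"
  assumes [measurable]: "h \<in> borel_measurable borel" and "0 < c"
  shows "(\<integral>x. indicator (ball 0 c) x * h (sgn x) \<partial>lborel) = c ^ DIM('a) * (\<integral>x. indicator (ball 0 1) x * h (sgn x) \<partial>lborel)"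
proof -
  have [measurable]: "(\<lambda>x. h (sgn x)) \<in> borel_measurable borel"
    by (rule measurable_compose[OF borel_measurable_sgn_vec assms(1)])
  have "(\<integral>x. indicator (ball 0 1) x * h (sgn x) \<partial>lborel) = (\<integral>x. indicator (ball 0 c) (c *\<^sub>R x) * h (sgn (c *\<^sub>R x)) \<partial>lborel)"
    using assms(2) by (intro Bochner_Integration.integral_cong) (auto simp: indicator_def sgn_scaleR dist_norm)
  then show ?thesis
    using assms(2) by (subst integral_lborel_scale[of _ c]) auto
qed

lemma integrable_continuous_bounded_support:
  fixes f :: "'a::euclidean_space \<Rightarrow> real"
  assumes "continuous_on UNIV f" and "\<And>x. b < norm x \<Longrightarrow> f x = 0"
  shows "integrable lborel f"
proof -
  have "integrable lborel (\<lambda>x. indicator (cball 0 b) x *\<^sub>R f x)"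
    by (intro borel_integrable_compact) (auto intro: continuous_on_subset[OF assms(1)])
  moreover have "(\<lambda>x. indicator (cball 0 b) x *\<^sub>R f x) = f"
    using assms(2) by (auto simp: indicator_def fun_eq_iff not_le)
  ultimately show ?thesis by simp
qed

lemma integrable_ball_bounded:
  fixes f :: "'a::euclidean_space \<Rightarrow> real"
  assumes [measurable]: "f \<in> borel_measurable borel" and "\<And>x. x \<in> ball 0 1 \<Longrightarrow> \<bar>f x\<bar> \<le> b"
  shows "integrable lborel (\<lambda>x. indicator (ball 0 1) x * f x)"
proof (rule integrableI_bounded_set[where A="ball 0 1" and B=b])
  show "emeasure lborel (ball 0 1 :: 'a set) < \<infinity>" by (rule emeasure_bounded_finite) auto
qed (use assms(2) in \<open>auto simp: indicator_def\<close>)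

text \<open>A Lipschitz cutoff of the unit ball. Its gradient is \<open>- sgn x / (1 - a)\<close> on the annulus
  \<open>a < \<parallel>x\<parallel> < 1\<close> and \<open>0\<close> elsewhere; as \<open>a
  \<rightarrow> 1\<close> it concentrates on the unit sphere, with the direction of the inner normal.\<close>

definition ramp :: "real \<Rightarrow> 'a::real_normed_vector \<Rightarrow> real" where
  "ramp a x = max 0 (min 1 ((1 - norm x) / (1 - a)))"

lemma ramp_bounds: "0 \<le> ramp a x" "ramp a x \<le> 1"
  by (auto simp: ramp_def)

lemma ramp_eq_0: "a < 1 \<Longrightarrow> 1 \<le> norm x \<Longrightarrow> ramp a x = 0"
  by (auto simp: ramp_def max_def min_def field_simps)

lemma ramp_eq_1: "a < 1 \<Longrightarrow> norm x \<le> a \<Longrightarrow> ramp a x = 1"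
  by (auto simp: ramp_def max_def min_def field_simps)

lemma ramp_lipschitz:
  assumes "a < 1"
  shows "\<bar>ramp a x - ramp a y\<bar> \<le> norm (x - y) / (1 - a)"
proof -
  have "\<bar>ramp a x - ramp a y\<bar> \<le> \<bar>(1 - norm x) / (1 - a) - (1 - norm y) / (1 - a)\<bar>"
    by (simp add: ramp_def max_def min_def)
  also have "\<dots> = \<bar>norm x - norm y\<bar> / (1 - a)"
    using assms by (simp add: diff_divide_distrib[symmetric] abs_minus_commute)
  also have "\<dots> \<le> norm (x - y) / (1 - a)"
    using assms by (intro divide_right_mono norm_triangle_ineq3) auto
  finally show ?thesis .
qed

lemma continuous_ramp: "a < 1 \<Longrightarrow> continuous_on S (ramp a)"
  unfolding ramp_def[abs_def] by (intro continuous_intros) auto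

lemma ramp_has_derivative:
  fixes x :: "'a::euclidean_space"
  assumes a: "0 < a" "a < 1" and x: "norm x \<noteq> a" "norm x \<noteq> 1"
  shows "(ramp a has_derivative (\<lambda>h. - indicator {x. a \<le> norm x \<and> norm x < 1} x * (h \<bullet> sgn x) / (1 - a))) (at x)"
proof -
  have op: "open {x::'a. norm x < a}" "open {x::'a. 1 < norm x}" "open {x::'a. a < norm x \<and> norm x < 1}"
    by (intro open_Collect_less open_Collect_conj continuous_intros)+
  consider "norm x < a" | "1 < norm x" | "a < norm x" "norm x < 1" using x by linarith
  then show ?thesis
  proof cases
    case 1
    have "((\<lambda>x. 1) has_derivative (\<lambda>h. 0)) (at x)" by simp
    then have "(ramp a has_derivative (\<lambda>h. 0)) (at x)"
      by (rule has_derivative_transform_within_open[OF _ op(1)]) (use 1 a in \<open>auto simp: ramp_eq_1\<close>)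
    then show ?thesis using 1 by simp
  next
    case 2
    have "((\<lambda>x. 0) has_derivative (\<lambda>h. 0)) (at x)" by simp
    then have "(ramp a has_derivative (\<lambda>h. 0)) (at x)"
      by (rule has_derivative_transform_within_open[OF _ op(2)]) (use 2 a in \<open>auto simp: ramp_eq_0\<close>)
    then show ?thesis using 2 by simp
  next
    case 3
    then have "x \<noteq> 0" using a by auto
    then have "((\<lambda>x. (1 - norm x) / (1 - a)) has_derivative (\<lambda>h. (0 - (h \<bullet> sgn x)) / (1 - a))) (at x)"
      using a by (auto intro!: derivative_eq_intros has_derivative_norm simp: divide_inverse)
    then have "(ramp a has_derivative (\<lambda>h. (0 - (h \<bullet> sgn x)) / (1 - a))) (at x)"
      by (rule has_derivative_transform_within_open[OF _ op(3)])
        (use 3 a in \<open>auto simp: ramp_def max_def min_def field_simps\<close>)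
    then show ?thesis using 3 by simp
  qed
qed

lemma has_derivative_imp_difference_quotient:
  fixes f :: "'a::real_normed_vector \<Rightarrow> real"
  assumes "(f has_derivative D) (at x)"
  shows "(\<lambda>n. (f (x + inverse (real (Suc n)) *\<^sub>R h) - f x) / inverse (real (Suc n))) \<longlonglongrightarrow> D h"
proof -
  have "((\<lambda>t. x + t *\<^sub>R h) has_derivative (\<lambda>t. t *\<^sub>R h)) (at 0)"
    by (auto intro!: derivative_eq_intros)
  moreover have "(f has_derivative D) (at (x + 0 *\<^sub>R h))" using assms by simp
  ultimately have "((\<lambda>t. f (x + t *\<^sub>R h)) has_derivative (\<lambda>t. D (t *\<^sub>R h))) (at 0)"
    by (rule has_derivative_compose)
  then have "((\<lambda>t. f (x + t *\<^sub>R h)) has_real_derivative D h) (at 0)"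
    using has_derivative_bounded_linear[OF assms]
    by (simp add: has_field_derivative_def linear_simps mult.commute[of _ "D h"] )
  then have *: "(\<lambda>t. (f (x + (0 + t) *\<^sub>R h) - f (x + 0 *\<^sub>R h)) / t) \<midarrow>0\<rightarrow> D h"
    by (simp only: DERIV_def)
  have "filterlim (\<lambda>n. inverse (real (Suc n))) (at 0) sequentially"
    using LIMSEQ_inverse_real_of_nat by (simp add: filterlim_at)
  from filterlim_compose[OF * this] show ?thesis by simp
qed

text \<open>Integration by parts in direction \<open>v\<close>, obtained by moving the translation by \<open>v /
  (n + 1)\<close> from \<open>f\<close> to the cutoff. Difference quotients of \<open>f\<close> stand
  in for its derivative; those of the cutoff converge almost everywhere.\<close>

lemma ramp_integration_by_parts:
  fixes f :: "'a::euclidean_space \<Rightarrow> real"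
  assumes a: "0 < a" "a < 1" and cont: "continuous_on UNIV f"
  shows "(\<lambda>n. \<integral>x. ramp a x * ((f (x + inverse (real (Suc n)) *\<^sub>R v) - f x) / inverse (real (Suc n))) \<partial>lborel)
     \<longlonglongrightarrow> (\<integral>x. indicator {x. a \<le> norm x \<and> norm x < 1} x * (sgn x \<bullet> v) * f x \<partial>lborel) / (1 - a)"
proof -
  define s where "s n = inverse (real (Suc n))" for n
  have s: "0 < s n" "s n \<le> 1" for n by (auto simp: s_def field_simps)
  have [measurable]: "f \<in> borel_measurable borel" "ramp a \<in> borel_measurable borel"
    by (intro borel_measurable_continuous_onI cont continuous_ramp a)+
  have fs: "continuous_on UNIV (\<lambda>x. f (x + c))" for c :: 'a
    by (rule continuous_on_compose2[OF cont]) (auto intro!: continuous_intros)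
  have ws: "continuous_on UNIV (\<lambda>x. ramp a (x - c))" for c :: 'a
    by (rule continuous_on_compose2[OF continuous_ramp[OF a(2), of UNIV]]) (auto intro!: continuous_intros)
  have int1: "integrable lborel (\<lambda>x. ramp a x * f (x + c))" for c
    by (rule integrable_continuous_bounded_support[where b=1])
       (use a in \<open>auto intro!: continuous_intros fs continuous_ramp simp: ramp_eq_0\<close>)
  have int2: "integrable lborel (\<lambda>x. ramp a (x - c) * f x)" for c :: 'a
  proof (rule integrable_continuous_bounded_support[where b="1 + norm c"])
    fix x :: 'a assume "1 + norm c < norm x"
    then have "1 \<le> norm (x - c)" using norm_triangle_ineq2[of x c] by linarith
    then show "ramp a (x - c) * f x = 0" using a by (simp add: ramp_eq_0)
  qed (intro continuous_intros ws cont)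
  have shift: "(\<integral>x. ramp a x * f (x + c) \<partial>lborel) = (\<integral>x. ramp a (x - c) * f x \<partial>lborel)" for c
    using integral_lborel_translate[of "\<lambda>x. ramp a (x - c) * f x" c] by simp
  have eq: "(\<integral>x. ramp a x * ((f (x + s n *\<^sub>R v) - f x) / s n) \<partial>lborel)
      = (\<integral>x. (ramp a (x + s n *\<^sub>R (- v)) - ramp a x) / s n * f x \<partial>lborel)" for n
  proof -
    have "(\<integral>x. ramp a x * ((f (x + s n *\<^sub>R v) - f x) / s n) \<partial>lborel)
        = (\<integral>x. (ramp a x * f (x + s n *\<^sub>R v) - ramp a x * f (x + 0)) / s n \<partial>lborel)"
      by (simp add: algebra_simps)
    also have "\<dots> = ((\<integral>x. ramp a x * f (x + s n *\<^sub>R v) \<partial>lborel) - (\<integral>x. ramp a x * f (x + 0) \<partial>lborel)) / s n"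
      by (simp only: Bochner_Integration.integral_diff[OF int1 int1] integral_divide_zero)
    also have "\<dots> = ((\<integral>x. ramp a (x - s n *\<^sub>R v) * f x \<partial>lborel) - (\<integral>x. ramp a (x - 0) * f x \<partial>lborel)) / s n"
      by (simp only: shift)
    also have "\<dots> = (\<integral>x. (ramp a (x - s n *\<^sub>R v) * f x - ramp a (x - 0) * f x) / s n \<partial>lborel)"
      by (simp only: Bochner_Integration.integral_diff[OF int2 int2] integral_divide_zero)
    also have "\<dots> = (\<integral>x. (ramp a (x + s n *\<^sub>R (- v)) - ramp a x) / s n * f x \<partial>lborel)"
      by (simp add: algebra_simps)
    finally show ?thesis .
  qed
  have "(\<lambda>n. \<integral>x. (ramp a (x + s n *\<^sub>R (- v)) - ramp a x) / s n * f x \<partial>lborel)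
     \<longlonglongrightarrow> (\<integral>x. (indicator {x. a \<le> norm x \<and> norm x < 1} x * (sgn x \<bullet> v) * f x) / (1 - a) \<partial>lborel)"
  proof (rule integral_dominated_convergence)
    let ?w = "\<lambda>x. norm v / (1 - a) * (indicator (cball 0 (1 + norm v)) x *\<^sub>R \<bar>f x\<bar>)"
    show "integrable lborel ?w"
      by (intro integrable_mult_right borel_integrable_compact)
         (auto intro!: continuous_intros continuous_on_subset[OF cont])
    show "AE x in lborel. norm ((ramp a (x + s n *\<^sub>R (- v)) - ramp a x) / s n * f x) \<le> ?w x" for n
    proof (rule AE_I2)
      fix x :: 'a
      show "norm ((ramp a (x + s n *\<^sub>R (- v)) - ramp a x) / s n * f x) \<le> ?w x"
      proof (cases "x \<in> cball 0 (1 + norm v)")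
        case True
        have "\<bar>ramp a (x + s n *\<^sub>R (- v)) - ramp a x\<bar> \<le> norm (s n *\<^sub>R (- v)) / (1 - a)"
          using ramp_lipschitz[OF a(2), of "x + s n *\<^sub>R (- v)" x] by simp
        then have "\<bar>ramp a (x + s n *\<^sub>R (- v)) - ramp a x\<bar> / s n \<le> norm v / (1 - a)"
          using s[of n] a by (simp add: field_simps)
        then have "\<bar>ramp a (x + s n *\<^sub>R (- v)) - ramp a x\<bar> / s n * \<bar>f x\<bar> \<le> norm v / (1 - a) * \<bar>f x\<bar>"
          by (intro mult_right_mono) auto
        then show ?thesis using True s[of n] by (simp add: abs_mult)
      next
        case False
        have "norm (s n *\<^sub>R (- v)) \<le> norm v"
          using s[of n] by (simp add: mult_left_le_one_le)
        with False have "1 \<le> norm (x + s n *\<^sub>R (- v))" "1 \<le> norm x"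
          using norm_diff_ineq[of x "s n *\<^sub>R (- v)"] norm_ge_zero[of v]
          by (simp_all only: mem_cball_0 not_le)
        then show ?thesis using a False by (simp add: ramp_eq_0)
      qed
    qed
    have "(sphere 0 r :: 'a set) \<in> null_sets lborel" for r :: real
      using negligible_sphere[of "0::'a" r] by (simp add: negligible_iff_null_sets null_sets_completion_iff)
    then have AEs: "AE x in lborel. (x::'a) \<notin> sphere 0 r" for r
      by (rule AE_not_in)
    have "AE x in lborel. norm (x::'a) \<noteq> a \<and> norm x \<noteq> 1"
      using AEs[of a] AEs[of 1] by eventually_elim simp
    then show "AE x in lborel. (\<lambda>n. (ramp a (x + s n *\<^sub>R (- v)) - ramp a x) / s n * f x)
       \<longlonglongrightarrow> (indicator {x. a \<le> norm x \<and> norm x < 1} x * (sgn x \<bullet> v) * f x) / (1 - a)"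
    proof (rule AE_mp, intro AE_I2 impI)
      fix x :: 'a assume "norm x \<noteq> a \<and> norm x \<noteq> 1"
      then have D: "(ramp a has_derivative (\<lambda>h. - indicator {x. a \<le> norm x \<and> norm x < 1} x * (h \<bullet> sgn x) / (1 - a))) (at x)"
        using a by (intro ramp_has_derivative) auto
      from tendsto_mult_right[OF has_derivative_imp_difference_quotient[OF D, of "- v"], of "f x"]
      show "(\<lambda>n. (ramp a (x + s n *\<^sub>R (- v)) - ramp a x) / s n * f x)
       \<longlonglongrightarrow> (indicator {x. a \<le> norm x \<and> norm x < 1} x * (sgn x \<bullet> v) * f x) / (1 - a)"
        by (simp add: s_def inner_commute algebra_simps)
    qed
  qed simp_all
  then show ?thesis
    unfolding eq[unfolded s_def] s_def by simp
qed

lemma ramp_integral_bounds: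
  fixes a :: real
  assumes a: "0 < a" "a < 1"
  defines "V \<equiv> measure lborel (ball 0 1 :: 'a::euclidean_space set)"
  shows "integrable lborel (ramp a :: 'a \<Rightarrow> real)"
    and "a ^ DIM('a) * V \<le> (\<integral>x. ramp a (x::'a) \<partial>lborel)" and "(\<integral>x. ramp a (x::'a) \<partial>lborel) \<le> V"
proof -
  have fin: "emeasure lborel (ball 0 c :: 'a set) < \<infinity>" for c by (rule emeasure_bounded_finite) auto
  have ind: "integrable lborel (indicator (ball 0 c) :: 'a \<Rightarrow> real)" for c
    using fin by (simp add: integrable_indicator_iff)
  show int: "integrable lborel (ramp a :: 'a \<Rightarrow> real)"
    by (rule integrable_continuous_bounded_support[where b=1]) (use a in \<open>auto simp: ramp_eq_0 intro: continuous_ramp\<close>)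
  have "(\<integral>x. indicator (ball 0 a) (x::'a) \<partial>lborel) \<le> (\<integral>x. ramp a (x::'a) \<partial>lborel)"
    using a by (intro integral_mono ind int) (auto simp: indicator_def ramp_eq_1 ramp_bounds)
  moreover have "(\<integral>x. indicator (ball 0 a) (x::'a) \<partial>lborel) = a ^ DIM('a) * V"
    using integral_ball_radial[of "\<lambda>x::'a. 1" a] a by (simp add: V_def)
  ultimately show "a ^ DIM('a) * V \<le> (\<integral>x. ramp a (x::'a) \<partial>lborel)" by simp
  have "(\<integral>x. ramp a (x::'a) \<partial>lborel) \<le> (\<integral>x. indicator (ball 0 1) (x::'a) \<partial>lborel)"
    using a by (intro integral_mono ind int) (auto simp: indicator_def ramp_eq_0 ramp_bounds)
  then show "(\<integral>x. ramp a (x::'a) \<partial>lborel) \<le> V" by (simp add: V_def)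
qed

text \<open>Facts about a function whose increments are those of \<open>x \<mapsto> g0 \<bullet> x\<close> up to
  an error of Lipschitz size \<open>N\<close>. This hypothesis replaces a bound on
  \<open>\<parallel>\<nabla>f - g0\<parallel>\<close> and avoids discussing the gradient field as a
  measurable function.\<close>

lemma near_linear_lipschitz:
  fixes f :: "'a::euclidean_space \<Rightarrow> real"
  assumes approx: "\<And>x y. \<bar>f (x + y) - f x - g0 \<bullet> y\<bar> \<le> N * norm y"
  shows "0 \<le> N" and "\<bar>f y - f x\<bar> \<le> (N + norm g0) * norm (y - x)" and "continuous_on UNIV f"
proof -
  show N: "0 \<le> N"
    using approx[of 0 "SOME b. b \<in> Basis"] by (simp add: norm_Basis SOME_Basis)
  have lip: "\<bar>f y - f x\<bar> \<le> (N + norm g0) * norm (y - x)" for x y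
  proof -
    have "\<bar>f y - f x\<bar> \<le> \<bar>f (x + (y - x)) - f x - g0 \<bullet> (y - x)\<bar> + \<bar>g0 \<bullet> (y - x)\<bar>" by simp
    also have "\<dots> \<le> N * norm (y - x) + norm g0 * norm (y - x)"
      by (intro add_mono approx Cauchy_Schwarz_ineq2)
    finally show ?thesis by (simp add: algebra_simps)
  qed
  then show "\<bar>f y - f x\<bar> \<le> (N + norm g0) * norm (y - x)" .
  show "continuous_on UNIV f"
    by (rule lipschitz_on_continuous_on[of "N + norm g0"])
      (use lip N in \<open>auto intro!: lipschitz_onI simp: dist_norm\<close>)
qed

lemma annulus_integral_bound:
  fixes f :: "'a::euclidean_space \<Rightarrow> real"
  assumes approx: "\<And>x y. \<bar>f (x + y) - f x - g0 \<bullet> y\<bar> \<le> N * norm y"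
    and a: "0 < a" "a < 1"
  defines "W \<equiv> \<integral>x. ramp a (x::'a) \<partial>lborel"
  shows "\<bar>(\<integral>x. indicator {x. a \<le> norm x \<and> norm x < 1} x * (sgn x \<bullet> v) * f x \<partial>lborel) / (1 - a) - (g0 \<bullet> v) * W\<bar>
    \<le> N * norm v * W"
proof -
  have cont: "continuous_on UNIV f" by (rule near_linear_lipschitz(3)[OF approx])
  have [measurable]: "f \<in> borel_measurable borel" "ramp a \<in> borel_measurable borel"
    by (intro borel_measurable_continuous_onI cont continuous_ramp a)+
  have int: "integrable lborel (ramp a :: 'a \<Rightarrow> real)" using ramp_integral_bounds(1)[OF a] .
  have fs: "continuous_on UNIV (\<lambda>x. f (x + c))" for c :: 'a
    by (rule continuous_on_compose2[OF cont]) (auto intro!: continuous_intros)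
  have main: "\<bar>(\<integral>x. ramp a x * ((f (x + s *\<^sub>R v) - f x) / s) \<partial>lborel) - (g0 \<bullet> v) * W\<bar> \<le> N * norm v * W" if s: "0 < s" for s
  proof -
    have int2: "integrable lborel (\<lambda>x. ramp a x * ((f (x + s *\<^sub>R v) - f x) / s))"
      by (rule integrable_continuous_bounded_support[where b=1])
        (use a s in \<open>auto intro!: continuous_intros fs cont continuous_ramp simp: ramp_eq_0\<close>)
    have "(\<integral>x. ramp a x * ((f (x + s *\<^sub>R v) - f x) / s) \<partial>lborel) - (g0 \<bullet> v) * W
      = (\<integral>x. ramp a x * ((f (x + s *\<^sub>R v) - f x) / s) - (g0 \<bullet> v) * ramp a x \<partial>lborel)"
      using int int2 by (simp add: W_def)
    also have "\<bar>\<dots>\<bar> \<le> (\<integral>x. N * norm v * ramp a (x::'a) \<partial>lborel)"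
    proof (rule integral_abs_bound[THEN order_trans], rule integral_mono)
      fix x
      have "\<bar>f (x + s *\<^sub>R v) - f x - g0 \<bullet> (s *\<^sub>R v)\<bar> \<le> N * norm (s *\<^sub>R v)" by (rule approx)
      then have "\<bar>(f (x + s *\<^sub>R v) - f x) / s - g0 \<bullet> v\<bar> \<le> N * norm v"
        using s by (simp add: abs_le_iff field_simps)
      then have "ramp a x * \<bar>(f (x + s *\<^sub>R v) - f x) / s - g0 \<bullet> v\<bar> \<le> ramp a x * (N * norm v)"
        by (intro mult_left_mono ramp_bounds)
      moreover have "\<bar>ramp a x * ((f (x + s *\<^sub>R v) - f x) / s) - (g0 \<bullet> v) * ramp a x\<bar> = ramp a x * \<bar>(f (x + s *\<^sub>R v) - f x) / s - g0 \<bullet> v\<bar>"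
        by (subst (3) abs_of_nonneg[OF ramp_bounds(1), symmetric], subst abs_mult[symmetric]) (simp add: algebra_simps)
      ultimately show "\<bar>ramp a x * ((f (x + s *\<^sub>R v) - f x) / s) - (g0 \<bullet> v) * ramp a x\<bar> \<le> N * norm v * ramp a x"
        by (simp add: mult.commute)
    qed (use int int2 in auto)
    finally show ?thesis using int by (simp add: W_def)
  qed
  have lim: "(\<lambda>n. \<bar>(\<integral>x. ramp a x * ((f (x + inverse (real (Suc n)) *\<^sub>R v) - f x) / inverse (real (Suc n))) \<partial>lborel) - (g0 \<bullet> v) * W\<bar>)
     \<longlonglongrightarrow> \<bar>(\<integral>x. indicator {x. a \<le> norm x \<and> norm x < 1} x * (sgn x \<bullet> v) * f x \<partial>lborel) / (1 - a) - (g0 \<bullet> v) * W\<bar>"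
    by (intro tendsto_intros ramp_integration_by_parts a cont)
  show ?thesis
    by (rule LIMSEQ_le_const2[OF lim]) (use main in auto)
qed

text \<open>The divergence theorem on the unit ball, in the form of an estimate: let \<open>a \<rightarrow>
  1\<close> in the bound for the annulus. There \<open>f x\<close> may be replaced by \<open>f (sgn
  x)\<close>, and the integral of a function of \<open>sgn x\<close> over the annulus is \<open>1 -
  a\<^sup>d\<close> times its integral over the ball; the factor \<open>d\<close> is the limit of
  \<open>(1 - a\<^sup>d) / (1 - a)\<close>.\<close>

lemma ball_average_bound:
  fixes f :: "'a::euclidean_space \<Rightarrow> real"
  assumes approx: "\<And>x y. \<bar>f (x + y) - f x - g0 \<bullet> y\<bar> \<le> N * norm y"
  defines "V \<equiv> measure lborel (ball 0 1 :: 'a::euclidean_space set)"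
  shows "\<bar>real DIM('a) * (\<integral>x. indicator (ball 0 1) x * (f (sgn x) * (sgn x \<bullet> v)) \<partial>lborel) - (g0 \<bullet> v) * V\<bar>
    \<le> N * norm v * V"
proof -
  define C where "C = (\<integral>x. indicator (ball 0 1) x * (f (sgn x) * (sgn x \<bullet> v)) \<partial>lborel)"
  define Nn where "Nn = N + norm g0"
  have N: "0 \<le> N" by (rule near_linear_lipschitz(1)[OF approx])
  have lip: "\<bar>f y - f x\<bar> \<le> Nn * norm (y - x)" for x y
    unfolding Nn_def by (rule near_linear_lipschitz(2)[OF approx])
  have Nn: "0 \<le> Nn" using N by (simp add: Nn_def)
  have cont: "continuous_on UNIV f" by (rule near_linear_lipschitz(3)[OF approx])
  have [measurable]: "f \<in> borel_measurable borel"
    by (intro borel_measurable_continuous_onI cont)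
  have fsgn[measurable]: "(\<lambda>x. f (sgn x)) \<in> borel_measurable borel" "(\<lambda>x::'a. sgn x \<bullet> v) \<in> borel_measurable borel"
    by (auto intro!: borel_measurable_inner measurable_compose[OF borel_measurable_sgn_vec])
  define B where "B = \<bar>f 0\<bar> + Nn"
  have fB: "\<bar>f x\<bar> \<le> B" if "norm x \<le> 1" for x
  proof -
    have "\<bar>f x\<bar> \<le> \<bar>f 0\<bar> + \<bar>f x - f 0\<bar>" by simp
    also have "\<bar>f x - f 0\<bar> \<le> Nn * norm x" using lip[of x 0] by simp
    also have "\<dots> \<le> Nn" using that Nn by (simp add: mult_left_le)
    finally show ?thesis by (simp add: B_def)
  qed
  have B: "0 \<le> B" using fB[of 0] by auto
  have sv: "\<bar>sgn x \<bullet> v\<bar> \<le> norm v" for x :: 'a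
    using Cauchy_Schwarz_ineq2[of "sgn x" v] by (cases "x = 0") (auto simp: norm_sgn)
  have nsgn: "norm (sgn x) \<le> 1" for x :: 'a by (simp add: norm_sgn)
  have intC: "integrable lborel (\<lambda>x. indicator (ball 0 1) x * (f (sgn x) * (sgn x \<bullet> v)))"
    by (rule integrable_ball_bounded[where b="B * norm v"])
       (auto simp: abs_mult intro!: mult_mono fB nsgn sv B)
  have intf: "integrable lborel (\<lambda>x. indicator (ball 0 1) x * (f x * (sgn x \<bullet> v)))"
    by (rule integrable_ball_bounded[where b="B * norm v"])
       (auto simp: abs_mult intro!: mult_mono fB sv B)
  have main: "\<bar>(1 - a ^ DIM('a)) / (1 - a) * C - (g0 \<bullet> v) * (\<integral>x. ramp a (x::'a) \<partial>lborel)\<bar>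
     \<le> N * norm v * (\<integral>x. ramp a (x::'a) \<partial>lborel) + Nn * norm v * (1 - a ^ DIM('a)) * V" if a: "0 < a" "a < 1" for a
  proof -
    define A where "A = {x::'a. a \<le> norm x \<and> norm x < 1}"
    have [measurable]: "A \<in> sets borel" unfolding A_def by measurable
    have Aind: "indicator A x * y = indicator A x * (indicator (ball 0 1) x * y)" for x and y :: real
      by (auto simp: A_def indicator_def)
    have Adiff: "indicator A x * y = indicator (ball 0 1) x * y - indicator (ball 0 a) x * y" for x and y :: real
      using a by (auto simp: A_def indicator_def)
    have ballsub: "indicator (ball 0 a) x * y = indicator (ball 0 a) x *\<^sub>R (indicator (ball 0 1) x * y)" for x :: 'a and y :: real
      using a by (auto simp: indicator_def)
    have intA: "integrable lborel (\<lambda>x. indicator A x * (f (sgn x) * (sgn x \<bullet> v)))"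
      by (subst Aind, rule integrable_mult_indicator[OF _ intC, of A, unfolded real_scaleR_def]) simp
    have intAf: "integrable lborel (\<lambda>x. indicator A x * (f x * (sgn x \<bullet> v)))"
      by (subst Aind, rule integrable_mult_indicator[OF _ intf, of A, unfolded real_scaleR_def]) simp
    have intb: "integrable lborel (\<lambda>x. indicator (ball 0 a) x * (f (sgn x) * (sgn x \<bullet> v)))"
      by (subst ballsub, rule integrable_mult_indicator[OF _ intC]) simp
    have AC: "(\<integral>x. indicator A x * (f (sgn x) * (sgn x \<bullet> v)) \<partial>lborel) = (1 - a ^ DIM('a)) * C"
    proof -
      have "(\<integral>x. indicator (ball 0 a) x * (f (sgn x) * (sgn x \<bullet> v)) \<partial>lborel) = a ^ DIM('a) * C"
        using integral_ball_radial[of "\<lambda>x. f x * (x \<bullet> v)" a] a by (simp add: C_def)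
      then show ?thesis
        unfolding Adiff using intC intb by (simp add: C_def algebra_simps)
    qed
    have fin: "emeasure lborel (ball 0 c :: 'a set) < \<infinity>" for c by (rule emeasure_bounded_finite) auto
    have ind: "integrable lborel (indicator (ball 0 c) :: 'a \<Rightarrow> real)" for c
      using fin by (simp add: integrable_indicator_iff)
    have intA1: "integrable lborel (\<lambda>x. indicator A x * (1::real))"
      unfolding Adiff using ind by simp
    have A1: "(\<integral>x. indicator A x * (1::real) \<partial>lborel) = (1 - a ^ DIM('a)) * V"
      unfolding Adiff using ind integral_ball_radial[of "\<lambda>x::'a. 1" a] a
      by (simp add: V_def algebra_simps)
    have split: "(P - q * R) / w = P / w - q / w * R" for P q R w :: real
      by (simp add: diff_divide_distrib)
    have "\<bar>(\<integral>x. indicator A x * (f x * (sgn x \<bullet> v)) \<partial>lborel) - (1 - a ^ DIM('a)) * C\<bar>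
      = \<bar>\<integral>x. indicator A x * (f x * (sgn x \<bullet> v)) - indicator A x * (f (sgn x) * (sgn x \<bullet> v)) \<partial>lborel\<bar>"
      using intA intAf AC by simp
    also have "\<dots> \<le> (\<integral>x. (Nn * (1 - a) * norm v) * (indicator A x * 1) \<partial>lborel)"
    proof (rule integral_abs_bound[THEN order_trans], rule integral_mono)
      fix x :: 'a
      show "\<bar>indicator A x * (f x * (sgn x \<bullet> v)) - indicator A x * (f (sgn x) * (sgn x \<bullet> v))\<bar> \<le> Nn * (1 - a) * norm v * (indicator A x * 1)"
      proof (cases "x \<in> A")
        case True
        then have x: "a \<le> norm x" "norm x < 1" "x \<noteq> 0" using a by (auto simp: A_def)
        have "x - sgn x = (norm x - 1) *\<^sub>R sgn x"
          using x by (simp add: sgn_div_norm algebra_simps)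
        then have "norm (x - sgn x) \<le> 1 - a"
          using x by (simp add: norm_sgn)
        then have "\<bar>f x - f (sgn x)\<bar> \<le> Nn * (1 - a)"
          using lip[of x "sgn x"] Nn by (meson mult_left_mono order_trans)
        then have "\<bar>f x - f (sgn x)\<bar> * \<bar>sgn x \<bullet> v\<bar> \<le> Nn * (1 - a) * norm v"
          using sv Nn a by (intro mult_mono) auto
        then show ?thesis using True by (simp add: abs_mult[symmetric] algebra_simps)
      qed simp
    qed (use intA intAf intA1 in auto)
    also have "\<dots> = Nn * (1 - a) * norm v * ((1 - a ^ DIM('a)) * V)"
      using A1 by simp
    finally have "\<bar>((\<integral>x. indicator A x * (f x * (sgn x \<bullet> v)) \<partial>lborel) - (1 - a ^ DIM('a)) * C) / (1 - a)\<bar> \<le> Nn * norm v * (1 - a ^ DIM('a)) * V"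
      using a by (simp add: field_simps)
    moreover have "\<bar>(\<integral>x. indicator A x * (f x * (sgn x \<bullet> v)) \<partial>lborel) / (1 - a) - (g0 \<bullet> v) * (\<integral>x. ramp a (x::'a) \<partial>lborel)\<bar>
       \<le> N * norm v * (\<integral>x. ramp a (x::'a) \<partial>lborel)"
      using annulus_integral_bound[OF approx a, of v] by (simp add: A_def ac_simps)
    moreover have "((\<integral>x. indicator A x * (f x * (sgn x \<bullet> v)) \<partial>lborel) - (1 - a ^ DIM('a)) * C) / (1 - a)
      = (\<integral>x. indicator A x * (f x * (sgn x \<bullet> v)) \<partial>lborel) / (1 - a) - (1 - a ^ DIM('a)) / (1 - a) * C"
      by (rule split)
    ultimately show ?thesis by linarith
  qed
  define an where "an n = 1 - inverse (real (Suc (Suc n)))" for n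
  have an: "0 < an n" "an n < 1" for n by (auto simp: an_def field_simps)
  have an_lim: "an \<longlonglongrightarrow> 1"
    unfolding an_def by (rule tendsto_eq_intros LIMSEQ_Suc[OF LIMSEQ_inverse_real_of_nat] refl | simp)+
  have pow: "(\<lambda>n. an n ^ DIM('a)) \<longlonglongrightarrow> 1"
    using tendsto_power[OF an_lim, of "DIM('a)"] by simp
  have W: "(\<lambda>n. \<integral>x. ramp (an n) (x::'a) \<partial>lborel) \<longlonglongrightarrow> V"
  proof (rule tendsto_sandwich[OF _ _ _ tendsto_const])
    show "(\<lambda>n. an n ^ DIM('a) * V) \<longlonglongrightarrow> V"
      using tendsto_mult_right[OF pow, of V] by simp
  qed (use ramp_integral_bounds(2,3)[OF an, where 'a='a] in \<open>auto simp: V_def\<close>)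
  have quot: "(\<lambda>n. (1 - an n ^ DIM('a)) / (1 - an n)) \<longlonglongrightarrow> real DIM('a)"
  proof -
    have "((\<lambda>x. x ^ DIM('a)) has_real_derivative real DIM('a)) (at (1::real))"
      by (auto intro!: derivative_eq_intros)
    then have *: "((\<lambda>x. (x ^ DIM('a) - 1 ^ DIM('a)) / (x - 1)) \<longlongrightarrow> real DIM('a)) (at (1::real))"
      by (simp only: has_field_derivative_iff)
    have "filterlim an (at 1) sequentially"
      unfolding filterlim_at using an_lim an(2) by (auto intro!: always_eventually simp: less_imp_neq)
    from filterlim_compose[OF * this]
    have "(\<lambda>n. (an n ^ DIM('a) - 1) / (an n - 1)) \<longlonglongrightarrow> real DIM('a)" by simp
    moreover have "(an n ^ DIM('a) - 1) / (an n - 1) = (1 - an n ^ DIM('a)) / (1 - an n)" for n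
      by (metis minus_diff_eq minus_divide_divide)
    ultimately show ?thesis by simp
  qed
  have "\<bar>real DIM('a) * C - (g0 \<bullet> v) * V\<bar> \<le> N * norm v * V + Nn * norm v * (1 - 1) * V"
  proof (rule LIMSEQ_le)
    show "(\<lambda>n. \<bar>(1 - an n ^ DIM('a)) / (1 - an n) * C - (g0 \<bullet> v) * (\<integral>x. ramp (an n) (x::'a) \<partial>lborel)\<bar>)
       \<longlonglongrightarrow> \<bar>real DIM('a) * C - (g0 \<bullet> v) * V\<bar>"
      by (intro tendsto_intros quot W)
    show "(\<lambda>n. N * norm v * (\<integral>x. ramp (an n) (x::'a) \<partial>lborel) + Nn * norm v * (1 - an n ^ DIM('a)) * V)
       \<longlonglongrightarrow> N * norm v * V + Nn * norm v * (1 - 1) * V"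
      by (intro tendsto_intros pow W)
  qed (use main[OF an] in auto)
  then show ?thesis by (simp add: C_def)
qed

lemma prob_space_unif_sphere: "prob_space (unif_sphere :: 'a::euclidean_space measure)"
proof -
  have "emeasure lborel (ball 0 1 :: 'a set) < \<infinity>" by (rule emeasure_bounded_finite) auto
  moreover have "emeasure lborel (ball 0 1 :: 'a set) \<noteq> 0"
    using content_ball_pos[of 1 "0::'a"] by (auto simp: measure_def)
  ultimately have "prob_space (uniform_measure lborel (ball 0 1 :: 'a set))"
    by (intro prob_space_uniform_measure) auto
  then show ?thesis
    unfolding unif_sphere_def by (rule prob_space.prob_space_distr) simp
qed

lemma sets_unif_sphere [measurable_cong, simp]: "sets unif_sphere = sets borel"
  by (simp add: unif_sphere_def)

lemma AE_unif_sphere: "AE \<delta> in unif_sphere. (\<delta>::'a::euclidean_space) \<in> sphere 0 1"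
proof -
  have "AE x in lborel. (x::'a) \<noteq> 0" by (rule AE_lborel_singleton)
  then have "AE x in uniform_measure lborel (ball 0 1 :: 'a set). sgn x \<in> sphere 0 1"
    by (intro AE_uniform_measureI) (auto simp: norm_sgn)
  then show ?thesis unfolding unif_sphere_def by (subst AE_distr_iff) auto
qed

lemma integral_unif_sphere:
  fixes h :: "'a::euclidean_space \<Rightarrow> real"
  assumes [measurable]: "h \<in> borel_measurable borel"
  shows "(\<integral>\<delta>. h \<delta> \<partial>unif_sphere) * measure lborel (ball 0 1 :: 'a set) = (\<integral>x. indicator (ball 0 1) x * h (sgn x) \<partial>lborel)"
proof -
  let ?V = "measure lborel (ball 0 1 :: 'a set)"
  have fin: "emeasure lborel (ball 0 1 :: 'a set) < \<infinity>" by (rule emeasure_bounded_finite) auto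
  have V: "emeasure lborel (ball 0 1 :: 'a set) = ennreal ?V" using fin by (simp add: emeasure_eq_ennreal_measure)
  have pos: "0 < ?V" by (simp add: content_ball_pos)
  have [measurable]: "(\<lambda>x. h (sgn x)) \<in> borel_measurable borel"
    by (rule measurable_compose[OF borel_measurable_sgn_vec assms(1)])
  have dens: "uniform_measure lborel (ball 0 1 :: 'a set) = density lborel (\<lambda>x. ennreal (indicator (ball 0 1) x / ?V))"
    unfolding uniform_measure_def using pos
    by (intro arg_cong[where f="density lborel"]) (auto simp: V indicator_def divide_ennreal[symmetric] fun_eq_iff)
  have "(\<integral>\<delta>. h \<delta> \<partial>unif_sphere) = (\<integral>x. h (sgn x) \<partial>uniform_measure lborel (ball 0 1 :: 'a set))"
    unfolding unif_sphere_def by (subst integral_distr) auto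
  also have "\<dots> = (\<integral>x. (indicator (ball 0 1) x / ?V) * h (sgn x) \<partial>lborel)"
    unfolding dens using pos by (subst integral_density) auto
  also have "\<dots> = (\<integral>x. indicator (ball 0 1) x * h (sgn x) / ?V \<partial>lborel)" by simp
  also have "\<dots> = (\<integral>x. indicator (ball 0 1) x * h (sgn x) \<partial>lborel) / ?V"
    by (rule integral_divide_zero)
  finally show ?thesis using pos by simp
qed

text \<open>The deviation of \<open>f\<close> from the linear function given by \<open>g0\<close> is extended
  from the closed unit ball to the whole space by composing it with the projection onto the ball. This
  preserves its Lipschitz constant and does not change \<open>f\<close> on the sphere.\<close>

lemma sphere_gradient_bound:
  fixes f :: "'a::euclidean_space \<Rightarrow> real"
  assumes [measurable]: "f \<in> borel_measurable borel"
    and approx: "\<And>x y. x \<in> cball 0 1 \<Longrightarrow> y \<in> cball 0 1 \<Longrightarrow> \<bar>f y - f x - g0 \<bullet> (y - x)\<bar> \<le> N * norm (y - x)"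
  shows "\<bar>real DIM('a) * (\<integral>\<delta>. f \<delta> * (\<delta> \<bullet> v) \<partial>unif_sphere) - g0 \<bullet> v\<bar> \<le> N * norm v"
proof -
  let ?V = "measure lborel (ball 0 1 :: 'a set)"
  have pos: "0 < ?V" by (simp add: content_ball_pos)
  let ?p = "closest_point (cball (0::'a) 1)"
  have p_in: "?p x \<in> cball 0 1" for x by (rule closest_point_in_set) auto
  have p_self: "?p x = x" if "x \<in> cball 0 1" for x using that by (rule closest_point_self)
  have p_lip: "norm (?p y - ?p x) \<le> norm (y - x)" for x y
    using closest_point_lipschitz[of "cball (0::'a) 1" y x] by (simp add: dist_norm)
  have N: "0 \<le> N"
    using approx[of 0 "SOME b. b \<in> Basis"] by (simp add: norm_Basis SOME_Basis)
  define F where "F x = f (?p x) - g0 \<bullet> ?p x + g0 \<bullet> x" for x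
  have Fapprox: "\<bar>F (x + y) - F x - g0 \<bullet> y\<bar> \<le> N * norm y" for x y
  proof -
    have "F (x + y) - F x - g0 \<bullet> y = f (?p (x + y)) - f (?p x) - g0 \<bullet> (?p (x + y) - ?p x)"
      by (simp add: F_def inner_diff_right inner_add_right)
    also have "\<bar>\<dots>\<bar> \<le> N * norm (?p (x + y) - ?p x)" by (intro approx p_in)
    also have "\<dots> \<le> N * norm y" using p_lip[of "x + y" x] N by (intro mult_left_mono) auto
    finally show ?thesis .
  qed
  have "F (sgn x) = f (sgn x)" for x
    using p_self[of "sgn x"] by (simp add: F_def norm_sgn)
  then have "(\<integral>x. indicator (ball 0 1) x * (F (sgn x) * (sgn x \<bullet> v)) \<partial>lborel) = (\<integral>\<delta>. f \<delta> * (\<delta> \<bullet> v) \<partial>unif_sphere) * ?V"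
    by (subst integral_unif_sphere) auto
  from ball_average_bound[OF Fapprox, of v, unfolded this]
  have "\<bar>(real DIM('a) * (\<integral>\<delta>. f \<delta> * (\<delta> \<bullet> v) \<partial>unif_sphere) - g0 \<bullet> v) * ?V\<bar> \<le> N * norm v * ?V"
    by (simp add: algebra_simps)
  then show ?thesis using pos by (simp add: abs_mult)
qed

section \<open>Measurability and bias of the two-point estimator\<close>

lemma continuous_on_matrix_vector_mult:
  fixes F :: "'a::topological_space \<Rightarrow> real^'m^'n"
  assumes "continuous_on S F" "continuous_on S g"
  shows "continuous_on S (\<lambda>p. F p *v g p)"
  unfolding matrix_vector_mult_def
  by (intro continuous_on_vec_lambda continuous_on_sum continuous_on_mult continuous_on_component assms)

lemma continuous_state:
  fixes xs :: "real^'n"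
  shows "continuous_on UNIV (\<lambda>p :: ('n, 'k::finite) policy \<times> (real^'n). state A B xs (fst p) (snd p) t)"
proof (induction t)
  case (Suc t)
  then show ?case
    by (simp add: control_def)
      (intro continuous_intros continuous_on_matrix_vector_mult)
qed (simp add: continuous_on_snd continuous_on_id)

lemma measurable_cost_from:
  fixes xs :: "real^'n"
  shows "(\<lambda>p :: ('n, 'k::finite) policy \<times> (real^'n). cost_from A B Q R \<gamma> xs (fst p) (snd p)) \<in> borel_measurable borel"
proof -
  have "continuous_on UNIV (\<lambda>p :: ('n, 'k) policy \<times> (real^'n). \<gamma> ^ t *
        (let x = state A B xs (fst p) (snd p) t; u = control xs (fst p) x
         in (x - xs) \<bullet> (Q *v (x - xs)) + u \<bullet> (R *v u)))" for t
    unfolding Let_def control_def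
    by (intro continuous_intros continuous_on_matrix_vector_mult continuous_state)
  then have [measurable]: "(\<lambda>p :: ('n, 'k) policy \<times> (real^'n). \<gamma> ^ t *
        (let x = state A B xs (fst p) (snd p) t; u = control xs (fst p) x
         in (x - xs) \<bullet> (Q *v (x - xs)) + u \<bullet> (R *v u))) \<in> borel_measurable borel" for t
    by (rule borel_measurable_continuous_onI)
  show ?thesis unfolding cost_from_def by measurable
qed

lemma measurable_cost_from_pair:
  fixes xs :: "real^'n" and f :: "'c \<Rightarrow> ('n, 'k::finite) policy"
  assumes "f \<in> borel_measurable N" "g \<in> borel_measurable N"
  shows "(\<lambda>y. cost_from A B Q R \<gamma> xs (f y) (g y)) \<in> borel_measurable N"
  using measurable_compose[OF borel_measurable_Pair[OF assms] measurable_cost_from] by simp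

lemma measurable_cost:
  fixes xs :: "real^'n"
  assumes "prob_space D" and D: "sets D = sets borel"
  shows "(cost A B Q R \<gamma> xs D :: ('n, 'k::finite) policy \<Rightarrow> ennreal) \<in> borel_measurable borel"
proof -
  interpret prob_space D by fact
  have "(\<lambda>p :: ('n, 'k) policy \<times> (real^'n). snd p) \<in> borel \<Otimes>\<^sub>M D \<rightarrow>\<^sub>M borel"
    using measurable_snd[of borel D] measurable_cong_sets[OF refl D] by blast
  then have "(\<lambda>(K :: ('n, 'k) policy, x). cost_from A B Q R \<gamma> xs K x) \<in> borel_measurable (borel \<Otimes>\<^sub>M D)"
    unfolding case_prod_beta' by (intro measurable_cost_from_pair measurable_fst)
  then show ?thesis
    unfolding cost_def[abs_def] by (rule borel_measurable_nn_integral)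
qed

lemma measurable_two_point:
  fixes xs :: "real^'n" and f h :: "'c \<Rightarrow> ('n, 'k::finite) policy"
  assumes "f \<in> borel_measurable N" "g \<in> borel_measurable N" "h \<in> borel_measurable N"
  shows "(\<lambda>y. two_point (cost_from A B Q R \<gamma> xs) r (f y) (g y) (h y)) \<in> borel_measurable N"
proof -
  have [measurable]: "(\<lambda>y. cost_from A B Q R \<gamma> xs (f y + r *\<^sub>R h y) (g y)) \<in> borel_measurable N"
    "(\<lambda>y. cost_from A B Q R \<gamma> xs (f y - r *\<^sub>R h y) (g y)) \<in> borel_measurable N"
    using assms by (auto intro!: measurable_cost_from_pair)
  show ?thesis unfolding two_point_def using assms by measurable
qed

lemma closed_msupport: "closed (msupport D)"
proof -
  have "- msupport D = \<Union>{U. open U \<and> emeasure D U = 0}"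
    by (auto simp: msupport_def)
  then show ?thesis unfolding closed_def by auto
qed

text \<open>The complement of the support is covered by the null sets among countably many basic open sets.\<close>

lemma AE_msupport:
  fixes D :: "'a::second_countable_topology measure"
  assumes D: "sets D = sets borel"
  shows "AE x in D. x \<in> msupport D"
proof -
  obtain B :: "'a set set" where B: "countable B" "topological_basis B"
    using ex_countable_basis by blast
  let ?N = "{U \<in> B. emeasure D U = 0}"
  have "(\<Union>U\<in>?N. U) \<in> null_sets D"
  proof (rule null_sets_UN')
    show "countable ?N" using B(1) by (rule countable_subset[rotated]) auto
    show "U \<in> null_sets D" if "U \<in> ?N" for U
      using that topological_basis_open[OF B(2), of U] by (intro null_setsI) (auto simp: D)
  qed
  then have "AE x in D. x \<notin> (\<Union>U\<in>?N. U)" by (rule AE_not_in)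
  then show ?thesis
  proof eventually_elim
    case (elim x)
    show ?case unfolding msupport_def
    proof (intro CollectI allI impI, elim conjE)
      fix U assume "open U" "x \<in> U"
      then obtain V where V: "V \<in> B" "x \<in> V" "V \<subseteq> U" using topological_basisE[OF B(2)] by blast
      then have "0 < emeasure D V" using elim by (auto simp: zero_less_iff_neq_zero)
      also have "\<dots> \<le> emeasure D U" using V \<open>open U\<close> by (intro emeasure_mono) (auto simp: D)
      finally show "0 < emeasure D U" .
    qed
  qed
qed

lemma AE_samples:
  fixes D :: "'a::euclidean_space measure"
  assumes "prob_space D" and D: "sets D = sets borel"
  shows "AE s in D \<Otimes>\<^sub>M (unif_sphere :: 'b::euclidean_space measure). fst s \<in> msupport D \<and> snd s \<in> sphere 0 1"
proof -
  interpret D: prob_space D by fact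
  interpret S: prob_space "unif_sphere :: 'b measure" by (rule prob_space_unif_sphere)
  interpret pair_prob_space D "unif_sphere :: 'b measure" ..
  have [measurable]: "msupport D \<in> sets D" "sphere (0::'b) 1 \<in> sets unif_sphere"
    using closed_msupport[of D] by (auto simp: D)
  show ?thesis
  proof (rule AE_pair_measure)
    show "AE x in D. AE y in (unif_sphere :: 'b measure). fst (x, y) \<in> msupport D \<and> snd (x, y) \<in> sphere 0 1"
      using AE_msupport[OF D]
    proof eventually_elim
      case (elim x)
      show ?case using AE_unif_sphere by eventually_elim (use elim in simp)
    qed
  qed measurable
qed

lemma integral_enn2real_cost_from:
  fixes xs :: "real^'n" and K :: "('n, 'k::finite) policy"
  assumes "prob_space D" and D: "sets D = sets borel" and fin: "cost A B Q R \<gamma> xs D K < \<top>"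
  shows "integrable D (\<lambda>x. enn2real (cost_from A B Q R \<gamma> xs K x))"
    and "(\<integral>x. enn2real (cost_from A B Q R \<gamma> xs K x) \<partial>D) = enn2real (cost A B Q R \<gamma> xs D K)"
proof -
  let ?F = "cost_from A B Q R \<gamma> xs K"
  have [measurable]: "?F \<in> borel_measurable D"
  proof -
    have "?F \<in> borel_measurable borel" by (rule measurable_cost_from_pair) auto
    then show ?thesis using measurable_cong_sets[OF D refl] by blast
  qed
  have "AE x in D. ?F x \<noteq> \<infinity>"
    using fin unfolding cost_def by (intro nn_integral_PInf_AE) auto
  then have AE: "AE x in D. ennreal (enn2real (?F x)) = ?F x" by eventually_elim (simp add: less_top)
  have nn: "(\<integral>\<^sup>+x. ennreal (enn2real (?F x)) \<partial>D) = cost A B Q R \<gamma> xs D K"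
    unfolding cost_def by (rule nn_integral_cong_AE[OF AE])
  show "integrable D (\<lambda>x. enn2real (?F x))"
    using fin nn by (intro integrableI_nonneg) auto
  show "(\<integral>x. enn2real (?F x) \<partial>D) = enn2real (cost A B Q R \<gamma> xs D K)"
    using nn by (subst integral_eq_nn_integral) auto
qed

text \<open>Averaging over the initial state first turns the estimator into a symmetric difference quotient
  \<open>h\<close> of the expected cost in direction \<open>\<delta>\<close>. On the unit ball
  \<open>h\<close> has increments within \<open>L r\<close> of those of the linear function
  \<open>g0\<close>.\<close>

lemma estimator_bias:
  fixes A Q :: "real^'n^'n" and B :: "real^'k^'n" and R :: "real^'k^'k" and \<gamma> r L b :: real
    and D :: "(real^'n) measure" and xs :: "real^'n" and K g0 :: "('n, 'k::finite) policy"
  defines "f \<equiv> \<lambda>K. enn2real (cost A B Q R \<gamma> xs D K)"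
    and "w \<equiv> \<lambda>s. two_point (cost_from A B Q R \<gamma> xs) r K (fst s) (snd s)"
  assumes D: "prob_space D" "sets D = sets borel" and r: "0 < r"
    and fin: "\<And>K'. norm (K' - K) \<le> r \<Longrightarrow> cost A B Q R \<gamma> xs D K' < \<top>"
    and approx: "\<And>x y. norm (x - K) \<le> r \<Longrightarrow> norm (y - K) \<le> r \<Longrightarrow> \<bar>f y - f x - g0 \<bullet> (y - x)\<bar> \<le> L * r * norm (y - x)"
    and bd: "AE s in D \<Otimes>\<^sub>M unif_sphere. norm (w s) \<le> b"
  shows "norm ((\<integral>s. w s \<partial>(D \<Otimes>\<^sub>M unif_sphere)) - g0) \<le> L * r"
proof -
  interpret D: prob_space D by fact
  interpret S: prob_space "unif_sphere :: ('n, 'k) policy measure" by (rule prob_space_unif_sphere)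
  interpret pair_prob_space D "unif_sphere :: ('n, 'k) policy measure" ..
  let ?P = "D \<Otimes>\<^sub>M (unif_sphere :: ('n, 'k) policy measure)"
  let ?d = "real DIM(('n, 'k) policy)"
  have d: "real (2 * CARD('n) * CARD('k)) = ?d" by simp
  have fstP: "fst \<in> borel_measurable ?P"
    using measurable_fst[of D "unif_sphere :: ('n, 'k) policy measure"] measurable_cong_sets[OF refl D(2), of ?P] by blast
  have sndP: "snd \<in> borel_measurable ?P"
    using measurable_snd[of D "unif_sphere :: ('n, 'k) policy measure"]
      measurable_cong_sets[OF refl sets_unif_sphere, of ?P] by blast
  have w: "w \<in> borel_measurable ?P"
    unfolding w_def using fstP sndP by (intro measurable_two_point) auto
  have intw: "integrable ?P w" by (rule P.integrable_const_bound[OF bd w])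
  have f: "f \<in> borel_measurable borel"
    unfolding f_def using measurable_cost[OF D] by measurable
  define h where "h u = (f (K + r *\<^sub>R u) - f (K - r *\<^sub>R u)) / (2 * r)" for u
  have h: "h \<in> borel_measurable borel"
    unfolding h_def[abs_def] using f by measurable
  have "((\<integral>s. w s \<partial>?P) - g0) \<bullet> v \<le> L * r * norm v" for v
  proof -
    define k where "k x \<delta> = w (x, \<delta>) \<bullet> v" for x \<delta>
    have intk: "integrable ?P (case_prod k)"
      using integrable_inner_left[OF intw, of v] by (simp add: k_def case_prod_beta')
    have "(\<integral>s. w s \<partial>?P) \<bullet> v = (\<integral>s. w s \<bullet> v \<partial>?P)"
      using intw by simp
    also have "\<dots> = (\<integral>s. case_prod k s \<partial>?P)" by (simp add: k_def case_prod_beta')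
    also have "\<dots> = (\<integral>\<delta>. (\<integral>x. k x \<delta> \<partial>D) \<partial>unif_sphere)"
      by (rule integral_snd[OF intk, symmetric])
    also have "\<dots> = (\<integral>\<delta>. ?d * (h \<delta> * (\<delta> \<bullet> v)) \<partial>unif_sphere)"
    proof (rule integral_cong_AE)
      show "(\<lambda>\<delta>. \<integral>x. k x \<delta> \<partial>D) \<in> borel_measurable unif_sphere"
        using integrable_snd[OF intk] by simp
      show "(\<lambda>\<delta>. ?d * (h \<delta> * (\<delta> \<bullet> v))) \<in> borel_measurable unif_sphere"
        using h by measurable
      show "AE \<delta> in unif_sphere. (\<integral>x. k x \<delta> \<partial>D) = ?d * (h \<delta> * (\<delta> \<bullet> v))"
        using AE_unif_sphere
      proof eventually_elim
        case (elim \<delta>)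
        then have plus: "cost A B Q R \<gamma> xs D (K + r *\<^sub>R \<delta>) < \<top>" and minus: "cost A B Q R \<gamma> xs D (K - r *\<^sub>R \<delta>) < \<top>"
          using r by (intro fin; simp)+
        note ip = integral_enn2real_cost_from[OF D plus] and im = integral_enn2real_cost_from[OF D minus]
        have pt: "c * ((a - b) / (2 * r)) * e = c / (2 * r) * e * (a - b)" for a b c e :: real
          by (simp add: field_simps)
        have "(\<integral>x. k x \<delta> \<partial>D) = (\<integral>x. (?d / (2 * r) * (\<delta> \<bullet> v)) *
           (enn2real (cost_from A B Q R \<gamma> xs (K + r *\<^sub>R \<delta>) x) - enn2real (cost_from A B Q R \<gamma> xs (K - r *\<^sub>R \<delta>) x)) \<partial>D)"
          by (rule Bochner_Integration.integral_cong[OF refl])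
            (simp only: k_def w_def two_point_def d fst_conv snd_conv inner_scaleR_left, rule pt)
        also have "\<dots> = (?d / (2 * r) * (\<delta> \<bullet> v)) * (f (K + r *\<^sub>R \<delta>) - f (K - r *\<^sub>R \<delta>))"
          using ip im by (simp add: f_def)
        also have "\<dots> = ?d * (h \<delta> * (\<delta> \<bullet> v))" by (simp add: h_def)
        finally show ?case .
      qed
    qed
    also have "\<dots> = ?d * (\<integral>\<delta>. h \<delta> * (\<delta> \<bullet> v) \<partial>unif_sphere)" by (rule integral_mult_right_zero)
    finally have "(\<integral>s. w s \<partial>?P) \<bullet> v = ?d * (\<integral>\<delta>. h \<delta> * (\<delta> \<bullet> v) \<partial>unif_sphere)" .
    moreover have "\<bar>?d * (\<integral>\<delta>. h \<delta> * (\<delta> \<bullet> v) \<partial>unif_sphere) - g0 \<bullet> v\<bar> \<le> L * r * norm v"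
    proof (rule sphere_gradient_bound[OF h])
      fix x y :: "('n, 'k) policy" assume xy: "x \<in> cball 0 1" "y \<in> cball 0 1"
      then have "norm (r *\<^sub>R x) \<le> r" "norm (r *\<^sub>R y) \<le> r" using r by auto
      then have ab: "\<bar>f (K + r *\<^sub>R y) - f (K + r *\<^sub>R x) - g0 \<bullet> (r *\<^sub>R (y - x))\<bar> \<le> L * r * norm (r *\<^sub>R (y - x))"
        "\<bar>f (K - r *\<^sub>R x) - f (K - r *\<^sub>R y) - g0 \<bullet> (r *\<^sub>R (y - x))\<bar> \<le> L * r * norm (r *\<^sub>R (y - x))"
        using approx[of "K + r *\<^sub>R x" "K + r *\<^sub>R y"] approx[of "K - r *\<^sub>R y" "K - r *\<^sub>R x"]
        by (simp_all add: scaleR_diff_right)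
      define a b u n where "a = f (K + r *\<^sub>R y) - f (K + r *\<^sub>R x)" and "b = f (K - r *\<^sub>R x) - f (K - r *\<^sub>R y)"
        and "u = g0 \<bullet> (y - x)" and "n = norm (y - x)"
      have "\<bar>a - r * u\<bar> \<le> L * r * (r * n)" "\<bar>b - r * u\<bar> \<le> L * r * (r * n)"
        using ab r by (simp_all only: a_def b_def u_def n_def inner_scaleR_right norm_scaleR abs_of_pos)
      then have "\<bar>a + b - 2 * (r * u)\<bar> \<le> 2 * (L * r * (r * n))" by linarith
      also have "\<dots> = L * r * n * (2 * r)" by (simp only: mult_ac)
      finally have "\<bar>a + b - 2 * (r * u)\<bar> / (2 * r) \<le> L * r * n" using r by (simp only: pos_divide_le_eq)
      moreover have "h y - h x - u = (a + b - 2 * (r * u)) / (2 * r)"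
        using r by (simp add: h_def a_def b_def field_simps)
      ultimately show "\<bar>h y - h x - g0 \<bullet> (y - x)\<bar> \<le> L * r * norm (y - x)"
        using r by (simp add: u_def[symmetric] n_def[symmetric])
    qed
    ultimately show ?thesis by (simp add: inner_diff_left)
  qed
  \<comment> \<open>Testing with the error vector itself bounds its norm.\<close>
  from this[of "(\<integral>s. w s \<partial>?P) - g0"]
  have sq: "norm ((\<integral>s. w s \<partial>?P) - g0) * norm ((\<integral>s. w s \<partial>?P) - g0) \<le> L * r * norm ((\<integral>s. w s \<partial>?P) - g0)"
    by (simp only: power2_norm_eq_inner[symmetric] power2_eq_square)
  have Lr: "0 \<le> L * r"
  proof -
    define u :: "('n, 'k) policy" where "u = (SOME b. b \<in> Basis)"
    have u: "norm u = 1" by (simp add: u_def SOME_Basis)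
    have "0 \<le> L * r * norm (r *\<^sub>R u)"
      using approx[of K "K + r *\<^sub>R u"] r u by (simp; linarith)
    then show ?thesis using r u by (simp add: zero_le_mult_iff)
  qed
  have "y \<le> c" if "y * y \<le> c * y" "0 \<le> c" "0 \<le> y" for y c :: real
    using that by (cases "y = 0") (auto simp: mult_le_cancel_right)
  from this[OF sq Lr norm_ge_zero] show ?thesis .
qed

section \<open>One minibatch step\<close>

lemma integrable_PiM_bounded:
  fixes f :: "('i \<Rightarrow> 'b) \<Rightarrow> 'a::{banach, second_countable_topology}"
  assumes "prob_space P" and "f \<in> borel_measurable (PiM I (\<lambda>_. P))"
    and "AE \<omega> in PiM I (\<lambda>_. P). norm (f \<omega>) \<le> B"
  shows "integrable (PiM I (\<lambda>_. P)) f"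
proof -
  interpret prob_space "PiM I (\<lambda>_. P)" using assms(1) by (intro prob_space_PiM)
  show ?thesis by (rule integrable_const_bound[OF assms(3,2)])
qed

lemma AE_PiM_all:
  assumes "prob_space P" "finite I" "AE s in P. R s"
  shows "AE \<omega> in PiM I (\<lambda>_. P). \<forall>i\<in>I. R (\<omega> i)"
  using assms by (intro AE_finite_allI AE_PiM_component) auto

lemma integral_PiM_component:
  fixes w :: "'b \<Rightarrow> 'a::{banach, second_countable_topology}"
  assumes "prob_space P" "i \<in> I" and [measurable]: "w \<in> borel_measurable P"
  shows "(\<integral>\<omega>. w (\<omega> i) \<partial>PiM I (\<lambda>_. P)) = (\<integral>s. w s \<partial>P)"
proof -
  have "(\<integral>s. w s \<partial>P) = (\<integral>s. w s \<partial>distr (PiM I (\<lambda>_. P)) P (\<lambda>\<omega>. \<omega> i))"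
    using assms(1,2) by (subst distr_PiM_component) auto
  also have "\<dots> = (\<integral>\<omega>. w (\<omega> i) \<partial>PiM I (\<lambda>_. P))"
    using assms(2) by (intro integral_distr) auto
  finally show ?thesis by simp
qed

text \<open>Independent centred vectors are orthogonal in \<open>L\<^sup>2\<close>.\<close>

lemma second_moment_sum:
  fixes w :: "'b \<Rightarrow> 'a::euclidean_space"
  assumes P: "prob_space P" and w [measurable]: "w \<in> borel_measurable P"
    and bd: "AE s in P. norm (w s) \<le> B" and mean: "(\<integral>s. w s \<partial>P) = 0" and I: "finite I"
  shows "(\<integral>\<omega>. (norm (\<Sum>i\<in>I. w (\<omega> i)))\<^sup>2 \<partial>PiM I (\<lambda>_. P)) = real (card I) * (\<integral>s. (norm (w s))\<^sup>2 \<partial>P)"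
  using I
proof (induction I)
  case empty
  then show ?case by simp
next
  case (insert i I)
  interpret P: prob_space P by (rule P)
  interpret Q: product_prob_space "\<lambda>_. P" by unfold_locales
  have intw: "integrable P w" by (rule P.integrable_const_bound[OF bd w])
  have intw2: "integrable P (\<lambda>s. (norm (w s))\<^sup>2)"
    by (rule P.integrable_const_bound[where B="B\<^sup>2"]) (use bd in \<open>auto elim!: eventually_mono intro: power_mono\<close>)
  have int: "integrable (PiM J (\<lambda>_. P)) (\<lambda>\<omega>. (norm (\<Sum>i\<in>J. w (\<omega> i)))\<^sup>2)" if J: "finite J" for J
  proof (rule integrable_PiM_bounded[OF P, where B="(real (card J) * B)\<^sup>2"])
    show "AE \<omega> in PiM J (\<lambda>_. P). norm ((norm (\<Sum>i\<in>J. w (\<omega> i)))\<^sup>2) \<le> (real (card J) * B)\<^sup>2"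
      using AE_PiM_all[OF P J bd]
    proof eventually_elim
      case (elim \<omega>)
      have "norm (\<Sum>i\<in>J. w (\<omega> i)) \<le> (\<Sum>i\<in>J. B)" using elim by (intro sum_norm_le) auto
      then show ?case by (simp add: power_mono)
    qed
  qed measurable
  interpret PI: prob_space "PiM I (\<lambda>_. P)" by (intro prob_space_PiM P)
  have "(\<integral>\<omega>. (norm (\<Sum>j\<in>insert i I. w (\<omega> j)))\<^sup>2 \<partial>PiM (insert i I) (\<lambda>_. P))
     = (\<integral>x. \<integral>y. (norm (\<Sum>j\<in>insert i I. w ((x(i := y)) j)))\<^sup>2 \<partial>P \<partial>PiM I (\<lambda>_. P))"
    using insert by (intro Q.product_integral_insert int) auto
  also have "\<dots> = (\<integral>x. (norm (\<Sum>j\<in>I. w (x j)))\<^sup>2 + (\<integral>s. (norm (w s))\<^sup>2 \<partial>P) \<partial>PiM I (\<lambda>_. P))"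
  proof (rule Bochner_Integration.integral_cong[OF refl])
    fix x
    let ?S = "\<Sum>j\<in>I. w (x j)"
    have "(\<Sum>j\<in>insert i I. w ((x(i := y)) j)) = ?S + w y" for y
    proof -
      have "(\<Sum>j\<in>I. w ((x(i := y)) j)) = ?S" using insert by (intro sum.cong) auto
      then show ?thesis using insert by (simp add: add.commute)
    qed
    then have "(norm (\<Sum>j\<in>insert i I. w ((x(i := y)) j)))\<^sup>2 = (norm ?S)\<^sup>2 + 2 * (?S \<bullet> w y) + (norm (w y))\<^sup>2" for y
      by (simp add: power2_norm_eq_inner inner_add_left inner_add_right inner_commute)
    then have "(\<integral>y. (norm (\<Sum>j\<in>insert i I. w ((x(i := y)) j)))\<^sup>2 \<partial>P)
       = (\<integral>y. (norm ?S)\<^sup>2 + 2 * (?S \<bullet> w y) + (norm (w y))\<^sup>2 \<partial>P)" by simp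
    also have "\<dots> = (norm ?S)\<^sup>2 + 2 * (?S \<bullet> (\<integral>s. w s \<partial>P)) + (\<integral>s. (norm (w s))\<^sup>2 \<partial>P)"
      using intw intw2 by (simp add: P.prob_space)
    finally show "(\<integral>y. (norm (\<Sum>j\<in>insert i I. w ((x(i := y)) j)))\<^sup>2 \<partial>P) = (norm ?S)\<^sup>2 + (\<integral>s. (norm (w s))\<^sup>2 \<partial>P)"
      by (simp add: mean)
  qed
  also have "\<dots> = real (card (insert i I)) * (\<integral>s. (norm (w s))\<^sup>2 \<partial>P)"
    using int[OF insert(1)] insert by (simp add: PI.prob_space algebra_simps)
  finally show ?case .
qed

lemma minibatch_moments:
  fixes w :: "'b \<Rightarrow> 'a::euclidean_space"
  assumes P: "prob_space P" and w [measurable]: "w \<in> borel_measurable P"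
    and bd: "AE s in P. norm (w s) \<le> B" and I: "finite I" "I \<noteq> {}"
  defines "g \<equiv> \<integral>s. w s \<partial>P" and "m \<equiv> real (card I)"
  shows "(\<integral>\<omega>. (1 / m) *\<^sub>R (\<Sum>i\<in>I. w (\<omega> i)) \<partial>PiM I (\<lambda>_. P)) = g"
    and "(\<integral>\<omega>. (norm ((1 / m) *\<^sub>R (\<Sum>i\<in>I. w (\<omega> i))))\<^sup>2 \<partial>PiM I (\<lambda>_. P))
       = (norm g)\<^sup>2 + (\<integral>s. (norm (w s - g))\<^sup>2 \<partial>P) / m"
proof -
  interpret P: prob_space P by (rule P)
  interpret PI: prob_space "PiM I (\<lambda>_. P)" by (intro prob_space_PiM P)
  have m: "0 < m" using I by (simp add: m_def card_gt_0_iff)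
  have intc: "integrable (PiM I (\<lambda>_. P)) (\<lambda>\<omega>. u (\<omega> i))" if "i \<in> I" "u \<in> borel_measurable P" "AE s in P. norm (u s) \<le> C"
    for u :: "'b \<Rightarrow> 'a" and i C
    using that by (intro integrable_PiM_bounded[OF P, where B=C] AE_PiM_component) (auto intro: P)
  have intw: "integrable P w" by (rule P.integrable_const_bound[OF bd w])
  have "(\<integral>\<omega>. (1 / m) *\<^sub>R (\<Sum>i\<in>I. w (\<omega> i)) \<partial>PiM I (\<lambda>_. P)) = (1 / m) *\<^sub>R (\<Sum>i\<in>I. \<integral>\<omega>. w (\<omega> i) \<partial>PiM I (\<lambda>_. P))"
    using bd w by (simp add: Bochner_Integration.integral_sum intc)
  also have "\<dots> = (1 / m) *\<^sub>R (\<Sum>i\<in>I. g)"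
    unfolding g_def by (intro arg_cong[where f="scaleR (1 / m)"] sum.cong integral_PiM_component P w refl)
  also have "\<dots> = g" using m by (simp add: m_def sum_constant_scaleR)
  finally show "(\<integral>\<omega>. (1 / m) *\<^sub>R (\<Sum>i\<in>I. w (\<omega> i)) \<partial>PiM I (\<lambda>_. P)) = g" .
  define u where "u s = w s - g" for s
  have u [measurable]: "u \<in> borel_measurable P" unfolding u_def by measurable
  have bdu: "AE s in P. norm (u s) \<le> B + norm g"
    using bd by eventually_elim (auto simp: u_def intro: norm_triangle_le_diff)
  have mu: "(\<integral>s. u s \<partial>P) = 0" using intw by (simp add: u_def g_def P.prob_space)
  let ?S = "\<lambda>\<omega>. \<Sum>i\<in>I. u (\<omega> i)"
  have bS: "AE \<omega> in PiM I (\<lambda>_. P). norm (?S \<omega>) \<le> real (card I) * (B + norm g)"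
    using AE_PiM_all[OF P I(1) bdu]
  proof eventually_elim
    case (elim \<omega>)
    have "norm (?S \<omega>) \<le> (\<Sum>i\<in>I. B + norm g)" using elim by (intro sum_norm_le) auto
    then show ?case by simp
  qed
  have intS: "integrable (PiM I (\<lambda>_. P)) ?S"
    using bdu u by (intro Bochner_Integration.integrable_sum intc)
  have eS: "(\<integral>\<omega>. ?S \<omega> \<partial>PiM I (\<lambda>_. P)) = 0"
    using bdu u mu by (simp add: Bochner_Integration.integral_sum intc integral_PiM_component[OF P])
  have intS2: "integrable (PiM I (\<lambda>_. P)) (\<lambda>\<omega>. (norm (?S \<omega>))\<^sup>2)"
  proof (rule integrable_PiM_bounded[OF P])
    show "AE \<omega> in PiM I (\<lambda>_. P). norm ((norm (?S \<omega>))\<^sup>2) \<le> (real (card I) * (B + norm g))\<^sup>2"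
      using bS by eventually_elim (auto intro: power_mono)
  qed measurable
  have "(1 / m) *\<^sub>R (\<Sum>i\<in>I. w (\<omega> i)) = g + (1 / m) *\<^sub>R ?S \<omega>" for \<omega>
    using m by (simp add: u_def sum_subtractf sum_constant_scaleR scaleR_diff_right m_def)
  moreover have "(norm (a + c *\<^sub>R b))\<^sup>2 = (norm a)\<^sup>2 + 2 * c * (a \<bullet> b) + c\<^sup>2 * (norm b)\<^sup>2" for a b :: 'a and c
    by (simp only: power2_norm_eq_inner) (simp add: inner_add_left inner_add_right inner_commute power2_eq_square)
  ultimately have "(norm ((1 / m) *\<^sub>R (\<Sum>i\<in>I. w (\<omega> i))))\<^sup>2 = (norm g)\<^sup>2 + 2 / m * (g \<bullet> ?S \<omega>) + (1 / m)\<^sup>2 * (norm (?S \<omega>))\<^sup>2" for \<omega>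
    by simp
  then have "(\<integral>\<omega>. (norm ((1 / m) *\<^sub>R (\<Sum>i\<in>I. w (\<omega> i))))\<^sup>2 \<partial>PiM I (\<lambda>_. P))
    = (\<integral>\<omega>. (norm g)\<^sup>2 + 2 / m * (g \<bullet> ?S \<omega>) + (1 / m)\<^sup>2 * (norm (?S \<omega>))\<^sup>2 \<partial>PiM I (\<lambda>_. P))" by simp
  also have "\<dots> = (norm g)\<^sup>2 + 2 / m * (g \<bullet> (\<integral>\<omega>. ?S \<omega> \<partial>PiM I (\<lambda>_. P))) + (1 / m)\<^sup>2 * (\<integral>\<omega>. (norm (?S \<omega>))\<^sup>2 \<partial>PiM I (\<lambda>_. P))"
    using intS intS2 by (simp add: PI.prob_space del: inner_sum_left inner_sum_right)
  also have "\<dots> = (norm g)\<^sup>2 + (1 / m)\<^sup>2 * (m * (\<integral>s. (norm (u s))\<^sup>2 \<partial>P))"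
    unfolding eS second_moment_sum[OF P u bdu mu I(1)] m_def by simp
  also have "\<dots> = (norm g)\<^sup>2 + (\<integral>s. (norm (w s - g))\<^sup>2 \<partial>P) / m"
    using m by (simp add: u_def power2_eq_square)
  finally show "(\<integral>\<omega>. (norm ((1 / m) *\<^sub>R (\<Sum>i\<in>I. w (\<omega> i))))\<^sup>2 \<partial>PiM I (\<lambda>_. P))
       = (norm g)\<^sup>2 + (\<integral>s. (norm (w s - g))\<^sup>2 \<partial>P) / m" .
qed

text \<open>With step size at most \<open>1 / L\<close> the term \<open>- \<eta> / 2
  \<parallel>g\<parallel>\<^sup>2\<close> from the polarization of \<open>d \<bullet> g\<close>, where
  \<open>g\<close> is the mean of the estimator, absorbs the mean part of the quadratic error. The
  remaining errors are the squared bias and the variance divided by the batch size. Samples are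
  indexed by an arbitrary finite set, so that the batches of different rounds can use disjoint index
  sets of one product space.\<close>

lemma expected_descent:
  fixes w :: "'b \<Rightarrow> 'a::euclidean_space" and f :: "'a \<Rightarrow> real"
  assumes P: "prob_space P" and w [measurable]: "w \<in> borel_measurable P"
    and bd: "AE s in P. norm (w s) \<le> B" and I: "finite I" "I \<noteq> {}"
    and f [measurable]: "f \<in> borel_measurable borel"
    and descent: "\<And>K'. norm (K' - K) \<le> \<rho> \<Longrightarrow> 0 \<le> f K' \<and> f K' \<le> f K + d \<bullet> (K' - K) + L / 2 * (norm (K' - K))\<^sup>2"
    and \<eta>: "0 < \<eta>" "\<eta> * B \<le> \<rho>" "\<eta> * L \<le> 1"
    and bias: "norm ((\<integral>s. w s \<partial>P) - d) \<le> \<beta>"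
  defines "x \<equiv> \<lambda>\<omega>. K - \<eta> *\<^sub>R ((1 / real (card I)) *\<^sub>R (\<Sum>i\<in>I. w (\<omega> i)))"
  shows "AE \<omega> in PiM I (\<lambda>_. P). norm (x \<omega> - K) \<le> \<rho>"
    and "integrable (PiM I (\<lambda>_. P)) (\<lambda>\<omega>. f (x \<omega>))"
    and "(\<integral>\<omega>. f (x \<omega>) \<partial>PiM I (\<lambda>_. P)) \<le> f K - \<eta> / 2 * (norm d)\<^sup>2 + \<eta> / 2 * \<beta>\<^sup>2
       + L * \<eta>\<^sup>2 / (2 * real (card I)) * (\<integral>s. (norm (w s - (\<integral>s. w s \<partial>P)))\<^sup>2 \<partial>P)"
proof -
  interpret P: prob_space P by (rule P)
  interpret PI: prob_space "PiM I (\<lambda>_. P)" by (intro prob_space_PiM P)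
  define m where "m = real (card I)"
  define g where "g = (\<integral>s. w s \<partial>P)"
  define V where "V = (\<integral>s. (norm (w s - g))\<^sup>2 \<partial>P)"
  have m: "0 < m" using I by (simp add: m_def card_gt_0_iff)
  define v where "v \<omega> = (1 / m) *\<^sub>R (\<Sum>i\<in>I. w (\<omega> i))" for \<omega>
  have v [measurable]: "v \<in> borel_measurable (PiM I (\<lambda>_. P))" unfolding v_def by measurable
  have x: "x \<omega> - K = - (\<eta> *\<^sub>R v \<omega>)" for \<omega> by (simp add: x_def v_def m_def)
  have [measurable]: "x \<in> borel_measurable (PiM I (\<lambda>_. P))" unfolding x_def by measurable
  have vB: "AE \<omega> in PiM I (\<lambda>_. P). norm (v \<omega>) \<le> B"
    using AE_PiM_all[OF P I(1) bd]
  proof eventually_elim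
    case (elim \<omega>)
    have "norm (\<Sum>i\<in>I. w (\<omega> i)) \<le> (\<Sum>i\<in>I. B)" using elim by (intro sum_norm_le) auto
    then show ?case using m by (simp add: v_def m_def field_simps)
  qed
  then show xK: "AE \<omega> in PiM I (\<lambda>_. P). norm (x \<omega> - K) \<le> \<rho>"
  proof eventually_elim
    case (elim \<omega>)
    have "norm (x \<omega> - K) = \<eta> * norm (v \<omega>)" unfolding x using \<eta> by simp
    also have "\<dots> \<le> \<eta> * B" using elim \<eta> by simp
    finally show ?case using \<eta> by simp
  qed
  have bound: "AE \<omega> in PiM I (\<lambda>_. P). f (x \<omega>) \<le> f K - \<eta> * (d \<bullet> v \<omega>) + L * \<eta>\<^sup>2 / 2 * (norm (v \<omega>))\<^sup>2"
    using xK
  proof eventually_elim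
    case (elim \<omega>)
    then have "f (x \<omega>) \<le> f K + d \<bullet> (x \<omega> - K) + L / 2 * (norm (x \<omega> - K))\<^sup>2" using descent by blast
    then show ?case using \<eta> unfolding x by (simp add: power_mult_distrib)
  qed
  have intv: "integrable (PiM I (\<lambda>_. P)) v" by (rule integrable_PiM_bounded[OF P v vB])
  have intv2: "integrable (PiM I (\<lambda>_. P)) (\<lambda>\<omega>. (norm (v \<omega>))\<^sup>2)"
  proof (rule integrable_PiM_bounded[OF P])
    show "AE \<omega> in PiM I (\<lambda>_. P). norm ((norm (v \<omega>))\<^sup>2) \<le> B\<^sup>2"
      using vB by eventually_elim (auto intro: power_mono)
  qed measurable
  have intr: "integrable (PiM I (\<lambda>_. P)) (\<lambda>\<omega>. f K - \<eta> * (d \<bullet> v \<omega>) + L * \<eta>\<^sup>2 / 2 * (norm (v \<omega>))\<^sup>2)"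
    using intv intv2 by simp
  show intf: "integrable (PiM I (\<lambda>_. P)) (\<lambda>\<omega>. f (x \<omega>))"
  proof (rule Bochner_Integration.integrable_bound[OF intr])
    show "AE \<omega> in PiM I (\<lambda>_. P). norm (f (x \<omega>)) \<le> norm (f K - \<eta> * (d \<bullet> v \<omega>) + L * \<eta>\<^sup>2 / 2 * (norm (v \<omega>))\<^sup>2)"
      using bound xK
    proof eventually_elim
      case (elim \<omega>)
      then have "0 \<le> f (x \<omega>)" using descent by blast
      with elim show ?case by simp
    qed
  qed measurable
  have e1: "(\<integral>\<omega>. v \<omega> \<partial>PiM I (\<lambda>_. P)) = g" and e2: "(\<integral>\<omega>. (norm (v \<omega>))\<^sup>2 \<partial>PiM I (\<lambda>_. P)) = (norm g)\<^sup>2 + V / m"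
    using minibatch_moments[OF P w bd I] by (simp_all only: v_def g_def V_def m_def)
  have "(\<integral>\<omega>. f (x \<omega>) \<partial>PiM I (\<lambda>_. P)) \<le> (\<integral>\<omega>. f K - \<eta> * (d \<bullet> v \<omega>) + L * \<eta>\<^sup>2 / 2 * (norm (v \<omega>))\<^sup>2 \<partial>PiM I (\<lambda>_. P))"
    by (rule integral_mono_AE[OF intf intr bound])
  also have "\<dots> = f K - \<eta> * (d \<bullet> g) + L * \<eta>\<^sup>2 / 2 * ((norm g)\<^sup>2 + V / m)"
    using intv intv2 by (simp add: PI.prob_space e1 e2)
  also have "d \<bullet> g = ((norm d)\<^sup>2 + (norm g)\<^sup>2 - (norm (g - d))\<^sup>2) / 2"
    by (simp add: power2_norm_eq_inner inner_diff_left inner_diff_right inner_commute)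
  also have "f K - \<eta> * (((norm d)\<^sup>2 + (norm g)\<^sup>2 - (norm (g - d))\<^sup>2) / 2) + L * \<eta>\<^sup>2 / 2 * ((norm g)\<^sup>2 + V / m)
     = f K - \<eta> / 2 * (norm d)\<^sup>2 + \<eta> / 2 * (norm (g - d))\<^sup>2 + L * \<eta>\<^sup>2 / (2 * m) * V - \<eta> / 2 * ((1 - \<eta> * L) * (norm g)\<^sup>2)"
    by (simp add: field_simps power2_eq_square)
  also have "\<dots> \<le> f K - \<eta> / 2 * (norm d)\<^sup>2 + \<eta> / 2 * \<beta>\<^sup>2 + L * \<eta>\<^sup>2 / (2 * m) * V - 0"
    using \<eta> bias by (intro add_mono diff_mono mult_left_mono mult_nonneg_nonneg order_refl power_mono) (auto simp: g_def)
  finally show "(\<integral>\<omega>. f (x \<omega>) \<partial>PiM I (\<lambda>_. P)) \<le> f K - \<eta> / 2 * (norm d)\<^sup>2 + \<eta> / 2 * \<beta>\<^sup>2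
       + L * \<eta>\<^sup>2 / (2 * real (card I)) * (\<integral>s. (norm (w s - (\<integral>s. w s \<partial>P)))\<^sup>2 \<partial>P)"
    by (simp add: V_def g_def m_def)
qed

section \<open>Descent stopped at the exit from a sublevel set\<close>

text \<open>Descent on a set \<open>G\<close>, with the samples of all rounds as coordinates \<open>(t,
  i)\<close> of one product space. The expectation at time \<open>t\<close> is taken in the product
  over the rounds before \<open>t\<close>, so that the independence of a batch from the past becomes
  Fubini's theorem for the step from \<open>t\<close> to \<open>t + 1\<close>.\<close>

locale stopped_descent =
  fixes P :: "'b measure" and z :: "'a::euclidean_space \<Rightarrow> 'b \<Rightarrow> 'a" and G :: "'a set" and \<Delta> :: "'a \<Rightarrow> real"
    and K0 :: 'a and \<eta> c \<epsilon> Bd :: real and m :: nat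
  assumes P: "prob_space P"
    and z [measurable]: "(\<lambda>(K, s). z K s) \<in> borel \<Otimes>\<^sub>M P \<rightarrow>\<^sub>M borel"
    and G [measurable]: "G \<in> sets borel" and \<Delta> [measurable]: "\<Delta> \<in> borel_measurable borel"
    and K0: "K0 \<in> G" "0 < \<Delta> K0"
    and \<Delta>_bounds: "\<And>K. K \<in> G \<Longrightarrow> 0 \<le> \<Delta> K \<and> \<Delta> K \<le> Bd"
    and c: "0 < c" "c \<le> 1" and \<epsilon>: "0 < \<epsilon>"
begin

definition step :: "nat \<Rightarrow> 'a \<Rightarrow> (nat \<times> nat \<Rightarrow> 'b) \<Rightarrow> 'a" where
  "step t K y = K - \<eta> *\<^sub>R ((1 / real m) *\<^sub>R (\<Sum>i=1..m. z K (y (t, i))))"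

primrec path :: "nat \<Rightarrow> (nat \<times> nat \<Rightarrow> 'b) \<Rightarrow> 'a" where
  "path 0 y = K0"
| "path (Suc t) y = step t (path t y) y"

primrec stopped :: "nat \<Rightarrow> (nat \<times> nat \<Rightarrow> 'b) \<Rightarrow> 'a" where
  "stopped 0 y = K0"
| "stopped (Suc t) y = (if stopped t y \<in> G then step t (stopped t y) y else stopped t y)"

definition past :: "nat \<Rightarrow> (nat \<times> nat \<Rightarrow> 'b) measure" where
  "past t = PiM ({..<t} \<times> {1..m}) (\<lambda>_. P)"

definition batch :: "nat \<Rightarrow> (nat \<times> nat \<Rightarrow> 'b) measure" where
  "batch t = PiM ({t} \<times> {1..m}) (\<lambda>_. P)"

sublocale batch: prob_space "batch t" for t
  unfolding batch_def by (intro prob_space_PiM P)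

sublocale past: prob_space "past t" for t
  unfolding past_def by (intro prob_space_PiM P)

lemma stopped_in_imp_path: "stopped t y \<in> G \<Longrightarrow> path t y = stopped t y"
  by (induction t) (auto split: if_splits)

lemma stopped_cong: "(\<And>s i. s < t \<Longrightarrow> i \<in> {1..m} \<Longrightarrow> y (s, i) = y' (s, i)) \<Longrightarrow> stopped t y = stopped t y'"
proof (induction t)
  case (Suc t)
  then have "stopped t y = stopped t y'" by simp
  moreover have "step t K y = step t K y'" for K
    unfolding step_def using Suc.prems by (intro arg_cong2[where f="(-)"] arg_cong[where f="scaleR _"] sum.cong refl) auto
  ultimately show ?case by simp
qed simp

lemma measurable_z: "f \<in> borel_measurable N \<Longrightarrow> g \<in> N \<rightarrow>\<^sub>M P \<Longrightarrow> (\<lambda>x. z (f x) (g x)) \<in> borel_measurable N"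
  using measurable_compose[OF measurable_Pair z, of f N g] by simp

lemma measurable_step:
  assumes "f \<in> borel_measurable N" and "\<And>i. i \<in> {1..m} \<Longrightarrow> (\<lambda>x. g x (t, i)) \<in> N \<rightarrow>\<^sub>M P"
  shows "(\<lambda>x. step t (f x) (g x)) \<in> borel_measurable N"
  unfolding step_def
  by (intro borel_measurable_diff borel_measurable_scaleR borel_measurable_sum measurable_z assms borel_measurable_const) 

lemma measurable_path_PiM:
  "{..<t} \<times> {1..m} \<subseteq> I \<Longrightarrow> path t \<in> borel_measurable (PiM I (\<lambda>_. P))"
proof (induction t)
  case 0
  then show ?case by (simp cong: measurable_cong)
next
  case (Suc t)
  then have "path t \<in> borel_measurable (PiM I (\<lambda>_. P))" by (auto simp: subset_iff)
  then have "(\<lambda>y. step t (path t y) y) \<in> borel_measurable (PiM I (\<lambda>_. P))"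
    by (intro measurable_step measurable_component_singleton) (use Suc.prems in auto)
  then show ?case by (simp cong: measurable_cong)
qed

lemma measurable_path: "path t \<in> borel_measurable (past t)"
  unfolding past_def by (rule measurable_path_PiM) simp

lemma measurable_stopped:
  "{..<t} \<times> {1..m} \<subseteq> I \<Longrightarrow> stopped t \<in> borel_measurable (PiM I (\<lambda>_. P))"
proof (induction t)
  case 0
  then show ?case by (simp add: fun_eq_iff[symmetric] cong: measurable_cong)
next
  case (Suc t)
  then have st: "stopped t \<in> borel_measurable (PiM I (\<lambda>_. P))" by (auto simp: subset_iff)
  have "(\<lambda>y. step t (stopped t y) y) \<in> borel_measurable (PiM I (\<lambda>_. P))"
    by (intro measurable_step st measurable_component_singleton) (use Suc.prems in auto)
  then have "(\<lambda>y. if stopped t y \<in> G then step t (stopped t y) y else stopped t y) \<in> borel_measurable (PiM I (\<lambda>_. P))"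
    using st by measurable
  then show ?case by (simp cong: measurable_cong)
qed

lemma measurable_stopped_past [measurable]: "stopped t \<in> borel_measurable (past t)"
  unfolding past_def by (rule measurable_stopped) simp

lemma measurable_step_batch: "(\<lambda>(K, y). step t K y) \<in> borel_measurable (borel \<Otimes>\<^sub>M batch t)"
  unfolding case_prod_beta batch_def
  by (intro measurable_step measurable_fst measurable_compose[OF measurable_snd measurable_component_singleton]) auto

text \<open>The conditional expectation of \<open>\<phi>\<close> after one round of the stopped process.\<close>

definition transition :: "nat \<Rightarrow> ('a \<Rightarrow> real) \<Rightarrow> 'a \<Rightarrow> real" where
  "transition t \<phi> K = (if K \<in> G then \<integral>y. \<phi> (step t K y) \<partial>batch t else \<phi> K)"

lemma integrable_step:
  fixes \<phi> :: "'a \<Rightarrow> real"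
  assumes [measurable]: "\<phi> \<in> borel_measurable borel" and b: "\<And>K. \<bar>\<phi> K\<bar> \<le> b"
  shows "integrable (batch t) (\<lambda>y. \<phi> (step t K y))"
proof (rule batch.integrable_const_bound[where B=b])
  have "(\<lambda>y. step t K y) \<in> borel_measurable (batch t)"
    using measurable_compose[OF measurable_Pair1' measurable_step_batch, of K] by simp
  from measurable_compose[OF this assms(1)] show "(\<lambda>y. \<phi> (step t K y)) \<in> borel_measurable (batch t)" .
qed (use b in auto)

lemma transition_measurable:
  assumes \<phi> [measurable]: "\<phi> \<in> borel_measurable borel"
  shows "transition t \<phi> \<in> borel_measurable borel"
proof -
  have "(\<lambda>(K, y). \<phi> (step t K y)) \<in> borel_measurable (borel \<Otimes>\<^sub>M batch t)"
    using measurable_compose[OF measurable_step_batch \<phi>] by (simp add: case_prod_beta')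
  then have [measurable]: "(\<lambda>K. \<integral>y. \<phi> (step t K y) \<partial>batch t) \<in> borel_measurable borel"
    by (rule batch.borel_measurable_lebesgue_integral)
  show ?thesis unfolding transition_def[abs_def] by measurable
qed

lemma transition_bound:
  assumes \<phi>: "\<phi> \<in> borel_measurable borel" and b: "\<And>K. \<bar>\<phi> K\<bar> \<le> b"
  shows "\<bar>transition t \<phi> K\<bar> \<le> b"
proof (cases "K \<in> G")
  case True
  have "\<bar>\<integral>y. \<phi> (step t K y) \<partial>batch t\<bar> \<le> (\<integral>y. b \<partial>batch t)"
    by (rule integral_abs_bound[THEN order_trans], intro integral_mono) 
      (use integrable_step[OF \<phi> b] b in auto)
  then show ?thesis using True by (simp add: transition_def batch.prob_space)
qed (use b in \<open>simp add: transition_def\<close>)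

lemma integrable_stopped:
  fixes \<phi> :: "'a \<Rightarrow> real"
  assumes \<phi> [measurable]: "\<phi> \<in> borel_measurable borel" and b: "\<And>K. \<bar>\<phi> K\<bar> \<le> b"
  shows "integrable (past t) (\<lambda>y. \<phi> (stopped t y))"
  by (rule past.integrable_const_bound[where B=b]) (use b in auto)

lemma expectation_stopped_Suc:
  assumes \<phi> [measurable]: "\<phi> \<in> borel_measurable borel" and b: "\<And>K. \<bar>\<phi> K\<bar> \<le> b"
  shows "(\<integral>y. \<phi> (stopped (Suc t) y) \<partial>past (Suc t)) = (\<integral>y. transition t \<phi> (stopped t y) \<partial>past t)"
proof -
  interpret P: prob_space P by (rule P)
  interpret Q: product_prob_space "\<lambda>_. P" by unfold_locales
  let ?I = "{..<t} \<times> {1..m}" and ?J = "{t} \<times> {1..m}"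
  have IJ: "{..<Suc t} \<times> {1..m} = ?I \<union> ?J" by auto
  have stop: "stopped (Suc t) (merge ?I ?J (x, y)) = (if stopped t x \<in> G then step t (stopped t x) y else stopped t x)" for x y
  proof -
    have "stopped t (merge ?I ?J (x, y)) = stopped t x"
      by (rule stopped_cong) (auto simp: merge_def)
    moreover have "step t K (merge ?I ?J (x, y)) = step t K y" for K
      unfolding step_def by (intro arg_cong2[where f="(-)"] arg_cong[where f="scaleR _"] sum.cong refl) (auto simp: merge_def)
    ultimately show ?thesis by simp
  qed
  have "integrable (PiM (?I \<union> ?J) (\<lambda>_. P)) (\<lambda>y. \<phi> (stopped (Suc t) y))"
    using integrable_stopped[OF \<phi> b, of "Suc t"] unfolding past_def IJ .
  then have "(\<integral>y. \<phi> (stopped (Suc t) y) \<partial>past (Suc t))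
    = (\<integral>x. \<integral>y. \<phi> (stopped (Suc t) (merge ?I ?J (x, y))) \<partial>batch t \<partial>past t)"
    unfolding past_def batch_def IJ by (intro Q.product_integral_fold) auto
  also have "\<dots> = (\<integral>x. transition t \<phi> (stopped t x) \<partial>past t)"
    by (intro Bochner_Integration.integral_cong refl) (simp only: stop, simp add: transition_def batch.prob_space)
  finally show ?thesis .
qed

lemma expectation_stopped_Suc_le:
  assumes \<phi>: "\<phi> \<in> borel_measurable borel" and b: "\<And>K. \<bar>\<phi> K\<bar> \<le> b" and le: "\<And>K. transition t \<phi> K \<le> a * \<phi> K + d"
  shows "(\<integral>y. \<phi> (stopped (Suc t) y) \<partial>past (Suc t)) \<le> a * (\<integral>y. \<phi> (stopped t y) \<partial>past t) + d"
proof -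
  have "(\<integral>y. transition t \<phi> (stopped t y) \<partial>past t) \<le> (\<integral>y. a * \<phi> (stopped t y) + d \<partial>past t)"
    by (intro integral_mono le integrable_stopped[OF transition_measurable[OF \<phi>] transition_bound[OF \<phi> b]]
        Bochner_Integration.integrable_add integrable_mult_right integrable_stopped[OF \<phi> b] past.integrable_const)
  also have "\<dots> = a * (\<integral>y. \<phi> (stopped t y) \<partial>past t) + d"
    using integrable_stopped[OF \<phi> b, of t] by (simp add: past.prob_space)
  finally show ?thesis unfolding expectation_stopped_Suc[OF \<phi> b] .
qed

text \<open>After an exit from \<open>G\<close> the gap is at least \<open>10 \<Delta>\<^sub>0\<close>.
  Recording only this bound keeps the potential bounded, hence integrable.\<close>

definition exit_potential :: "'a \<Rightarrow> real" where
  "exit_potential K = (if K \<in> G then \<Delta> K else 10 * \<Delta> K0)"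

definition stopped_gap :: "'a \<Rightarrow> real" where
  "stopped_gap K = (if K \<in> G then \<Delta> K else 0)"

lemma potentials_measurable [measurable]:
  "exit_potential \<in> borel_measurable borel" "stopped_gap \<in> borel_measurable borel"
  unfolding exit_potential_def[abs_def] stopped_gap_def[abs_def] by measurable

lemma potentials_bounded: "\<bar>exit_potential K\<bar> \<le> max Bd (10 * \<Delta> K0)" "\<bar>stopped_gap K\<bar> \<le> max Bd (10 * \<Delta> K0)"
  using \<Delta>_bounds[of K] K0 by (auto simp: exit_potential_def stopped_gap_def)

lemma potentials_nonneg: "0 \<le> exit_potential K" "0 \<le> stopped_gap K"
  using \<Delta>_bounds[of K] K0 by (auto simp: exit_potential_def stopped_gap_def)

text \<open>The expected exit potential and the expected gap of the surviving iterates combine without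
  conditioning: at every outcome, the indicator of success plus \<open>exit_potential / (10
  \<Delta>\<^sub>0)\<close> plus \<open>stopped_gap / \<epsilon>\<close> is at least \<open>1\<close>.\<close>

theorem descent_success_probability:
  assumes one_step: "\<And>t K. K \<in> G \<Longrightarrow> AE y in batch t. 0 \<le> \<Delta> (step t K y) \<and> (step t K y \<notin> G \<longrightarrow> 10 * \<Delta> K0 \<le> \<Delta> (step t K y))"
    "\<And>t K. K \<in> G \<Longrightarrow> integrable (batch t) (\<lambda>y. \<Delta> (step t K y))"
    "\<And>t K. K \<in> G \<Longrightarrow> (\<integral>y. \<Delta> (step t K y) \<partial>batch t) \<le> (1 - c) * \<Delta> K + c * \<epsilon> / 120"
    and large: "\<epsilon> \<le> 120 * \<Delta> K0" and tol: "\<epsilon> * ln (120 * \<Delta> K0 / \<epsilon>) \<le> 5 * \<Delta> K0"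
  defines "T \<equiv> nat \<lceil>2 / c * ln (120 * \<Delta> K0 / \<epsilon>)\<rceil>"
  shows "3 / 4 \<le> measure (past T) {y \<in> space (past T). stopped T y \<in> G \<and> \<Delta> (stopped T y) \<le> \<epsilon>}"
proof -
  define D0 e q b where "D0 = \<Delta> K0" and "e = c * \<epsilon> / 120" and "q = 120 * D0 / \<epsilon>" and "b = max Bd (10 * \<Delta> K0)"
  define EU where "EU t = (\<integral>y. exit_potential (stopped t y) \<partial>past t)" for t
  define EW where "EW t = (\<integral>y. stopped_gap (stopped t y) \<partial>past t)" for t
  have D0: "0 < D0" using K0 by (simp add: D0_def)
  have e: "0 < e" "e \<le> c * D0" using c \<epsilon> large by (auto simp: e_def D0_def)
  have q: "1 \<le> q" using \<epsilon> large by (simp add: q_def D0_def)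
  have trans_in: "transition t \<phi> K \<le> (1 - c) * \<Delta> K + e"
    if "K \<in> G" "\<phi> \<in> borel_measurable borel" "\<And>K. \<bar>\<phi> K\<bar> \<le> b"
      "\<And>K'. 0 \<le> \<Delta> K' \<Longrightarrow> K' \<notin> G \<longrightarrow> 10 * \<Delta> K0 \<le> \<Delta> K' \<Longrightarrow> \<phi> K' \<le> \<Delta> K'" for t \<phi> K
  proof -
    have "(\<integral>y. \<phi> (step t K y) \<partial>batch t) \<le> (\<integral>y. \<Delta> (step t K y) \<partial>batch t)"
      by (rule integral_mono_AE[OF integrable_step[OF that(2,3)] one_step(2)[OF that(1)]])
        (use one_step(1)[OF that(1), of t] in \<open>eventually_elim, use that(4) in blast\<close>)
    then show ?thesis using one_step(3)[OF that(1), of t] that(1) by (simp add: transition_def e_def)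
  qed
  note bnd = potentials_bounded[folded b_def]
  have U_step: "transition t exit_potential K \<le> (1 - c) * \<Delta> K + e" if "K \<in> G" for t K
    by (rule trans_in[OF that potentials_measurable(1) bnd(1)]) (auto simp: exit_potential_def)
  have W_step: "transition t stopped_gap K \<le> (1 - c) * \<Delta> K + e" if "K \<in> G" for t K
    by (rule trans_in[OF that potentials_measurable(2) bnd(2)]) (auto simp: stopped_gap_def)
  have U_trans: "transition t exit_potential K \<le> 1 * exit_potential K + e" for t K
  proof (cases "K \<in> G")
    case True
    have "0 \<le> c * \<Delta> K" using c \<Delta>_bounds[OF True] by simp
    with U_step[OF True, of t] True show ?thesis by (simp add: exit_potential_def algebra_simps)
  qed (use e in \<open>simp add: transition_def\<close>)
  have W_trans: "transition t stopped_gap K \<le> (1 - c) * stopped_gap K + e" for t K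
    using W_step[of K t] e by (cases "K \<in> G") (auto simp: stopped_gap_def transition_def)
  \<comment> \<open>The first step does not increase the potential, as \<open>e \<le> c D0\<close>. This saves one increment and makes up for rounding \<open>T\<close> upwards.\<close>
  have EU_1: "EU (Suc 0) \<le> D0"
  proof -
    have "EU (Suc 0) = transition 0 exit_potential K0"
      unfolding EU_def expectation_stopped_Suc[OF potentials_measurable(1) bnd(1)] by (simp add: past.prob_space)
    also have "\<dots> \<le> D0" using U_step[OF K0(1), of 0] e by (simp add: D0_def algebra_simps)
    finally show ?thesis .
  qed
  have EU_Suc: "EU (Suc t) \<le> D0 + e * real t" for t
  proof (induction t)
    case (Suc t)
    have "EU (Suc (Suc t)) \<le> 1 * EU (Suc t) + e"
      unfolding EU_def by (rule expectation_stopped_Suc_le[OF potentials_measurable(1) bnd(1) U_trans])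
    with Suc show ?case by (simp add: algebra_simps)
  qed (use EU_1 in simp)
  have EW: "EW t \<le> (1 - c) ^ t * D0 + \<epsilon> / 120" for t
  proof (induction t)
    case 0
    then show ?case using \<epsilon> K0 by (simp add: EW_def stopped_gap_def D0_def past.prob_space)
  next
    case (Suc t)
    have "EW (Suc t) \<le> (1 - c) * EW t + e"
      unfolding EW_def by (rule expectation_stopped_Suc_le[OF potentials_measurable(2) bnd(2) W_trans])
    also have "\<dots> \<le> (1 - c) * ((1 - c) ^ t * D0 + \<epsilon> / 120) + e"
      using Suc c by (intro add_mono mult_left_mono) auto
    also have "\<dots> = (1 - c) ^ Suc t * D0 + \<epsilon> / 120" by (simp add: e_def field_simps)
    finally show ?case .
  qed
  have lnq: "0 \<le> ln q" using q by simp
  have T_ge: "2 / c * ln q \<le> real T"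
    unfolding T_def q_def[symmetric] D0_def[symmetric] by (rule real_nat_ceiling_ge)
  have EU_T: "EU T \<le> 13 / 12 * D0"
  proof (cases T)
    case 0
    then show ?thesis using K0 D0 by (simp add: EU_def exit_potential_def D0_def past.prob_space)
  next
    case (Suc t)
    have "real t < 2 / c * ln q"
      using Suc unfolding T_def q_def[symmetric] D0_def[symmetric] by linarith
    then have "e * real t \<le> e * (2 / c * ln q)" using e by (intro mult_left_mono) auto
    also have "\<dots> = \<epsilon> * ln q / 60" using c by (simp add: e_def)
    also have "\<dots> \<le> D0 / 12" using tol by (simp add: q_def D0_def)
    finally show ?thesis using EU_Suc[of t] Suc by simp
  qed
  have EW_T: "EW T \<le> \<epsilon> / 60"
  proof -
    have "(1 - c) ^ T \<le> exp (- c) ^ T"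
      using c exp_ge_add_one_self[of "- c"] by (intro power_mono) auto
    also have "\<dots> = exp (- (c * real T))" by (simp add: exp_of_nat_mult[symmetric] mult.commute)
    also have "\<dots> \<le> exp (- ln q)"
    proof -
      have "c * (2 / c * ln q) \<le> c * real T" using T_ge c by (intro mult_left_mono) auto
      then show ?thesis using c lnq by simp
    qed
    also have "\<dots> = 1 / q" using q by (simp add: exp_minus field_simps)
    finally have "(1 - c) ^ T * D0 \<le> 1 / q * D0" using D0 by (intro mult_right_mono) auto
    also have "\<dots> = \<epsilon> / 120" using D0 \<epsilon> by (simp add: q_def)
    finally show ?thesis using EW[of T] by simp
  qed
  let ?S = "{y \<in> space (past T). stopped T y \<in> G \<and> \<Delta> (stopped T y) \<le> \<epsilon>}"
  have S [measurable]: "?S \<in> sets (past T)" by measurable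
  have intU: "integrable (past T) (\<lambda>y. exit_potential (stopped T y))" and intW: "integrable (past T) (\<lambda>y. stopped_gap (stopped T y))"
    by (rule integrable_stopped[OF potentials_measurable(1) bnd(1)] integrable_stopped[OF potentials_measurable(2) bnd(2)])+
  have intS: "integrable (past T) (indicator ?S :: _ \<Rightarrow> real)"
    using S by (simp add: integrable_indicator_iff past.emeasure_finite less_top[symmetric])
  have "(1::real) = (\<integral>y. 1 \<partial>past T)" by (simp add: past.prob_space)
  also have "\<dots> \<le> (\<integral>y. indicator ?S y + exit_potential (stopped T y) / (10 * D0) + stopped_gap (stopped T y) / \<epsilon> \<partial>past T)"
  proof (rule integral_mono)
    fix y assume y: "y \<in> space (past T)"
    have "1 \<le> stopped_gap (stopped T y) / \<epsilon>" if "stopped T y \<in> G" "\<not> \<Delta> (stopped T y) \<le> \<epsilon>"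
      using that \<epsilon> by (simp add: stopped_gap_def)
    moreover have "1 \<le> exit_potential (stopped T y) / (10 * D0)" if "stopped T y \<notin> G"
      using that D0 by (simp add: exit_potential_def D0_def)
    moreover have "0 \<le> exit_potential (stopped T y) / (10 * D0)" "0 \<le> stopped_gap (stopped T y) / \<epsilon>"
      using potentials_nonneg D0 \<epsilon> by simp_all
    ultimately show "1 \<le> indicator ?S y + exit_potential (stopped T y) / (10 * D0) + stopped_gap (stopped T y) / \<epsilon>"
      using y by (cases "stopped T y \<in> G"; cases "\<Delta> (stopped T y) \<le> \<epsilon>") (simp_all add: indicator_def)
  qed (use intU intW intS in simp_all)
  also have "\<dots> = measure (past T) ?S + EU T / (10 * D0) + EW T / \<epsilon>"
    using intU intW intS S by (simp add: EU_def EW_def)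
  also have "\<dots> \<le> measure (past T) ?S + 13 / 120 + 1 / 60"
    using EU_T EW_T D0 \<epsilon> by (intro add_mono) (simp_all add: pos_divide_le_eq)
  finally show ?thesis by simp
qed

end

section \<open>Convergence of the zeroth-order method\<close>

text \<open>Division in \<open>[0,\<infinity>]\<close> makes \<open>a / \<infinity> = 0\<close>, so a positive
  lower bound on a quotient implies that the denominator is finite; and \<open>a / 0 =
  \<infinity>\<close> for \<open>a > 0\<close>, so a vanishing denominator imposes nothing.\<close>

lemma le_ennreal_divideD:
  assumes "0 < \<eta>" "0 \<le> a" "ennreal \<eta> \<le> ennreal a / X"
  shows "X < \<top>" and "\<eta> * enn2real X \<le> a"
proof -
  show fin: "X < \<top>"
  proof (rule ccontr)
    assume "\<not> X < \<top>"
    then have "X = \<top>" by (simp add: less_top[symmetric])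
    then show False using assms(1,3) by simp
  qed
  show "\<eta> * enn2real X \<le> a"
  proof (cases "enn2real X = 0")
    case False
    define x where "x = enn2real X"
    have x: "0 < x" "X = ennreal x" using False fin by (auto simp: x_def less_le)
    have "ennreal \<eta> \<le> ennreal (a / x)" using assms x by (simp add: divide_ennreal)
    then have "\<eta> \<le> a / x" using assms x by (simp add: ennreal_le_iff)
    then show ?thesis using x(1) by (simp add: x_def[symmetric] field_simps)
  qed (use assms in simp)
qed

theorem theorem1:
  fixes A :: "real^'n^'n" and B :: "real^'k^'n"
    and Q \<Sigma> :: "real^'n^'n" and R :: "real^'k^'k"
    and \<gamma> C \<mu> \<rho> lam L \<epsilon> \<eta> r \<Delta>0 :: real and xs :: "real^'n"
    and D :: "(real^'n) measure"
    and Jx :: "('n, 'k) policy \<Rightarrow> real^'n \<Rightarrow> ennreal"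
    and J :: "('n, 'k) policy \<Rightarrow> ennreal" and Jopt :: ennreal
    and K0 :: "('n, 'k) policy" and G :: "('n, 'k) policy set"
    and z :: "('n, 'k) policy \<Rightarrow> real^'n \<Rightarrow> ('n, 'k) policy \<Rightarrow> ('n, 'k) policy"
    and m T :: nat
    and M :: "'w measure"
    and X :: "nat \<Rightarrow> nat \<Rightarrow> 'w \<Rightarrow> real^'n" and \<delta> :: "nat \<Rightarrow> nat \<Rightarrow> 'w \<Rightarrow> ('n, 'k) policy"
  assumes "controllable A B" and "pos_def Q" and "pos_def R" and "pos_def \<Sigma>"
    and "0 < \<gamma>" and "\<gamma> < 1"
    and "prob_space D" and "sets D = sets borel"
    and "(\<integral>x. x \<partial>D) = 0"
    and "(\<integral>x. (\<chi> i j. x $ i * x $ j) \<partial>D) = \<Sigma>"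
    and "0 < C" and "\<forall>x\<in>msupport D. norm x \<le> C"
    and Jx_def: "Jx = cost_from A B Q R \<gamma> xs"
    and J_def: "J = cost A B Q R \<gamma> xs D"
    and Jopt_def: "Jopt = (INF K. J K)"
    and "sqrt \<gamma> * spectral_radius (A + B ** fst K0) < 1"
    and "0 < \<mu>"
    and PL: "\<forall>K. sqrt \<gamma> * spectral_radius (A + B ** fst K) < 1 \<longrightarrow>
      enn2real (J K) - enn2real Jopt \<le> 1 / \<mu> * (norm (grad (\<lambda>K. enn2real (J K)) K))\<^sup>2"
    and G_def: "G = {K. J K \<le> 10 * J K0}"
    and "0 < \<rho>" and "0 < lam" and "0 < L"
    and Lip_J: "\<forall>K\<in>G. \<forall>K'. norm (K' - K) \<le> \<rho> \<longrightarrow>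
      edist (J K') (J K) \<le> ereal (lam * norm (K' - K))"
    and Lip_Jx: "\<forall>K\<in>G. \<forall>K'. norm (K' - K) \<le> \<rho> \<longrightarrow>
      (\<forall>x0\<in>msupport D. edist (Jx K' x0) (Jx K x0) \<le> ereal (lam * norm (K' - K)))"
    and Lip_grad: "\<forall>K\<in>G. \<forall>K'. norm (K' - K) \<le> \<rho> \<longrightarrow>
      norm (grad (\<lambda>K. enn2real (J K)) K' - grad (\<lambda>K. enn2real (J K)) K) \<le> L * norm (K' - K)"
    and z_def: "z = two_point Jx r"
    and "1 \<le> m" and "0 < \<epsilon>" and "0 < \<eta>" and "0 < r"
    and "ennreal \<eta> \<le> min (ennreal (real m * \<epsilon> * \<mu>) / (ennreal (240 * L) * estimator_variance G D z))
      (min (ennreal (1 / (4 * L))) (ennreal \<rho> / estimator_bound G D z))"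
    and "r \<le> min (sqrt (\<epsilon> * \<mu> / (240 * L\<^sup>2))) \<rho>"
    and \<Delta>0_def: "\<Delta>0 = enn2real (J K0) - enn2real Jopt"
    and "\<epsilon> * ln (120 * \<Delta>0 / \<epsilon>) \<le> 5 * \<Delta>0"
    and T_def: "T = nat \<lceil>4 / (\<mu> * \<eta>) * ln (120 * \<Delta>0 / \<epsilon>)\<rceil>"
    and "prob_space M"
    and indep: "prob_space.indep_vars M (\<lambda>_. D \<Otimes>\<^sub>M unif_sphere)
      (\<lambda>(t, i) \<omega>. (X t i \<omega>, \<delta> t i \<omega>)) ({..<T} \<times> {1..m})"
    and law: "\<forall>t<T. \<forall>i\<in>{1..m}.
      distr M (D \<Otimes>\<^sub>M unif_sphere) (\<lambda>\<omega>. (X t i \<omega>, \<delta> t i \<omega>)) = D \<Otimes>\<^sub>M unif_sphere"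
  shows "3 / 4 \<le> measure M {\<omega> \<in> space M.
      J (iterate z \<eta> m K0 (\<lambda>t i. X t i \<omega>) (\<lambda>t i. \<delta> t i \<omega>) T) - Jopt \<le> ennreal \<epsilon>}"
proof -
  define P where "P = D \<Otimes>\<^sub>M (unif_sphere :: ('n, 'k) policy measure)"
  define w where "w K s = z K (fst s) (snd s)" for K s
  define f where "f K = enn2real (J K)" for K
  define opt where "opt = enn2real Jopt"
  define \<Delta> where "\<Delta> K = f K - opt" for K
  define d where "d K = grad f K" for K
  note Q = \<open>pos_def Q\<close> and R = \<open>pos_def R\<close> and \<gamma> = \<open>0 < \<gamma>\<close> \<open>\<gamma> < 1\<close>
  note D = \<open>prob_space D\<close> \<open>sets D = sets borel\<close>
  note \<mu> = \<open>0 < \<mu>\<close> and \<rho> = \<open>0 < \<rho>\<close> and L = \<open>0 < L\<close> and m = \<open>1 \<le> m\<close>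
    and \<epsilon> = \<open>0 < \<epsilon>\<close> and \<eta> = \<open>0 < \<eta>\<close> and r = \<open>0 < r\<close>
  note eta_le = assms(31) and r_le = assms(32) and tol = assms(34)
  interpret initial_law D \<Sigma>
    by (rule initial_law.intro[OF assms(7) assms(8) assms(9) assms(10) assms(4)])
  interpret D: prob_space D by (rule D)
  interpret S: prob_space "unif_sphere :: ('n, 'k) policy measure" by (rule prob_space_unif_sphere)
  interpret DS: pair_prob_space D "unif_sphere :: ('n, 'k) policy measure" ..
  have P: "prob_space P" unfolding P_def by (rule DS.P.prob_space_axioms)
  interpret M: prob_space M by fact

  \<comment> \<open>If the initial cost were infinite, \<open>G\<close> would contain \<open>K0\<close>, against the Lipschitz bound at distance \<open>0\<close>.\<close>
  have J_K0: "J K0 < \<top>"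
  proof (rule ccontr)
    assume "\<not> J K0 < \<top>"
    then have top: "J K0 = \<top>" by (simp add: less_top[symmetric])
    then have "K0 \<in> G" by (simp add: G_def)
    then have "edist (J K0) (J K0) \<le> ereal (lam * norm (K0 - K0))"
      using \<rho> by (intro Lip_J[rule_format]) auto
    then show False using top by (simp add: edist_def)
  qed
  have K0: "K0 \<in> G"
  proof -
    have "1 * J K0 \<le> 10 * J K0" by (intro mult_right_mono) auto
    then show ?thesis by (simp add: G_def)
  qed
  have G_fin: "J K < \<top>" if "K \<in> G" for K
  proof -
    have "J K \<le> 10 * J K0" using that by (simp add: G_def)
    also have "\<dots> < \<top>" using J_K0 by (simp add: ennreal_mult_less_top)
    finally show ?thesis .
  qed
  have near_fin: "J K' < \<top>" if "K \<in> G" "norm (K' - K) \<le> \<rho>" for K K'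
  proof (rule ccontr)
    assume "\<not> J K' < \<top>"
    then have top: "J K' = \<top>" by (simp add: less_top[symmetric])
    have "edist (J K') (J K) \<le> ereal (lam * norm (K' - K))" by (rule Lip_J[rule_format, OF that])
    then show False using top G_fin[OF that(1)]
      by (cases "J K") (auto simp: edist_def)
  qed
  have Jopt_le: "Jopt \<le> J K" for K unfolding Jopt_def by (rule INF_lower) simp
  have Jopt_fin: "Jopt < \<top>" using Jopt_le[of K0] J_K0 by (rule le_less_trans)
  have J_eq: "J K = ennreal (f K)" if "J K < \<top>" for K using that by (simp add: f_def)
  have Jopt_eq: "Jopt = ennreal opt" using Jopt_fin by (simp add: opt_def)
  have f_nonneg: "0 \<le> f K" and opt_nonneg: "0 \<le> opt" for K by (simp_all add: f_def opt_def)
  have \<Delta>_nonneg: "0 \<le> \<Delta> K" if "J K < \<top>" for K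
    using Jopt_le[of K] that f_nonneg[of K] by (simp add: J_eq Jopt_eq \<Delta>_def ennreal_le_iff)
  have \<Delta>0: "\<Delta>0 = \<Delta> K0" by (simp add: \<Delta>0_def \<Delta>_def f_def opt_def)
  have G_iff: "K \<in> G \<longleftrightarrow> f K \<le> 10 * f K0" if "J K < \<top>" for K
  proof -
    have "10 * J K0 = ennreal (10 * f K0)" using f_nonneg by (simp add: J_eq[OF J_K0] ennreal_mult)
    then show ?thesis using f_nonneg by (simp add: G_def J_eq[OF that] ennreal_le_iff)
  qed

  have fin: "cost A B Q R \<gamma> xs D K' < \<top>" if "K \<in> G" "norm (K' - K) \<le> \<rho>" for K K'
    using near_fin[OF that] by (simp add: J_def)
  have f_alt: "f = (\<lambda>K. enn2real (cost A B Q R \<gamma> xs D K))" by (simp add: f_def[abs_def] J_def)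
  have cont: "continuous_on (cball K \<rho>) f" if "K \<in> G" for K
    unfolding f_alt by (rule finite_cost_calculus(1)[OF Q R \<gamma> fin[OF that]])
  have deriv: "GDERIV f y :> d y" if "K \<in> G" "y \<in> ball K \<rho>" for K y
    unfolding d_def f_alt by (rule finite_cost_calculus(2)[OF Q R \<gamma> fin[OF that(1)] that(2)])
  have lip: "norm (d y - d K) \<le> L * norm (y - K)" if "K \<in> G" "y \<in> ball K \<rho>" for K y
    unfolding d_def f_def[abs_def]
    by (rule Lip_grad[rule_format, OF that(1)]) (use that(2) in \<open>simp add: dist_norm norm_minus_commute\<close>)
  have PL': "\<Delta> K \<le> 1 / \<mu> * (norm (d K))\<^sup>2" if "K \<in> G" for K
  proof -
    have "cost A B Q R \<gamma> xs D K < \<top>" using G_fin[OF that] by (simp add: J_def)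
    then have "sqrt \<gamma> * spectral_radius (A + B ** fst K) < 1"
      by (intro summable_imp_stable[OF \<gamma>(1)] finite_cost_imp_summable[OF Q R \<gamma>])
    then show ?thesis
      unfolding \<Delta>_def d_def f_def[abs_def] opt_def by (rule PL[rule_format])
  qed
  have descent: "0 \<le> \<Delta> K' \<and> \<Delta> K' \<le> \<Delta> K + d K \<bullet> (K' - K) + L / 2 * (norm (K' - K))\<^sup>2"
    if "K \<in> G" "norm (K' - K) \<le> \<rho>" for K K'
    using descent_inequality[OF cont[OF that(1)] deriv[OF that(1)] lip[OF that(1)] that(2)]
      \<Delta>_nonneg[OF near_fin[OF that]] by (simp add: \<Delta>_def)

  have eta_bounds: "ennreal \<eta> \<le> ennreal (real m * \<epsilon> * \<mu>) / (ennreal (240 * L) * estimator_variance G D z)"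
    "\<eta> \<le> 1 / (4 * L)" "ennreal \<eta> \<le> ennreal \<rho> / estimator_bound G D z"
    using eta_le L by (auto simp: ennreal_le_iff)
  define Z where "Z = enn2real (estimator_bound G D z)"
  define V where "V = enn2real (estimator_variance G D z)"
  have Z: "estimator_bound G D z < \<top>" "\<eta> * Z \<le> \<rho>"
    using le_ennreal_divideD[OF \<eta> _ eta_bounds(3)] \<rho> by (simp_all add: Z_def)
  have V_fin: "estimator_variance G D z < \<top>" and V: "\<eta> * (240 * L * V) \<le> real m * \<epsilon> * \<mu>"
  proof -
    note * = le_ennreal_divideD[OF \<eta> _ eta_bounds(1)]
    show "estimator_variance G D z < \<top>"
      using *(1) m \<epsilon> \<mu> L by (auto simp: ennreal_mult_less_top)
    show "\<eta> * (240 * L * V) \<le> real m * \<epsilon> * \<mu>"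
      using *(2) m \<epsilon> \<mu> L by (simp add: enn2real_mult V_def)
  qed
  have \<eta>L: "\<eta> * L \<le> 1" "4 * (\<eta> * L) \<le> 1" using eta_bounds(2) L \<eta> by (simp_all add: field_simps)

  have fstP: "fst \<in> borel_measurable P"
    using measurable_fst[of D "unif_sphere :: ('n, 'k) policy measure"] measurable_cong_sets[OF refl D(2), of P]
    unfolding P_def by blast
  have sndP: "snd \<in> borel_measurable P"
    using measurable_snd[of D "unif_sphere :: ('n, 'k) policy measure"] measurable_cong_sets[OF refl sets_unif_sphere, of P]
    unfolding P_def by blast
  have w_joint: "(\<lambda>(K, s). w K s) \<in> borel \<Otimes>\<^sub>M P \<rightarrow>\<^sub>M borel"
    unfolding w_def z_def Jx_def case_prod_beta'
    by (intro measurable_two_point measurable_fst measurable_compose[OF measurable_snd fstP] measurable_compose[OF measurable_snd sndP])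
  have w_meas: "w K \<in> borel_measurable P" for K
    using measurable_compose[OF measurable_Pair1' w_joint, of K] by simp
  have w_bound: "AE s in P. norm (w K s) \<le> Z" if "K \<in> G" for K
  proof -
    have "norm (w K s) \<le> Z" if s: "fst s \<in> msupport D" "snd s \<in> sphere 0 1" for s
    proof -
      have "ennreal (norm (z K (fst s) (snd s))) \<le> estimator_bound G D z"
        unfolding estimator_bound_def using \<open>K \<in> G\<close> s
        by (intro SUP_upper2[of K] SUP_upper2[of "fst s"] SUP_upper2[of "snd s"]) auto
      also have "\<dots> = ennreal Z" using Z(1) by (simp add: Z_def)
      finally show ?thesis by (simp add: w_def Z_def ennreal_le_iff)
    qed
    note * = this
    show ?thesis
      using AE_samples[OF D, where 'b="('n, 'k) policy"] unfolding P_def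
      by eventually_elim (elim conjE, rule *)
  qed
  have bias: "norm ((\<integral>s. w K s \<partial>P) - d K) \<le> L * r" if "K \<in> G" for K
    unfolding P_def w_def z_def Jx_def
  proof (rule estimator_bias[OF D r])
    have r\<rho>: "r \<le> \<rho>" using r_le by simp
    show "cost A B Q R \<gamma> xs D K' < \<top>" if "norm (K' - K) \<le> r" for K'
      using fin[OF \<open>K \<in> G\<close>] that r\<rho> by simp
    show "\<bar>enn2real (cost A B Q R \<gamma> xs D y) - enn2real (cost A B Q R \<gamma> xs D x) - d K \<bullet> (y - x)\<bar> \<le> L * r * norm (y - x)"
      if "norm (x - K) \<le> r" "norm (y - K) \<le> r" for x y
      using gradient_nearly_constant[OF cont[OF \<open>K \<in> G\<close>] deriv[OF \<open>K \<in> G\<close>] lip[OF \<open>K \<in> G\<close>] r\<rho> _ that] L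
      by (simp add: f_alt)
    show "AE s in D \<Otimes>\<^sub>M unif_sphere. norm (two_point (cost_from A B Q R \<gamma> xs) r K (fst s) (snd s)) \<le> Z"
      using w_bound[OF that] unfolding P_def w_def z_def Jx_def .
  qed
  have variance: "(\<integral>s. (norm (w K s - (\<integral>s. w K s \<partial>P)))\<^sup>2 \<partial>P) \<le> V" if "K \<in> G" for K
  proof -
    have "(\<integral>\<^sup>+s. ennreal ((norm (w K s - (\<integral>s. w K s \<partial>P)))\<^sup>2) \<partial>P) \<le> estimator_variance G D z"
      unfolding estimator_variance_def w_def P_def
      by (rule SUP_upper2[OF that]) (simp add: case_prod_beta')
    then have "enn2real (\<integral>\<^sup>+s. ennreal ((norm (w K s - (\<integral>s. w K s \<partial>P)))\<^sup>2) \<partial>P) \<le> V"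
      unfolding V_def using V_fin by (rule enn2real_mono)
    then show ?thesis using w_meas[of K] by (subst integral_eq_nn_integral) auto
  qed

  let ?it = "\<lambda>\<omega>. iterate z \<eta> m K0 (\<lambda>t i. X t i \<omega>) (\<lambda>t i. \<delta> t i \<omega>) T"
  have success: "J K - Jopt \<le> ennreal \<epsilon>" if "J K < \<top>" "\<Delta> K \<le> \<epsilon>" for K
    using that opt_nonneg by (simp add: J_eq Jopt_eq ennreal_minus \<Delta>_def ennreal_leI)
  show ?thesis
  proof (cases "T = 0")
    case True
    \<comment> \<open>No step is made, also when \<open>\<Delta>0 = 0\<close>, as then \<open>ln 0 = 0\<close>. The logarithm is then not positive, so the initial gap is already below \<open>\<epsilon>\<close>.\<close>
    have "\<Delta> K0 \<le> \<epsilon>"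
    proof (rule ccontr)
      assume "\<not> \<Delta> K0 \<le> \<epsilon>"
      then have "0 < ln (120 * \<Delta>0 / \<epsilon>)" using \<epsilon> by (intro ln_gt_zero) (simp add: \<Delta>0)
      then have "0 < 4 / (\<mu> * \<eta>) * ln (120 * \<Delta>0 / \<epsilon>)" using \<mu> \<eta> by simp
      then have "0 < T" unfolding T_def by simp
      with True show False by simp
    qed
    then show ?thesis using True success[OF J_K0] by (simp add: M.prob_space)
  next
    case False
    define c where "c = \<eta> * \<mu> / 2"
    have T_eq: "T = nat \<lceil>2 / c * ln (120 * \<Delta> K0 / \<epsilon>)\<rceil>"
      using \<mu> \<eta> by (simp add: T_def \<Delta>0 c_def mult.commute)
    have c: "0 < c" using \<mu> \<eta> by (simp add: c_def)
    have "0 < 2 / c * ln (120 * \<Delta> K0 / \<epsilon>)" using False unfolding T_eq by simp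
    then have lnpos: "0 < ln (120 * \<Delta> K0 / \<epsilon>)" by (rule zero_less_mult_pos) (use c in simp)
    have \<Delta>K0: "0 < \<Delta> K0"
    proof (rule ccontr)
      assume "\<not> 0 < \<Delta> K0"
      then have "\<Delta> K0 = 0" using \<Delta>_nonneg[OF J_K0] by simp
      then show False using lnpos by simp
    qed
    then have large: "\<epsilon> \<le> 120 * \<Delta> K0" using lnpos \<epsilon> by (simp add: ln_gt_zero_iff)
    have "\<mu> \<le> 2 * L"
    proof (rule PL_constant_le_smoothness[where f=\<Delta> and d=d, OF K0 \<Delta>K0 \<rho> L \<mu>])
      show "continuous_on (cball K \<rho>) \<Delta>" if "K \<in> G" for K
        unfolding \<Delta>_def[abs_def] by (intro continuous_intros cont that)
      show "K' \<in> G" if "K \<in> G" "norm (K' - K) \<le> \<rho>" "\<Delta> K' \<le> \<Delta> K" for K K'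
        using that G_iff[OF near_fin[OF that(1,2)]] G_iff[OF G_fin[OF that(1)]] by (simp add: \<Delta>_def)
    qed (fact descent[THEN conjunct1] descent[THEN conjunct2] PL')+
    then have "\<eta> * \<mu> \<le> \<eta> * (2 * L)" using \<eta> by (intro mult_left_mono) auto
    then have c1: "c \<le> 1" using \<eta>L by (simp add: c_def)
    have f_meas: "f \<in> borel_measurable borel"
      unfolding f_alt using measurable_cost[OF D] by measurable
    interpret SD: stopped_descent P w G \<Delta> K0 \<eta> c \<epsilon> "10 * f K0" m
    proof (rule stopped_descent.intro)
      show "G \<in> sets borel" unfolding G_def J_def using measurable_cost[OF D] by measurable
      show "\<Delta> \<in> borel_measurable borel" unfolding \<Delta>_def[abs_def] using f_meas by measurable
      show "0 \<le> \<Delta> K \<and> \<Delta> K \<le> 10 * f K0" if "K \<in> G" for K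
        using \<Delta>_nonneg[OF G_fin[OF that]] G_iff[OF G_fin[OF that]] that opt_nonneg by (simp add: \<Delta>_def)
    qed (fact P w_joint K0 \<Delta>K0 c c1 \<epsilon>)+
    \<comment> \<open>Squared bias and variance each contribute at most \<open>\<eta> \<epsilon> \<mu> / 480\<close>.\<close>
    have noise_le: "\<eta> / 2 * (L * r)\<^sup>2 + L * \<eta>\<^sup>2 / (2 * real m) * V \<le> c * \<epsilon> / 120"
    proof -
      have "r \<le> sqrt (\<epsilon> * \<mu> / (240 * L\<^sup>2))" using r_le by simp
      then have "r\<^sup>2 \<le> (sqrt (\<epsilon> * \<mu> / (240 * L\<^sup>2)))\<^sup>2" using r by (intro power_mono) auto
      then have "r\<^sup>2 \<le> \<epsilon> * \<mu> / (240 * L\<^sup>2)" using \<epsilon> \<mu> by simp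
      then have "(L * r)\<^sup>2 \<le> \<epsilon> * \<mu> / 240" using L by (simp add: power_mult_distrib field_simps)
      then have bias_le: "\<eta> / 2 * (L * r)\<^sup>2 \<le> \<eta> / 2 * (\<epsilon> * \<mu> / 240)" using \<eta> by (intro mult_left_mono) auto
      have "L * \<eta>\<^sup>2 / (2 * real m) * V = \<eta> / (480 * real m) * (\<eta> * (240 * L * V))"
        by (simp add: power2_eq_square)
      also have "\<dots> \<le> \<eta> / (480 * real m) * (real m * \<epsilon> * \<mu>)"
        using V \<eta> by (intro mult_left_mono) auto
      also have "\<dots> = \<eta> / 2 * (\<epsilon> * \<mu> / 240)" using m by simp
      finally have "\<eta> / 2 * (L * r)\<^sup>2 + L * \<eta>\<^sup>2 / (2 * real m) * V
        \<le> \<eta> / 2 * (\<epsilon> * \<mu> / 240) + \<eta> / 2 * (\<epsilon> * \<mu> / 240)"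
        by (rule add_mono[OF bias_le])
      also have "\<dots> = c * \<epsilon> / 120" by (simp add: c_def)
      finally show ?thesis .
    qed
    have step_eq: "SD.step t K = (\<lambda>y. K - \<eta> *\<^sub>R ((1 / real (card ({t} \<times> {1..m}))) *\<^sub>R (\<Sum>p\<in>{t} \<times> {1..m}. w K (y p))))" for t K
    proof -
      have "{t} \<times> {1..m} = Pair t ` {1..m}" by auto
      then have "(\<Sum>p\<in>{t} \<times> {1..m}. w K (y p)) = (\<Sum>i=1..m. w K (y (t, i)))" for y
        by (simp add: sum.reindex inj_on_def)
      then show ?thesis by (simp add: SD.step_def fun_eq_iff card_cartesian_product_singleton)
    qed
    have one_step: "AE y in SD.batch t. norm (SD.step t K y - K) \<le> \<rho>"
      "integrable (SD.batch t) (\<lambda>y. \<Delta> (SD.step t K y))"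
      "(\<integral>y. \<Delta> (SD.step t K y) \<partial>SD.batch t) \<le> (1 - c) * \<Delta> K + c * \<epsilon> / 120" if K: "K \<in> G" for t K
    proof -
      have I: "finite ({t} \<times> {1..m})" "{t} \<times> {1..m} \<noteq> {}" and card: "card ({t} \<times> {1..m}) = m"
        using m by (auto simp: card_cartesian_product_singleton)
      note ed = expected_descent[OF P w_meas w_bound[OF K] I SD.\<Delta> descent[OF K] \<eta> Z(2) \<eta>L(1) bias[OF K]]
      show "AE y in SD.batch t. norm (SD.step t K y - K) \<le> \<rho>"
        unfolding step_eq SD.batch_def by (rule ed(1))
      show "integrable (SD.batch t) (\<lambda>y. \<Delta> (SD.step t K y))"
        unfolding step_eq SD.batch_def by (rule ed(2))
      have "(\<integral>y. \<Delta> (SD.step t K y) \<partial>SD.batch t) \<le> \<Delta> K - \<eta> / 2 * (norm (d K))\<^sup>2 + \<eta> / 2 * (L * r)\<^sup>2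
         + L * \<eta>\<^sup>2 / (2 * real m) * (\<integral>s. (norm (w K s - (\<integral>s. w K s \<partial>P)))\<^sup>2 \<partial>P)"
        using ed(3) unfolding step_eq SD.batch_def card .
      also have "\<dots> \<le> \<Delta> K - \<eta> / 2 * (norm (d K))\<^sup>2 + \<eta> / 2 * (L * r)\<^sup>2 + L * \<eta>\<^sup>2 / (2 * real m) * V"
        using variance[OF K] L by (intro add_left_mono mult_left_mono) auto
      also have "\<dots> \<le> \<Delta> K - \<eta> / 2 * (norm (d K))\<^sup>2 + c * \<epsilon> / 120" using noise_le by simp
      also have "\<dots> \<le> \<Delta> K - c * \<Delta> K + c * \<epsilon> / 120"
      proof -
        have "\<mu> * \<Delta> K \<le> (norm (d K))\<^sup>2" using PL'[OF K] \<mu> by (simp add: field_simps)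
        then have "\<eta> / 2 * (\<mu> * \<Delta> K) \<le> \<eta> / 2 * (norm (d K))\<^sup>2" using \<eta> by (intro mult_left_mono) auto
        then show ?thesis by (simp add: c_def)
      qed
      finally show "(\<integral>y. \<Delta> (SD.step t K y) \<partial>SD.batch t) \<le> (1 - c) * \<Delta> K + c * \<epsilon> / 120"
        by (simp add: algebra_simps)
    qed
    have exits: "AE y in SD.batch t. 0 \<le> \<Delta> (SD.step t K y) \<and> (SD.step t K y \<notin> G \<longrightarrow> 10 * \<Delta> K0 \<le> \<Delta> (SD.step t K y))"
      if K: "K \<in> G" for t K
      using one_step(1)[OF K, of t]
    proof eventually_elim
      case (elim y)
      have fin': "J (SD.step t K y) < \<top>" by (rule near_fin[OF K elim])
      show ?case using \<Delta>_nonneg[OF fin'] G_iff[OF fin'] opt_nonneg by (auto simp: \<Delta>_def)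
    qed
    have main: "3 / 4 \<le> measure (SD.past T) {y \<in> space (SD.past T). SD.stopped T y \<in> G \<and> \<Delta> (SD.stopped T y) \<le> \<epsilon>}"
      unfolding T_eq
      by (rule SD.descent_success_probability[OF exits one_step(2,3) large]) (use tol in \<open>simp_all add: \<Delta>0\<close>)
    let ?I = "{..<T} \<times> {1..m}"
    let ?s = "\<lambda>p \<omega>. (X (fst p) (snd p) \<omega>, \<delta> (fst p) (snd p) \<omega>)"
    define Y where "Y \<omega> = (\<lambda>p\<in>?I. ?s p \<omega>)" for \<omega>
    have ind: "M.indep_vars (\<lambda>_. P) ?s ?I"
      using indep unfolding P_def by (simp add: case_prod_beta')
    have rv: "?s p \<in> M \<rightarrow>\<^sub>M P" if "p \<in> ?I" for p
      using ind that unfolding M.indep_vars_def by blast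
    have Y_meas: "Y \<in> M \<rightarrow>\<^sub>M SD.past T"
      unfolding Y_def SD.past_def by (intro measurable_restrict rv)
    \<comment> \<open>The event depends on the samples through their joint law alone, and this is the product law of the abstract process.\<close>
    have Y_law: "distr M (SD.past T) Y = SD.past T"
    proof -
      have ne: "?I \<noteq> {}" using False m by auto
      have "distr M (PiM ?I (\<lambda>_. P)) (\<lambda>\<omega>. \<lambda>p\<in>?I. ?s p \<omega>) = PiM ?I (\<lambda>p. distr M P (?s p))"
        by (rule iffD1[OF M.indep_vars_iff_distr_eq_PiM'[where I="?I" and X="?s" and M'="\<lambda>_. P", OF ne rv] ind])
      also have "\<dots> = PiM ?I (\<lambda>_. P)"
        using law unfolding P_def by (intro PiM_cong refl) auto
      finally show ?thesis unfolding SD.past_def Y_def .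
    qed
    have it_path: "iterate z \<eta> m K0 (\<lambda>t i. X t i \<omega>) (\<lambda>t i. \<delta> t i \<omega>) t = SD.path t (Y \<omega>)" if "t \<le> T" for t \<omega>
      using that
    proof (induction t)
      case (Suc t)
      have "(\<Sum>i=1..m. z K (X t i \<omega>) (\<delta> t i \<omega>)) = (\<Sum>i=1..m. w K (Y \<omega> (t, i)))" for K
        using Suc.prems by (intro sum.cong refl) (auto simp: w_def Y_def)
      with Suc show ?case by (simp add: SD.step_def)
    qed simp
    have it_meas: "?it \<in> borel_measurable M"
      unfolding it_path[OF order_refl] by (rule measurable_compose[OF Y_meas SD.measurable_path])
    have J_meas: "J \<in> borel_measurable borel" unfolding J_def by (rule measurable_cost[OF D])
    have Jit: "(\<lambda>\<omega>. J (?it \<omega>)) \<in> borel_measurable M" by (rule measurable_compose[OF it_meas J_meas])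
    let ?good = "{y \<in> space (SD.past T). SD.stopped T y \<in> G \<and> \<Delta> (SD.stopped T y) \<le> \<epsilon>}"
    have good_sets: "?good \<in> sets (SD.past T)" by measurable
    have "3 / 4 \<le> measure (distr M (SD.past T) Y) ?good" using main unfolding Y_law .
    also have "\<dots> = measure M (Y -` ?good \<inter> space M)" by (rule measure_distr[OF Y_meas good_sets])
    also have "\<dots> \<le> measure M {\<omega> \<in> space M. J (?it \<omega>) - Jopt \<le> ennreal \<epsilon>}"
    proof (rule M.finite_measure_mono)
      show "Y -` ?good \<inter> space M \<subseteq> {\<omega> \<in> space M. J (?it \<omega>) - Jopt \<le> ennreal \<epsilon>}"
      proof
        fix \<omega> assume "\<omega> \<in> Y -` ?good \<inter> space M"
        then have \<omega>: "\<omega> \<in> space M" "SD.stopped T (Y \<omega>) \<in> G" "\<Delta> (SD.stopped T (Y \<omega>)) \<le> \<epsilon>" by auto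
        have "?it \<omega> = SD.stopped T (Y \<omega>)"
          unfolding it_path[OF order_refl] by (rule SD.stopped_in_imp_path[OF \<omega>(2)])
        then show "\<omega> \<in> {\<omega> \<in> space M. J (?it \<omega>) - Jopt \<le> ennreal \<epsilon>}"
          using \<omega> success[OF G_fin[OF \<omega>(2)] \<omega>(3)] by simp
      qed
      show "{\<omega> \<in> space M. J (?it \<omega>) - Jopt \<le> ennreal \<epsilon>} \<in> sets M" using Jit by measurable
    qed
    finally show ?thesis .
  qed
qed

end
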